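(* Consider the SI-ADMM algorithm described in the context. Suppose that: (1) the problem has a KKT point; (2) $Q$ and $\hat P=P+\rho A^TA$ are symmetric with $\hat P\succ0$ and $Q\succ0$; (3) $f$ and $g$ are strongly convex with constants $\mu_f$ and $\sigma_g$ respectively, and are continuously differentiable with Lipschitz continuous gradients with constants $L_f$ and $L_g$ respectively; (4) the matrix $[A\ \ B]$ has full row rank; (5) the moment assumption holds: with $w^x=\nabla_x\tilde f(x,\xi)-\nabla_xf(x)$ and $w^y=\nabla_y\tilde g(y,\xi)-\nabla_yg(y)$, there are constants $v_1^x,v_2^x,v_1^y,v_2^y$ such that for all $x\in\mathbb{R}^n$, $y\in\mathbb{R}^m$: $\mathbb{E}[w^x]=0$, $\mathbb{E}[w^y]=0$, $\mathbb{E}[\|w^x\|^2]\le v_1^x\|x\|^2+v_2^x$ and $\mathbb{E}[\|w^y\|^2]\le v_1^y\|y\|^2+v_2^y$; (6) if $P\ne0$ then $(2-\gamma)P\succ(\gamma-1)\rho A^TA$, and if $P=0$ then $\gamma=1$. Let $u^*=(x^*;y^*;\lambda^* )$ denote the KKT point, which is unique under these assumptions, and suppose $\mathbb{E}[\|u_0-u^*\|_G^2]<\infty$. Suppose further that for all $k\ge0$, $T_{k+1}^y=\max\{K_y,\lceil T/\eta^k\rceil\}$ and $T_{k+1}^x=\max\{K_x,\lceil T/\eta^k\rceil\}$, where $0<\eta<1$ and $T>0$. Then the following hold. (i) $\mathbb{E}[\|u_k-u^*\|_G^2]\to0$ geometrically as $k\to\infty$, i.e. there exist constants $D>0$ and $q\in(0,1)$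 such that $\mathbb{E}[\|u_k-u^*\|_G^2]\le Dq^k$ for all $k$. (ii) Assume $\eta>\frac1{1+\delta}$, where $\delta>0$ is a constant such that $\|u_{k+1}^*-u^*\|_G^2\le\frac1{1+\delta}\|u_k-u^*\|_G^2$ for all $k\ge0$ (with $u_{k+1}^*$ the exact ADMM update from $u_k$, defined in the context). Then, for precision $\epsilon\le1/e$, the overall iteration (sample) complexity $N(\epsilon)$ of the algorithm to obtain an $\epsilon$-solution, i.e. $\mathbb{E}[\|u_k-u^*\|_G^2]\le\epsilon$, is $\mathcal{O}(1/\epsilon)$.
   Context: Problem: $\min_{x\in\mathbb{R}^n,y\in\mathbb{R}^m}\ f(x)+g(y)$ subject to $Ax+By=b$, where $f(x)=\mathbb{E}[\tilde f(x,\xi)]$, $g(y)=\mathbb{E}[\tilde g(y,\xi)]$, $\xi$ is a random vector in $\mathbb{R}^d$ with range $\Xi$, $\tilde f(\cdot,\xi)$ and $\tilde g(\cdot,\xi)$ are convex for every $\xi\in\Xi$, $A\in\mathbb{R}^{p\times n}$, $B\in\mathbb{R}^{p\times m}$, $b\in\mathbb{R}^p$. A KKT point is a triple $u^*=(x^*;y^*;\lambda^* )$ with $A^T\lambda^*\in\partial f(x^* )$, $B^T\lambda^*\in\partial g(y^* )$, $Ax^*+By^*=b$. Augmented Lagrangian: $\mathcal{L}_\rho(x,y,\lambda)=f(x)+g(y)-\lambda^T(Ax+By-b)+\frac\rho2\|Ax+By-b\|^2$. Let $\tilde{\mathcal{L}}_1(x,y,\lambda,\xi)$ be the same expression with $f(x)$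 replaced by $\tilde f(x,\xi)$, and $\tilde{\mathcal{L}}_2(x,y,\lambda,\xi)$ the same expression with $g(y)$ replaced by $\tilde g(y,\xi)$. SI-ADMM algorithm: fix matrices $P\in\mathbb{R}^{n\times n}$, $Q\in\mathbb{R}^{m\times m}$, positive scalars $\rho,\gamma,\gamma_x,\gamma_y$, positive integers $T_{k+1}^x,T_{k+1}^y$ ($k\ge0$), and an initial point $u_0=(x_0;y_0;\lambda_0)$ independent of the samples below. For $k=0,1,2,\dots$: set $y_{k,1}=y_k$ and, for $j=1,\dots,T_{k+1}^y-1$, $y_{k,j+1}=y_{k,j}-\frac{\gamma_y}{j}\left[\nabla_y\tilde{\mathcal{L}}_2(x_k,y_{k,j},\lambda_k,\xi^y_{k,j})+Q(y_{k,j}-y_k)\right]$; let $y_{k+1}=y_{k,T_{k+1}^y}$; set $x_{k,1}=x_k$ and, for $j=1,\dots,T_{k+1}^x-1$, $x_{k,j+1}=x_{k,j}-\frac{\gamma_x}{j}\left[\nabla_x\tilde{\mathcal{L}}_1(x_{k,j},y_{k+1},\lambda_k,\xi^x_{k,j})+P(x_{k,j}-x_k)\right]$; let $x_{k+1}=x_{k,T_{k+1}^x}$; $\lambda_{k+1}=\lambda_k-\gamma\rho(Ax_{k+1}+By_{k+1}-b)$. The samples $\{\xi^y_{k,j},\xi^x_{k,j}\}$ are i.i.d. copies of $\xi$. Write $u_k=(x_k;y_k;\lambda_k)$. Exact update: $y_{k+1}^*=\arg\min_y\{\mathcal{L}_\rho(x_k,y,\lambda_k)+\frac12\|y-y_k\|_Q^2\}$,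 $x_{k+1}^*=\arg\min_x\{\mathcal{L}_\rho(x,y_{k+1}^*,\lambda_k)+\frac12\|x-x_k\|_P^2\}$, $\lambda_{k+1}^*=\lambda_k-\gamma\rho(Ax_{k+1}^*+By_{k+1}^*-b)$, $u_{k+1}^*=(x_{k+1}^*;y_{k+1}^*;\lambda_{k+1}^* )$. (Under the stated assumptions, a constant $\delta>0$ with the contraction property used in (ii) exists, by the known linear convergence theorem for generalized ADMM.) Notation: $\hat P=P+\rho A^TA$; $G$ is the block-diagonal matrix with blocks $\hat P$, $Q$, $\frac1{\rho\gamma}I_p$; $\|z\|_M^2=z^TMz$. Constants: $c_y$ and $L_y$ are, respectively, a strong convexity constant in $y$ of $\mathcal{L}_\rho(x,y,\lambda)+\frac12\|y-z\|_Q^2$ and a Lipschitz constant in $y$ of its $y$-gradient, both independent of $x,y,\lambda,z$; $c_x$ and $L_x$ are, respectively, a strong convexity constant in $x$ of $\mathcal{L}_\rho(x,y,\lambda)+\frac12\|x-z\|_P^2$ and a Lipschitz constant in $x$ of its $x$-gradient, both independent of $x,y,\lambda,z$. It is assumed that $2c_x\gamma_x>1$ and $2c_y\gamma_y>1$. Fix $R>0$ and set $M_y=L_y^2+v_1^y(1+\frac1R)$, $K_y=\left\lceil\frac{\gamma_y^2M_y}{2c_y\gamma_y-1}\right\rceil+1$, $M_x=L_x^2+v_1^x(1+\frac1R)$, $K_x=\left\lceil\frac{\gamma_x^2M_x}{2c_x\gamma_x-1}\right\rceil+1$. Complexity: for $\epsilon>0$ let $\bar K(\epsilon)=\min\{K:\mathbb{E}[\|u_k-u^*\|_G^2]\le\epsilon\text{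 for all }k\ge K\}$; the overall iteration (sample) complexity is the total number of inner stochastic gradient steps (equivalently sampled gradients) up to that major iteration, $N(\epsilon)=\sum_{k=1}^{\bar K(\epsilon)}\left((T_k^y-1)+(T_k^x-1)\right)$. *)

theory Defs
  imports "HOL-Probability.Probability"
begin

definition grad :: "('v::real_inner \<Rightarrow> real) \<Rightarrow> 'v \<Rightarrow> 'v" where
  "grad f x = (THE D. GDERIV f x :> D)"

text \<open>\<^const>\<open>grad\<close> is unspecified where the function is not differentiable, so
  differentiability is always stated separately.\<close>

definition lipschitz_gradient :: "real \<Rightarrow> ('v::real_inner \<Rightarrow> real) \<Rightarrow> bool" where
  "lipschitz_gradient L f \<longleftrightarrow> (\<forall>x. f differentiable (at x)) \<and> L-lipschitz_on UNIV (grad f)"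

text \<open>Normalised so that, for differentiable functions, it amounts to
  \<open>(grad f x - grad f y) \<bullet> (x - y) \<ge> c * (norm (x - y))\<^sup>2\<close>.\<close>

definition strongly_convex :: "real \<Rightarrow> ('v::real_inner \<Rightarrow> real) \<Rightarrow> bool" where
  "strongly_convex c f \<longleftrightarrow> 0 < c \<and>
     (\<forall>x y t. 0 \<le> t \<and> t \<le> 1 \<longrightarrow>
        f ((1 - t) *\<^sub>R x + t *\<^sub>R y)
          \<le> (1 - t) * f x + t * f y - c / 2 * t * (1 - t) * (norm (x - y))\<^sup>2)"

definition subdifferential :: "('v::real_inner \<Rightarrow> real) \<Rightarrow> 'v \<Rightarrow> 'v set" where
  "subdifferential f x = {v. \<forall>z. f z \<ge> f x + v \<bullet> (z - x)}"

definition pos_def_mat :: "real^'n^'n \<Rightarrow> bool" where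
  "pos_def_mat M \<longleftrightarrow> transpose M = M \<and> (\<forall>z. z \<noteq> 0 \<longrightarrow> 0 < z \<bullet> (M *v z))"

text \<open>Written \<open>\<parallel>z\<parallel>\<^sub>M\<^sup>2\<close> in the literature, although \<open>M\<close> may be indefinite.\<close>

definition qform :: "real^'n^'n \<Rightarrow> real^'n \<Rightarrow> real" where
  "qform M z = z \<bullet> (M *v z)"

definition hconcat :: "real^'n^'p \<Rightarrow> real^'m^'p \<Rightarrow> real^('n + 'm)^'p" where
  "hconcat A B = (\<chi> i j. case j of Inl a \<Rightarrow> A $ i $ a | Inr c \<Rightarrow> B $ i $ c)"

definition is_KKT ::
  "real^'n^'p \<Rightarrow> real^'m^'p \<Rightarrow> real^'p \<Rightarrow> (real^'n \<Rightarrow> real) \<Rightarrow> (real^'m \<Rightarrow> real)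
    \<Rightarrow> (real^'n) \<times> (real^'m) \<times> (real^'p) \<Rightarrow> bool" where
  "is_KKT A B b f g u \<longleftrightarrow> (case u of (x, y, l) \<Rightarrow>
     transpose A *v l \<in> subdifferential f x \<and>
     transpose B *v l \<in> subdifferential g y \<and>
     A *v x + B *v y = b)"

definition aug_lag ::
  "real^'n^'p \<Rightarrow> real^'m^'p \<Rightarrow> real^'p \<Rightarrow> real \<Rightarrow> (real^'n \<Rightarrow> real) \<Rightarrow> (real^'m \<Rightarrow> real)
    \<Rightarrow> real^'n \<Rightarrow> real^'m \<Rightarrow> real^'p \<Rightarrow> real" where
  "aug_lag A B b \<rho> f g x y l =
     f x + g y - l \<bullet> (A *v x + B *v y - b) + \<rho> / 2 * (norm (A *v x + B *v y - b))\<^sup>2"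

definition P_hat :: "real^'n^'p \<Rightarrow> real \<Rightarrow> real^'n^'n \<Rightarrow> real^'n^'n" where
  "P_hat A \<rho> P = P + \<rho> *\<^sub>R (transpose A ** A)"

text \<open>The squared norm for the block-diagonal matrix with blocks
  \<^term>\<open>P_hat A \<rho> P\<close>, \<open>Q\<close> and \<open>(1 / (\<rho> * \<gamma>)) I\<close>.\<close>

definition G_sqnorm ::
  "real^'n^'p \<Rightarrow> real \<Rightarrow> real \<Rightarrow> real^'n^'n \<Rightarrow> real^'m^'m
    \<Rightarrow> (real^'n) \<times> (real^'m) \<times> (real^'p) \<Rightarrow> real" where
  "G_sqnorm A \<rho> \<gamma> P Q u = (case u of (x, y, l) \<Rightarrow>
     qform (P_hat A \<rho> P) x + qform Q y + qform (mat (1 / (\<rho> * \<gamma>))) l)"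

definition exact_update ::
  "real^'n^'p \<Rightarrow> real^'m^'p \<Rightarrow> real^'p \<Rightarrow> real \<Rightarrow> real \<Rightarrow> real^'n^'n \<Rightarrow> real^'m^'m
    \<Rightarrow> (real^'n \<Rightarrow> real) \<Rightarrow> (real^'m \<Rightarrow> real)
    \<Rightarrow> (real^'n) \<times> (real^'m) \<times> (real^'p) \<Rightarrow> (real^'n) \<times> (real^'m) \<times> (real^'p)" where
  "exact_update A B b \<rho> \<gamma> P Q f g u = (case u of (x, y, l) \<Rightarrow>
     let y' = arg_min (\<lambda>v. aug_lag A B b \<rho> f g x v l + 1/2 * qform Q (v - y)) (\<lambda>_. True);
         x' = arg_min (\<lambda>v. aug_lag A B b \<rho> f g v y' l + 1/2 * qform P (v - x)) (\<lambda>_. True)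
     in (x', y', l - (\<gamma> * \<rho>) *\<^sub>R (A *v x' + B *v y' - b)))"

text \<open>One realisation of the algorithm: \<open>sx k j\<close> and \<open>sy k j\<close> are the realised samples,
  \<open>xi k j\<close> and \<open>yi k j\<close> the inner iterates (\<open>j \<ge> 1\<close>), and \<open>x k\<close>, \<open>y k\<close>, \<open>l k\<close> the outer ones.\<close>

definition si_admm_path ::
  "real^'n^'p \<Rightarrow> real^'m^'p \<Rightarrow> real^'p \<Rightarrow> real \<Rightarrow> real \<Rightarrow> real \<Rightarrow> real \<Rightarrow> real^'n^'n \<Rightarrow> real^'m^'m
    \<Rightarrow> (real^'n \<Rightarrow> real) \<Rightarrow> (real^'m \<Rightarrow> real)
    \<Rightarrow> (real^'n \<Rightarrow> real^'d \<Rightarrow> real) \<Rightarrow> (real^'m \<Rightarrow> real^'d \<Rightarrow> real)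
    \<Rightarrow> (nat \<Rightarrow> nat) \<Rightarrow> (nat \<Rightarrow> nat)
    \<Rightarrow> (nat \<Rightarrow> nat \<Rightarrow> real^'d) \<Rightarrow> (nat \<Rightarrow> nat \<Rightarrow> real^'d)
    \<Rightarrow> (nat \<Rightarrow> nat \<Rightarrow> real^'n) \<Rightarrow> (nat \<Rightarrow> nat \<Rightarrow> real^'m)
    \<Rightarrow> (nat \<Rightarrow> real^'n) \<Rightarrow> (nat \<Rightarrow> real^'m) \<Rightarrow> (nat \<Rightarrow> real^'p) \<Rightarrow> bool" where
  "si_admm_path A B b \<rho> \<gamma> \<gamma>x \<gamma>y P Q f g ft gt Tx Ty sx sy xi yi x y l \<longleftrightarrow> (\<forall>k.
     yi k 1 = y k \<and>
     (\<forall>j\<in>{1..<Ty (Suc k)}. yi k (Suc j) = yi k j - (\<gamma>y / real j) *\<^sub>R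
        (grad (\<lambda>v. aug_lag A B b \<rho> f (\<lambda>w. gt w (sy k j)) (x k) v (l k)) (yi k j)
          + Q *v (yi k j - y k))) \<and>
     y (Suc k) = yi k (Ty (Suc k)) \<and>
     xi k 1 = x k \<and>
     (\<forall>j\<in>{1..<Tx (Suc k)}. xi k (Suc j) = xi k j - (\<gamma>x / real j) *\<^sub>R
        (grad (\<lambda>v. aug_lag A B b \<rho> (\<lambda>w. ft w (sx k j)) g v (y (Suc k)) (l k)) (xi k j)
          + P *v (xi k j - x k))) \<and>
     x (Suc k) = xi k (Tx (Suc k)) \<and>
     l (Suc k) = l k - (\<gamma> * \<rho>) *\<^sub>R (A *v x (Suc k) + B *v y (Suc k) - b))"

text \<open>The samples that are actually drawn, as one family: \<open>Inl (k, j)\<close> indexes the samples of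
  the \<open>x\<close>-loops, \<open>Inr (k, j)\<close> those of the \<open>y\<close>-loops.\<close>

definition sample_index :: "(nat \<Rightarrow> nat) \<Rightarrow> (nat \<Rightarrow> nat) \<Rightarrow> (nat \<times> nat + nat \<times> nat) set" where
  "sample_index Tx Ty =
     {Inl (k, j) | k j. j \<in> {1..<Tx (Suc k)}} \<union> {Inr (k, j) | k j. j \<in> {1..<Ty (Suc k)}}"

definition samples ::
  "(nat \<Rightarrow> nat \<Rightarrow> 'w \<Rightarrow> 's) \<Rightarrow> (nat \<Rightarrow> nat \<Rightarrow> 'w \<Rightarrow> 's) \<Rightarrow> nat \<times> nat + nat \<times> nat \<Rightarrow> 'w \<Rightarrow> 's" where
  "samples \<xi>x \<xi>y = case_sum (\<lambda>(k, j). \<xi>x k j) (\<lambda>(k, j). \<xi>y k j)"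

definition iid_copies ::
  "'w measure \<Rightarrow> 's measure \<Rightarrow> ('w \<Rightarrow> 's) \<Rightarrow> ('i \<Rightarrow> 'w \<Rightarrow> 's) \<Rightarrow> 'i set \<Rightarrow> bool" where
  "iid_copies M S \<xi> X I \<longleftrightarrow>
     prob_space.indep_vars M (\<lambda>_. S) X I \<and> (\<forall>i\<in>I. distr M S (X i) = distr M S \<xi>)"

text \<open>\<^const>\<open>prob_space.indep_var\<close> requires both variables to have values in the same type.\<close>

definition indep_rv ::
  "'w measure \<Rightarrow> 's measure \<Rightarrow> ('w \<Rightarrow> 's) \<Rightarrow> 't measure \<Rightarrow> ('w \<Rightarrow> 't) \<Rightarrow> bool" where
  "indep_rv M S X N Y \<longleftrightarrow> X \<in> M \<rightarrow>\<^sub>M S \<and> Y \<in> M \<rightarrow>\<^sub>M N \<and>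
     prob_space.indep_set M {X -` C \<inter> space M | C. C \<in> sets S} {Y -` C \<inter> space M | C. C \<in> sets N}"

text \<open>Moment condition on the gradient noise. The Bochner integral of a non-integrable function
  is 0, so integrability is part of the condition.\<close>

definition noise_moments ::
  "'w measure \<Rightarrow> ('w \<Rightarrow> 's) \<Rightarrow> ('v::euclidean_space \<Rightarrow> 's \<Rightarrow> real) \<Rightarrow> ('v \<Rightarrow> real)
    \<Rightarrow> real \<Rightarrow> real \<Rightarrow> bool" where
  "noise_moments M \<xi> ft f v1 v2 \<longleftrightarrow> (\<forall>x.
     let w = (\<lambda>\<omega>. grad (\<lambda>z. ft z (\<xi> \<omega>)) x - grad f x) in
       has_bochner_integral M w 0 \<and>
       integrable M (\<lambda>\<omega>. (norm (w \<omega>))\<^sup>2) \<and>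
       (\<integral>\<omega>. (norm (w \<omega>))\<^sup>2 \<partial>M) \<le> v1 * (norm x)\<^sup>2 + v2)"

text \<open>\<open>\<Xi>\<close> need not be a Borel set, hence the trace sigma-algebra.\<close>

definition stochastic_objective ::
  "'w measure \<Rightarrow> ('s::topological_space) set \<Rightarrow> ('w \<Rightarrow> 's)
    \<Rightarrow> ('v::euclidean_space \<Rightarrow> 's \<Rightarrow> real) \<Rightarrow> ('v \<Rightarrow> real) \<Rightarrow> bool" where
  "stochastic_objective M \<Xi> \<xi> ft f \<longleftrightarrow>
     (\<forall>s\<in>\<Xi>. convex_on UNIV (\<lambda>x. ft x s) \<and> (\<forall>x. (\<lambda>z. ft z s) differentiable (at x))) \<and>
     (\<forall>x. ft x \<in> borel_measurable (restrict_space borel \<Xi>)) \<and>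
     (\<forall>x. integrable M (\<lambda>\<omega>. ft x (\<xi> \<omega>)) \<and> f x = (\<integral>\<omega>. ft x (\<xi> \<omega>) \<partial>M))"

definition inner_threshold :: "real \<Rightarrow> real \<Rightarrow> real \<Rightarrow> real \<Rightarrow> real \<Rightarrow> nat" where
  "inner_threshold c L v1 R \<gamma>' =
     nat \<lceil>\<gamma>'\<^sup>2 * (L\<^sup>2 + v1 * (1 + 1 / R)) / (2 * c * \<gamma>' - 1)\<rceil> + 1"

text \<open>\<open>e k\<close> stands for the mean squared error of the \<open>k\<close>-th outer iterate.\<close>

definition major_iterations :: "(nat \<Rightarrow> real) \<Rightarrow> real \<Rightarrow> nat" where
  "major_iterations e \<epsilon> = (LEAST K. \<forall>k\<ge>K. e k \<le> \<epsilon>)"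

definition sample_complexity :: "(nat \<Rightarrow> real) \<Rightarrow> (nat \<Rightarrow> nat) \<Rightarrow> (nat \<Rightarrow> nat) \<Rightarrow> real \<Rightarrow> nat" where
  "sample_complexity e Tx Ty \<epsilon> = (\<Sum>k = 1..major_iterations e \<epsilon>. (Ty k - 1) + (Tx k - 1))"

end

theory Submission
  imports Defs
begin

text \<open>The proof compares the algorithm with the exact method, which contracts, and bounds the
  distance between the two in mean square.

  \<^bold>\<open>The exact method contracts.\<close> Write \<open>u' = (x', y', \<lambda>')\<close> for the exact update of an
  arbitrary point \<open>u\<close>. Its two stationarity conditions, subtracted from the KKT conditions and
  tested with \<open>x' - x\<^sup>*\<close> and \<open>y' - y\<^sup>*\<close>, show that the squared G-distance to \<open>u\<^sup>*\<close> drops by at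
  least a quadratic form in the primal errors, the steps and the residual (\<open>fejer_inequality\<close>). The
  condition on \<open>\<gamma>\<close> makes this form nonnegative (\<open>cross_form_lower\<close>). The form does not see the
  multiplier, but stationarity together with the Lipschitz gradients expresses
  \<open>A\<^sup>T (\<lambda>' - \<lambda>\<^sup>*)\<close> and \<open>B\<^sup>T (\<lambda>' - \<lambda>\<^sup>*)\<close> through quantities that it does see, and full row
  rank recovers \<open>\<lambda>' - \<lambda>\<^sup>*\<close> (\<open>multiplier_bound\<close>). Hence the drop is a fixed fraction of the new
  distance (\<open>exact_contraction\<close>).

  \<^bold>\<open>Each inner loop is close to its target.\<close> Both loops run stochastic gradient descent with
  step \<open>s / j\<close> for the zero of a strongly monotone Lipschitz map
  \<open>v \<mapsto> \<nabla> h v + H v + \<theta>\<close>, where only \<open>\<theta>\<close> depends on the current iterate. The sample of a step is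
  independent of everything computed before it, so it may be integrated out with the past frozen
  (\<open>nn_integral_fresh_sample\<close>); the noise is centred and contributes its second moment only. This
  yields \<open>d (j + 1) \<le> (1 - 2 c s / j + O(1 / j\<^sup>2)) d j + O(1 / j\<^sup>2)\<close> for the mean square error, and
  \<open>2 c s > 1\<close> gives \<open>d n = O(1 / n)\<close> (\<open>robbins_monro_recurrence\<close>, \<open>stochastic_gradient_loop\<close>).

  \<^bold>\<open>Combination.\<close> Since the loops have length at least \<open>T / \<eta>\<^sup>k\<close>, the mean square distance
  between \<open>u\<^bsub>k+1\<^esub>\<close> and the exact update of \<open>u\<^sub>k\<close> is at most \<open>C \<eta>\<^sup>k (e\<^sub>k + 1)\<close>, where \<open>e\<^sub>k\<close> is
  the mean square error (\<open>major_iteration_error\<close>). Young's inequality turns this into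
  \<open>e\<^bsub>k+1\<^esub> \<le> s e\<^sub>k + c \<eta>\<^sup>k (e\<^sub>k + 1)\<close> for any \<open>s\<close> above the contraction factor, and such a
  sequence is \<open>O(q\<^sup>k)\<close> for every \<open>q\<close> in \<open>[\<eta>, 1)\<close> above the contraction factor
  (\<open>geometric_decay\<close>). Claim (i) takes the factor from \<open>exact_contraction\<close> and a suitable
  \<open>q < 1\<close>; claim (ii) takes \<open>q = \<eta>\<close>, so that the number of samples per major iteration and the
  error bound are inversely proportional (\<open>sample_complexity_bound\<close>).\<close>

section \<open>Gradients and strong convexity\<close>

lemma GDERIV_unique:
  assumes "GDERIV f x :> D" "GDERIV f x :> E"
  shows "D = E"
proof -
  have "(\<lambda>h. inner h D) = (\<lambda>h. inner h E)"
    using assms unfolding gderiv_def by (rule has_derivative_unique)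
  then have "inner (D - E) (D - E) = 0"
    by (metis inner_diff_right right_minus_eq)
  then show ?thesis by simp
qed

lemma grad_eqI: "GDERIV f x :> D \<Longrightarrow> grad f x = D"
  unfolding grad_def using GDERIV_unique by blast

lemma GDERIV_grad:
  fixes f :: "'v::euclidean_space \<Rightarrow> real"
  assumes "f differentiable (at x)"
  shows "GDERIV f x :> grad f x"
proof -
  obtain f' where f': "(f has_derivative f') (at x)"
    using assms unfolding differentiable_def by blast
  interpret bounded_linear f' using f' by (rule has_derivative_bounded_linear)
  have "f' h = inner h (\<Sum>i\<in>Basis. f' i *\<^sub>R i)" for h
  proof -
    have "f' h = f' (\<Sum>i\<in>Basis. (h \<bullet> i) *\<^sub>R i)" by (simp add: euclidean_representation)
    also have "\<dots> = (\<Sum>i\<in>Basis. (h \<bullet> i) * f' i)" by (simp add: sum scaleR)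
    finally show ?thesis by (simp add: inner_sum_right mult.commute)
  qed
  then have "f' = (\<lambda>h. inner h (\<Sum>i\<in>Basis. f' i *\<^sub>R i))" by (rule ext)
  with f' have "GDERIV f x :> (\<Sum>i\<in>Basis. f' i *\<^sub>R i)"
    unfolding gderiv_def by metis
  then show ?thesis by (metis grad_eqI)
qed

lemma GDERIV_real_power2_norm_affine:
  fixes K :: "real^'n^'p"
  shows "GDERIV (\<lambda>v. (norm (K *v v + r))\<^sup>2) v :> 2 *\<^sub>R (transpose K *v (K *v v + r))"
proof -
  have "((\<lambda>v. (K *v v + r) \<bullet> (K *v v + r)) has_derivative
      (\<lambda>h. (K *v v + r) \<bullet> (K *v h) + (K *v h) \<bullet> (K *v v + r))) (at v)"
    by (auto intro!: derivative_eq_intros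
        bounded_linear.has_derivative[OF matrix_vector_mul_bounded_linear, of "\<lambda>v. v" "\<lambda>v. v" "at v" K])
  moreover have "(K *v h) \<bullet> w = h \<bullet> (transpose K *v w)" for h w
    by (metis dot_lmul_matrix inner_commute transpose_matrix_vector)
  ultimately show ?thesis
    unfolding gderiv_def power2_norm_eq_inner by (simp add: inner_commute)
qed

lemma GDERIV_inner_right:
  fixes d :: "'v::real_inner"
  shows "GDERIV (\<lambda>v. d \<bullet> v) v :> d"
  unfolding gderiv_def by (auto intro!: derivative_eq_intros simp: inner_commute)

lemma GDERIV_half_qform_diff:
  fixes K :: "real^'n^'n"
  assumes "transpose K = K"
  shows "GDERIV (\<lambda>v. 1/2 * qform K (v - z)) v :> K *v (v - z)"
proof -
  have *: "((\<lambda>v. (v - z) \<bullet> (K *v (v - z))) has_derivative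
      (\<lambda>h. (v - z) \<bullet> (K *v h) + h \<bullet> (K *v (v - z)))) (at v)"
    by (auto intro!: derivative_eq_intros
        bounded_linear.has_derivative[OF matrix_vector_mul_bounded_linear, of "\<lambda>v. v - z" "\<lambda>v. v" "at v" K])
  have "(v - z) \<bullet> (K *v h) = h \<bullet> (K *v (v - z))" for h
    by (metis assms dot_lmul_matrix inner_commute transpose_matrix_vector)
  with * have "((\<lambda>v. qform K (v - z)) has_derivative (\<lambda>h. 2 * (h \<bullet> (K *v (v - z))))) (at v)"
    unfolding qform_def by simp
  from has_derivative_mult_right[OF this, of "1/2"] show ?thesis
    unfolding gderiv_def by simp
qed

lemma GDERIV_aug_lag_x:
  assumes "GDERIV h v :> D"
  shows "GDERIV (\<lambda>v. aug_lag A B b \<rho> h g v y l) v :>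
    D - transpose A *v l + \<rho> *\<^sub>R (transpose A *v (A *v v + B *v y - b))"
proof -
  have eq: "aug_lag A B b \<rho> h g v y l
    = h v + (g y - l \<bullet> (B *v y - b)) - (transpose A *v l) \<bullet> v + \<rho> / 2 * (norm (A *v v + (B *v y - b)))\<^sup>2" for v
    by (simp add: aug_lag_def algebra_simps inner_add_right inner_diff_right
        dot_lmul_matrix[symmetric] transpose_matrix_vector)
  have "GDERIV (\<lambda>v. h v + (g y - l \<bullet> (B *v y - b)) - (transpose A *v l) \<bullet> v
        + \<rho> / 2 * (norm (A *v v + (B *v y - b)))\<^sup>2) v :>
     D + 0 - transpose A *v l + ((\<rho> / 2) *\<^sub>R (2 *\<^sub>R (transpose A *v (A *v v + (B *v y - b))))
        + (norm (A *v v + (B *v y - b)))\<^sup>2 *\<^sub>R 0)"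
    by (intro GDERIV_add GDERIV_diff GDERIV_mult assms GDERIV_const GDERIV_inner_right
        GDERIV_real_power2_norm_affine)
  then show ?thesis by (simp add: eq add_diff_eq)
qed

lemma GDERIV_aug_lag_y:
  assumes "GDERIV h v :> D"
  shows "GDERIV (\<lambda>v. aug_lag A B b \<rho> f h x v l) v :>
    D - transpose B *v l + \<rho> *\<^sub>R (transpose B *v (A *v x + B *v v - b))"
  using GDERIV_aug_lag_x[OF assms, of B A b \<rho> f x l]
  by (simp add: aug_lag_def add.commute)

text \<open>A subgradient of a differentiable function is its gradient, since the difference of the
  function and the supporting affine function has a minimum at the base point.\<close>

lemma subdifferential_grad:
  fixes f :: "'v::euclidean_space \<Rightarrow> real"
  assumes "f differentiable (at x)" "v \<in> subdifferential f x"
  shows "grad f x = v"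
proof -
  have "GDERIV (\<lambda>z. f z - v \<bullet> z) x :> grad f x - v"
    by (intro GDERIV_diff GDERIV_grad assms GDERIV_inner_right)
  then have d: "((\<lambda>z. f z - v \<bullet> z) has_derivative (\<lambda>h. h \<bullet> (grad f x - v))) (at x)"
    unfolding gderiv_def .
  have "f x - v \<bullet> x \<le> f z - v \<bullet> z" for z
    using assms(2) by (auto simp: subdifferential_def inner_diff_right dest!: spec[of _ z])
  then have "(\<lambda>h. h \<bullet> (grad f x - v)) = (\<lambda>h. 0)"
    using d by (intro has_derivative_local_min[OF d]) auto
  then have "(grad f x - v) \<bullet> (grad f x - v) = 0" by meson
  then show ?thesis by simp
qed

lemma GDERIV_directional:
  assumes "GDERIV f x :> D"
  shows "((\<lambda>t. (f (x + t *\<^sub>R d) - f x) / t) \<longlongrightarrow> D \<bullet> d) (at 0)"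
proof -
  have 1: "((\<lambda>t. x + t *\<^sub>R d) has_derivative (\<lambda>t. t *\<^sub>R d)) (at 0)"
    by (auto intro!: derivative_eq_intros)
  have "(f has_derivative (\<lambda>h. h \<bullet> D)) (at (x + 0 *\<^sub>R d))"
    using assms unfolding gderiv_def by simp
  from has_derivative_compose[OF 1 this]
  have "((\<lambda>t. f (x + t *\<^sub>R d)) has_derivative (\<lambda>t. t * (d \<bullet> D))) (at 0)"
    by simp
  then have "((\<lambda>t. f (x + t *\<^sub>R d)) has_field_derivative (d \<bullet> D)) (at 0)"
    unfolding has_field_derivative_def by (simp only: mult_commute_abs)
  then show ?thesis by (simp add: has_field_derivative_iff inner_commute)
qed

text \<open>The defining inequality, divided by \<open>t\<close>, gives the quadratic lower bound on a strongly
  convex function in the limit \<open>t \<rightarrow> 0\<close>.\<close>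

lemma strongly_convex_lower_bound:
  assumes sc: "strongly_convex c f" and D: "GDERIV f x :> D"
  shows "f x + D \<bullet> (y - x) + c / 2 * (norm (y - x))\<^sup>2 \<le> f y"
proof -
  have lim1: "((\<lambda>t. (f (x + t *\<^sub>R (y - x)) - f x) / t) \<longlongrightarrow> D \<bullet> (y - x)) (at_right 0)"
    by (rule filterlim_mono[OF GDERIV_directional[OF D] order_refl]) (simp add: at_within_le_at)
  have lim2: "((\<lambda>t. f y - f x - c / 2 * (1 - t) * (norm (x - y))\<^sup>2)
      \<longlongrightarrow> f y - f x - c / 2 * (1 - 0) * (norm (x - y))\<^sup>2) (at_right 0)"
    by (intro tendsto_intros)
  have "\<forall>\<^sub>F t in at_right (0::real). t \<in> {0<..<1}"
    by (rule eventually_at_right_real) simp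
  then have "\<forall>\<^sub>F t in at_right 0. (f (x + t *\<^sub>R (y - x)) - f x) / t \<le> f y - f x - c / 2 * (1 - t) * (norm (x - y))\<^sup>2"
  proof eventually_elim
    case (elim t)
    have "f (x + t *\<^sub>R (y - x)) = f ((1 - t) *\<^sub>R x + t *\<^sub>R y)" by (simp add: algebra_simps)
    also have "\<dots> \<le> (1 - t) * f x + t * f y - c / 2 * t * (1 - t) * (norm (x - y))\<^sup>2"
      using sc elim unfolding strongly_convex_def by auto
    finally have "f (x + t *\<^sub>R (y - x)) - f x \<le> t * (f y - f x - c / 2 * (1 - t) * (norm (x - y))\<^sup>2)"
      by (simp add: algebra_simps)
    then show ?case using elim by (simp add: divide_le_eq mult.commute)
  qed
  from tendsto_le[OF _ lim2 lim1 this] show ?thesis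
    by (simp add: inner_commute norm_minus_commute)
qed

lemma strongly_convex_strongly_monotone:
  assumes sc: "strongly_convex c f" and D: "GDERIV f x :> D" and E: "GDERIV f y :> E"
  shows "c * (norm (x - y))\<^sup>2 \<le> (D - E) \<bullet> (x - y)"
proof -
  have "D \<bullet> (y - x) = - (D \<bullet> (x - y))" by (simp add: inner_diff_right)
  then show ?thesis
  using strongly_convex_lower_bound[OF sc D, of y] strongly_convex_lower_bound[OF sc E, of x]
  by (simp add: inner_diff_left norm_minus_commute)
qed

lemma strongly_convex_arg_min:
  assumes sc: "strongly_convex c f" and D: "GDERIV f v :> 0"
  shows "arg_min f (\<lambda>_. True) = v"
  unfolding arg_min_def
proof (rule some_equality)
  have "f v \<le> f z" for z
    using strongly_convex_lower_bound[OF sc D, of z] sc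
    by (auto simp: strongly_convex_def intro: order_trans[rotated])
  then show "is_arg_min f (\<lambda>_. True) v" by (auto simp: is_arg_min_def not_less)
next
  fix z assume "is_arg_min f (\<lambda>_. True) z"
  then have "f z \<le> f v" by (auto simp: is_arg_min_def not_less)
  then have "c / 2 * (norm (z - v))\<^sup>2 \<le> 0"
    using strongly_convex_lower_bound[OF sc D, of z] by simp
  then show "z = v" using sc by (simp add: strongly_convex_def mult_le_0_iff)
qed

section \<open>Zeros of strongly monotone maps\<close>

text \<open>The common form of the two ADMM subproblems and of the two inner loops: find the zero of
  \<open>v \<mapsto> N v + \<theta>\<close>, where \<open>N\<close> is fixed and all dependence on the current iterate is in \<open>\<theta>\<close>. The
  solution as a function of \<open>\<theta>\<close> is Lipschitz, which gives both its measurability and its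
  sensitivity to inexact inputs.\<close>

locale strongly_monotone_map =
  fixes N :: "'v::euclidean_space \<Rightarrow> 'v" and c L :: real
  assumes c_pos: "0 < c"
    and strong_mono: "c * (norm (v - w))\<^sup>2 \<le> (N v - N w) \<bullet> (v - w)"
    and lip: "norm (N v - N w) \<le> L * norm (v - w)"
begin

lemma expansive: "c * norm (v - w) \<le> norm (N v - N w)"
proof (cases "v = w")
  case False
  have "c * norm (v - w) * norm (v - w) \<le> norm (N v - N w) * norm (v - w)"
    using order_trans[OF strong_mono norm_cauchy_schwarz, of v w]
    by (simp add: power2_eq_square)
  then show ?thesis using False by simp
qed simp

text \<open>For small \<open>t\<close> the gradient step \<open>v \<mapsto> v - t (N v + \<theta>)\<close> is a contraction.\<close>

lemma ex1_zero: "\<exists>!v. N v + \<theta> = 0"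
proof -
  \<comment> \<open>The minimiser \<open>c / L\<^sup>2\<close> of the factor \<open>1 - 2 t c + t\<^sup>2 L\<^sup>2\<close>, made safe against \<open>L = 0\<close>.\<close>
  define t where "t = c / (c\<^sup>2 + L\<^sup>2)"
  have S: "0 < c\<^sup>2 + L\<^sup>2" using c_pos by (simp add: add_pos_nonneg)
  then have t: "t > 0" using c_pos by (simp add: t_def)
  have tt: "t\<^sup>2 * (c\<^sup>2 + L\<^sup>2) = t * c" using S by (simp add: t_def power2_eq_square)
  define q where "q = sqrt (1 - t * c)"
  have tc: "t * c \<le> 1" using S c_pos by (simp add: t_def power2_eq_square[symmetric] divide_le_eq)
  have q: "0 \<le> q" "q < 1" "q\<^sup>2 = 1 - t * c" using tc t c_pos by (auto simp: q_def)
  have "dist (v - t *\<^sub>R (N v + \<theta>)) (w - t *\<^sub>R (N w + \<theta>)) \<le> q * dist v w" for v w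
  proof (rule power2_le_imp_le)
    have eq: "v - t *\<^sub>R (N v + \<theta>) - (w - t *\<^sub>R (N w + \<theta>)) = (v - w) - t *\<^sub>R (N v - N w)"
      by (simp add: algebra_simps)
    have "(norm ((v - w) - t *\<^sub>R (N v - N w)))\<^sup>2
       = (norm (v - w))\<^sup>2 - 2 * t * ((N v - N w) \<bullet> (v - w)) + t\<^sup>2 * (norm (N v - N w))\<^sup>2"
      by (simp add: power2_norm_eq_inner inner_diff inner_commute algebra_simps)
        (simp add: power2_eq_square algebra_simps)
    also have "\<dots> \<le> (norm (v - w))\<^sup>2 - 2 * t * (c * (norm (v - w))\<^sup>2) + t\<^sup>2 * (L * norm (v - w))\<^sup>2"
      by (intro add_mono diff_left_mono mult_left_mono strong_mono power_mono lip) (use t in auto)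
    also have "\<dots> = (1 - 2 * (t * c) + t\<^sup>2 * L\<^sup>2) * (norm (v - w))\<^sup>2"
      by (simp add: algebra_simps power_mult_distrib)
    also have "\<dots> \<le> (1 - t * c) * (norm (v - w))\<^sup>2"
    proof (rule mult_right_mono)
      have "t\<^sup>2 * L\<^sup>2 \<le> t\<^sup>2 * (c\<^sup>2 + L\<^sup>2)" by (intro mult_left_mono) auto
      then show "1 - 2 * (t * c) + t\<^sup>2 * L\<^sup>2 \<le> 1 - t * c" using tt by linarith
    qed simp
    finally show "(dist (v - t *\<^sub>R (N v + \<theta>)) (w - t *\<^sub>R (N w + \<theta>)))\<^sup>2 \<le> (q * dist v w)\<^sup>2"
      by (simp add: dist_norm eq power_mult_distrib q)
  qed (use q in auto)
  then have "\<exists>!v. v - t *\<^sub>R (N v + \<theta>) = v"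
    using q by (intro banach_fix_type) auto
  moreover have "v - t *\<^sub>R (N v + \<theta>) = v \<longleftrightarrow> N v + \<theta> = 0" for v using t by simp
  ultimately show ?thesis by simp
qed

definition resolvent :: "'v \<Rightarrow> 'v" where "resolvent \<theta> = (THE v. N v + \<theta> = 0)"

lemma resolvent: "N (resolvent \<theta>) + \<theta> = 0"
  unfolding resolvent_def by (rule theI'[OF ex1_zero])

lemma resolvent_eqI: "N v + \<theta> = 0 \<Longrightarrow> resolvent \<theta> = v"
  using ex1_zero resolvent by blast

lemma resolvent_lipschitz: "norm (resolvent \<theta> - resolvent \<theta>') \<le> 1 / c * norm (\<theta> - \<theta>')"
proof -
  have "N (resolvent \<theta>) = - \<theta>" for \<theta>
    using resolvent[of \<theta>] by (simp add: eq_neg_iff_add_eq_0)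
  then have "N (resolvent \<theta>) - N (resolvent \<theta>') = \<theta>' - \<theta>" by simp
  then show ?thesis using expansive[of "resolvent \<theta>" "resolvent \<theta>'"] c_pos
    by (metis mult.commute mult_1 norm_minus_commute pos_le_divide_eq times_divide_eq_left)
qed

lemma resolvent_continuous: "continuous_on UNIV resolvent"
proof (rule lipschitz_on_continuous_on)
  show "(1 / c)-lipschitz_on UNIV resolvent"
    using c_pos resolvent_lipschitz by (intro lipschitz_onI) (auto simp: dist_norm)
qed

end

section \<open>Two scalar recurrences\<close>

text \<open>With step sizes \<open>a / j\<close> and \<open>a > 1\<close>, the quantity \<open>j * d j\<close> contracts up to a noise of
  order \<open>1 / j\<close> once \<open>j\<close> exceeds a threshold \<open>J\<close>; before that it grows at most
  exponentially, which only affects the constant.\<close>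

lemma robbins_monro_recurrence:
  fixes a M :: real
  assumes a: "a > 1" and M: "M \<ge> 0"
  obtains C where "C > 0"
    "\<And>d n N. N \<ge> 0 \<Longrightarrow> (\<And>j. 1 \<le> j \<Longrightarrow> j \<le> n \<Longrightarrow> 0 \<le> d j) \<Longrightarrow>
      (\<And>j. 1 \<le> j \<Longrightarrow> j < n \<Longrightarrow>
        d (Suc j) \<le> (1 - a / real j + M / (real j)\<^sup>2) * d j + N / (real j)\<^sup>2) \<Longrightarrow>
      1 \<le> n \<Longrightarrow> d n \<le> C * (d 1 + N) / real n"
proof -
  define J where "J = nat \<lceil>max a (4 * M / (a - 1))\<rceil>"
  have J: "a \<le> real j" "4 * M / (a - 1) \<le> real j" if "j \<ge> J" for j
    using that by (auto simp: J_def nat_le_iff ceiling_le_iff)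
  \<comment> \<open>The first summand covers the steps up to \<open>J\<close>; the second makes the decrease
    \<open>(a - 1) / 2 * C / j\<close> after \<open>J\<close> outweigh the noise \<open>2 / j\<close>.\<close>
  define C where "C = real (Suc J) * (2 + M) ^ Suc J + 4 / (a - 1)"
  have C: "C > 0" "4 / (a - 1) \<le> C" "\<And>j. j \<le> Suc J \<Longrightarrow> real j * (2 + M) ^ j \<le> C"
  proof -
    have "0 < real (Suc J) * (2 + M) ^ Suc J" using M by simp
    moreover have "0 < 4 / (a - 1)" using a by simp
    ultimately show "C > 0" "4 / (a - 1) \<le> C" unfolding C_def by linarith+
    fix j assume "j \<le> Suc J"
    then have "real j * (2 + M) ^ j \<le> real (Suc J) * (2 + M) ^ Suc J"
      using M by (intro mult_mono power_increasing) auto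
    with \<open>0 < 4 / (a - 1)\<close> show "real j * (2 + M) ^ j \<le> C" unfolding C_def by linarith
  qed
  have main: "d n \<le> C * (d 1 + N) / real n"
    if N: "N \<ge> 0" and nn: "\<And>j. 1 \<le> j \<Longrightarrow> j \<le> n \<Longrightarrow> 0 \<le> d j"
      and rec: "\<And>j. 1 \<le> j \<Longrightarrow> j < n \<Longrightarrow>
        d (Suc j) \<le> (1 - a / real j + M / (real j)\<^sup>2) * d j + N / (real j)\<^sup>2"
      and n: "1 \<le> n" for d :: "nat \<Rightarrow> real" and n N
  proof -
    define E where "E = d 1 + N"
    have E: "0 \<le> E" "N \<le> E" using nn[of 1] n N by (auto simp: E_def)
    have crude: "d j \<le> (2 + M) ^ j * E" if "1 \<le> j" "j \<le> n" for j
      using that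
    proof (induction j rule: nat_induct_at_least)
      case base
      have "1 * E \<le> (2 + M) ^ 1 * E" using M E by (intro mult_right_mono) auto
      then show ?case using N by (simp add: E_def)
    next
      case (Suc j)
      have j: "real j \<ge> 1" using Suc.hyps by simp
      then have j2: "1 \<le> (real j)\<^sup>2" by (simp add: one_le_power)
      have "M / (real j)\<^sup>2 \<le> M" using M j2 by (simp add: divide_le_eq mult_le_cancel_left1)
      moreover have "0 \<le> a / real j" using a j by simp
      ultimately have "1 - a / real j + M / (real j)\<^sup>2 \<le> 1 + M" by simp
      then have "(1 - a / real j + M / (real j)\<^sup>2) * d j \<le> (1 + M) * d j"
        using nn[of j] Suc by (intro mult_right_mono) auto
      moreover have "N / (real j)\<^sup>2 \<le> N" using N j2 by (simp add: divide_le_eq mult_le_cancel_left1)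
      ultimately have "d (Suc j) \<le> (1 + M) * d j + N" using rec[of j] Suc by simp
      also have "\<dots> \<le> (1 + M) * ((2 + M) ^ j * E) + 1 * E"
        using Suc M E by (intro add_mono mult_left_mono) auto
      also have "1 * E \<le> (2 + M) ^ j * E"
        using M E by (intro mult_right_mono one_le_power) auto
      finally show ?case by (simp add: algebra_simps)
    qed
    have "real j * d j \<le> C * E" if "1 \<le> j" "j \<le> n" for j
      using that
    proof (induction j rule: nat_induct_at_least)
      case base
      have "1 * d 1 \<le> 1 * ((2 + M) ^ 1 * E)" using crude[of 1] base by simp
      also have "\<dots> \<le> C * E" using C(3)[of 1] E by (simp add: mult_right_mono)
      finally show ?case by simp
    next
      case (Suc j)
      show ?case
      proof (cases "j < J")
        case True
        have "real (Suc j) * d (Suc j) \<le> real (Suc j) * ((2 + M) ^ Suc j * E)"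
          using Suc by (intro mult_left_mono crude) auto
        also have "\<dots> = (real (Suc j) * (2 + M) ^ Suc j) * E" by (simp only: mult.assoc)
        also have "\<dots> \<le> C * E" using C(3)[of "Suc j"] True E by (intro mult_right_mono) auto
        finally show ?thesis .
      next
        case False
        have j: "real j \<ge> 1" "real j > 0" using Suc.hyps by auto
        define p where "p = 1 - a / real j + M / (real j)\<^sup>2"
        have aj: "a \<le> real j" and Mj: "4 * M / (a - 1) \<le> real j" using J[of j] False by auto
        have "a / real j \<le> 1" using aj j by simp
        moreover have "0 \<le> M / (real j)\<^sup>2" using M by simp
        ultimately have p: "0 \<le> p" unfolding p_def by linarith
        have "4 * M \<le> real j * (a - 1)" using Mj a by (simp add: divide_le_eq)
        then have "4 * M / real j \<le> a - 1" using j by (simp add: pos_divide_le_eq mult.commute)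
        then have "2 * (M / real j) \<le> (a - 1) / 2" by simp
        moreover have "M / (real j)\<^sup>2 \<le> M / real j"
          using M j by (intro divide_left_mono) (auto simp: power2_eq_square)
        moreover have "(1 + real j) * p = real j + 1 - a - a / real j + M / real j + M / (real j)\<^sup>2"
          using j by (simp add: p_def power2_eq_square field_simps)
        moreover have "0 \<le> a / real j" using a j by simp
        ultimately have p': "(1 + real j) * p \<le> real j - (a - 1) / 2" by argo
        have IH: "d j \<le> C * E / real j" using Suc j by (simp add: field_simps)
        have "(1 + real j) * d (Suc j) \<le> (1 + real j) * (p * d j + N / (real j)\<^sup>2)"
          using rec[of j] Suc j by (intro mult_left_mono) (auto simp: p_def)
        also have "\<dots> = ((1 + real j) * p) * d j + (1 + real j) * (N / (real j)\<^sup>2)"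
          by (simp add: algebra_simps)
        also have "\<dots> \<le> (real j - (a - 1) / 2) * (C * E / real j) + 2 * E / real j"
        proof (rule add_mono)
          have "((1 + real j) * p) * d j \<le> ((1 + real j) * p) * (C * E / real j)"
            using IH p j by (intro mult_left_mono) auto
          also have "\<dots> \<le> (real j - (a - 1) / 2) * (C * E / real j)"
            using p' C E j by (intro mult_right_mono) auto
          finally show "((1 + real j) * p) * d j \<le> (real j - (a - 1) / 2) * (C * E / real j)" .
          have "(1 + real j) * N \<le> (2 * real j) * E" using j N E by (intro mult_mono) auto
          then have "(1 + real j) * N / (real j)\<^sup>2 \<le> (2 * real j) * E / (real j)\<^sup>2"
            by (intro divide_right_mono) auto
          then show "(1 + real j) * (N / (real j)\<^sup>2) \<le> 2 * E / real j"
            using j by (simp add: power2_eq_square)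
        qed
        also have "\<dots> = C * E + (2 - (a - 1) / 2 * C) * E / real j"
          using j by (simp add: field_simps)
        also have "\<dots> \<le> C * E"
        proof -
          have "2 - (a - 1) / 2 * C \<le> 0" using C(2) a by (simp add: field_simps)
          then show ?thesis using E j by (simp add: divide_nonpos_pos mult_nonpos_nonneg)
        qed
        finally show ?thesis by simp
      qed
    qed
    from this[of n] n show ?thesis by (simp add: E_def field_simps)
  qed
  show ?thesis using C(1) main by (rule that)
qed

text \<open>After division by \<open>q ^ k\<close> the perturbation of the linear coefficient tends to \<open>0\<close> and the
  inhomogeneous term stays bounded, so the quotient is eventually contracted towards a bounded
  set.\<close>

lemma perturbed_linear_recurrence:
  fixes e :: "nat \<Rightarrow> real"
  assumes s: "0 \<le> s" "s < q" and q: "q < 1" and \<eta>: "0 < \<eta>" "\<eta> \<le> q" and c: "0 \<le> c"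
    and nn: "\<And>k. 0 \<le> e k"
    and rec: "\<And>k. e (Suc k) \<le> s * e k + c * \<eta> ^ k * (e k + 1)"
  obtains D where "D > 0" "\<And>k. e k \<le> D * q ^ k"
proof -
  have q0: "q > 0" using s by simp
  define v where "v k = e k / q ^ k" for k
  have v: "0 \<le> v k" "e k = v k * q ^ k" for k using nn q0 by (auto simp: v_def)
  define r where "r = (q + s) / (2 * q)"
  have r: "0 \<le> r" "r < 1" using s q0 by (auto simp: r_def)
  have "(\<lambda>k. c * \<eta> ^ k) \<longlonglongrightarrow> c * 0"
    by (intro tendsto_mult tendsto_const LIMSEQ_realpow_zero) (use \<eta> q in auto)
  then have "\<forall>\<^sub>F k in sequentially. c * \<eta> ^ k < (q - s) / 2"
    using s by (intro order_tendstoD(2)[of _ "c * 0"]) auto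
  then obtain k0 where k0: "\<And>k. k \<ge> k0 \<Longrightarrow> c * \<eta> ^ k < (q - s) / 2"
    by (auto simp: eventually_sequentially)
  have step: "v (Suc k) \<le> r * v k + c / q" if "k \<ge> k0" for k
  proof -
    \<comment> \<open>The factor \<open>(q - s) / 2\<close> raises \<open>s\<close> to the midpoint \<open>(q + s) / 2 = r q\<close>.\<close>
    have "c * \<eta> ^ k * (e k + 1) = (c * \<eta> ^ k) * e k + c * \<eta> ^ k" by (simp add: algebra_simps)
    also have "\<dots> \<le> (q - s) / 2 * e k + c * q ^ k"
      using k0[OF that] nn \<eta> c by (intro add_mono mult_right_mono mult_left_mono power_mono) auto
    finally have "e (Suc k) \<le> (q + s) / 2 * e k + c * q ^ k"
      using rec[of k] by (simp add: field_simps)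
    then have "v (Suc k) \<le> ((q + s) / 2 * e k + c * q ^ k) / q ^ Suc k"
      unfolding v_def using q0 by (intro divide_right_mono) auto
    also have "\<dots> = r * v k + c / q" using q0 by (simp add: v_def r_def field_simps)
    finally show ?thesis .
  qed
  define D where "D = Max (v ` {..k0}) + c / q / (1 - r) + 1"
  have mx: "v k \<le> Max (v ` {..k0})" if "k \<le> k0" for k using that by (intro Max_ge) auto
  have cq: "0 \<le> c / q / (1 - r)" using c q0 r by simp
  have "v k \<le> D" for k
  proof (induction k)
    case 0
    then show ?case using mx[of 0] cq unfolding D_def by linarith
  next
    case (Suc k)
    show ?case
    proof (cases "k \<ge> k0")
      case True
      have "c / q / (1 - r) \<le> D" using mx[of 0] v(1)[of 0] unfolding D_def by linarith
      then have "c / q \<le> (1 - r) * D" using r by (simp add: pos_divide_le_eq mult.commute del: divide_divide_eq_left)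
      moreover have "r * v k \<le> r * D" using Suc r by (intro mult_left_mono) auto
      ultimately show ?thesis using step[OF True] by (simp add: algebra_simps)
    next
      case False
      then have "v (Suc k) \<le> Max (v ` {..k0})" by (intro mx) simp
      then show ?thesis using cq unfolding D_def by linarith
    qed
  qed
  moreover have "D > 0" using mx[of 0] v(1)[of 0] cq unfolding D_def by linarith
  ultimately show ?thesis using v(2) q0 by (intro that[of D]) (auto intro!: mult_right_mono)
qed

section \<open>Joint measurability of a random gradient\<close>

text \<open>Composing with a countably valued approximation of \<open>X\<close> only needs measurability in the second
  argument; continuity in the first one passes to the limit.\<close>

lemma caratheodory_measurable:
  fixes h :: "'v::euclidean_space \<Rightarrow> 's \<Rightarrow> real"
  assumes meas: "\<And>x. h x \<in> borel_measurable S"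
    and cont: "\<And>s. s \<in> space S \<Longrightarrow> continuous_on UNIV (\<lambda>x. h x s)"
    and X: "X \<in> borel_measurable N" and Y: "Y \<in> N \<rightarrow>\<^sub>M S"
  shows "(\<lambda>\<omega>. h (X \<omega>) (Y \<omega>)) \<in> borel_measurable N"
proof -
  obtain F where F: "\<And>i. simple_function N (F i)"
      "\<And>\<omega>. \<omega> \<in> space N \<Longrightarrow> (\<lambda>i. F i \<omega>) \<longlonglongrightarrow> X \<omega>"
    using borel_measurable_implies_sequence_metric[OF X, of 0] by metis
  show ?thesis
  proof (rule borel_measurable_LIMSEQ_metric)
    show "(\<lambda>\<omega>. h (F i \<omega>) (Y \<omega>)) \<in> borel_measurable N" for i
    proof (rule measurable_compose_countable'[where I = "F i ` space N"])
      show "(\<lambda>\<omega>. h v (Y \<omega>)) \<in> borel_measurable N" for v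
        by (rule measurable_compose[OF Y meas])
      show "F i \<in> N \<rightarrow>\<^sub>M count_space (F i ` space N)"
        using F(1)[of i] by (subst measurable_count_space_eq2) (auto simp: simple_function_def)
      show "countable (F i ` space N)"
        using F(1)[of i] by (intro countable_finite simple_functionD)
    qed
    fix \<omega> assume w: "\<omega> \<in> space N"
    then have "Y \<omega> \<in> space S" using Y by (auto dest: measurable_space)
    from cont[OF this] F(2)[OF w] show "(\<lambda>i. h (F i \<omega>) (Y \<omega>)) \<longlonglongrightarrow> h (X \<omega>) (Y \<omega>)"
      by (rule continuous_on_tendsto_compose) auto
  qed
qed

text \<open>The components of the gradient are limits of difference quotients of a Caratheodory function.\<close>

lemma random_gradient_measurable:
  fixes ft :: "'v::euclidean_space \<Rightarrow> 's::topological_space \<Rightarrow> real"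
  assumes obj: "stochastic_objective M \<Xi> \<xi> ft f"
    and X: "X \<in> borel_measurable N" and Y: "Y \<in> N \<rightarrow>\<^sub>M restrict_space borel \<Xi>"
  shows "(\<lambda>\<omega>. grad (\<lambda>z. ft z (Y \<omega>)) (X \<omega>)) \<in> borel_measurable N"
proof (subst borel_measurable_euclidean_space, rule ballI)
  have diff: "(\<lambda>z. ft z s) differentiable (at v)" if "s \<in> \<Xi>" for s v
    using obj that by (simp add: stochastic_objective_def)
  have ft: "(\<lambda>\<omega>. ft (X' \<omega>) (Y \<omega>)) \<in> borel_measurable N" if "X' \<in> borel_measurable N" for X'
  proof (rule caratheodory_measurable[OF _ _ that Y])
    show "ft v \<in> borel_measurable (restrict_space borel \<Xi>)" for v
      using obj by (simp add: stochastic_objective_def)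
    fix s assume "s \<in> space (restrict_space borel \<Xi>)"
    then have "s \<in> \<Xi>" by (simp add: space_restrict_space)
    then show "continuous_on UNIV (\<lambda>v. ft v s)"
      using diff by (intro continuous_at_imp_continuous_on) (auto intro: differentiable_imp_continuous_within)
  qed
  fix i :: 'v assume "i \<in> Basis"
  show "(\<lambda>\<omega>. grad (\<lambda>z. ft z (Y \<omega>)) (X \<omega>) \<bullet> i) \<in> borel_measurable N"
  proof (rule borel_measurable_LIMSEQ_real)
    fix \<omega> assume "\<omega> \<in> space N"
    then have "Y \<omega> \<in> \<Xi>" using measurable_space[OF Y] by (auto simp: space_restrict_space)
    then have lim: "((\<lambda>t. (ft (X \<omega> + t *\<^sub>R i) (Y \<omega>) - ft (X \<omega>) (Y \<omega>)) / t)
        \<longlongrightarrow> grad (\<lambda>z. ft z (Y \<omega>)) (X \<omega>) \<bullet> i) (at 0)"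
      by (intro GDERIV_directional[OF GDERIV_grad] diff)
    have "filterlim (\<lambda>n. inverse (real (Suc n))) (at 0) sequentially"
      using LIMSEQ_inverse_real_of_nat by (simp add: filterlim_at del: of_nat_Suc)
    from filterlim_compose[OF lim this]
    show "(\<lambda>n. (ft (X \<omega> + inverse (real (Suc n)) *\<^sub>R i) (Y \<omega>) - ft (X \<omega>) (Y \<omega>)) / inverse (real (Suc n)))
        \<longlonglongrightarrow> grad (\<lambda>z. ft z (Y \<omega>)) (X \<omega>) \<bullet> i" .
  next
    fix n
    have "(\<lambda>\<omega>. X \<omega> + inverse (real (Suc n)) *\<^sub>R i) \<in> borel_measurable N"
      using X by measurable
    then show "(\<lambda>\<omega>. (ft (X \<omega> + inverse (real (Suc n)) *\<^sub>R i) (Y \<omega>) - ft (X \<omega>) (Y \<omega>)) / inverse (real (Suc n)))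
        \<in> borel_measurable N"
      using ft[OF X] ft[of "\<lambda>\<omega>. X \<omega> + inverse (real (Suc n)) *\<^sub>R i"] by measurable
  qed
qed

section \<open>Independence of a fresh sample from the past\<close>

locale sampling = prob_space M for M :: "'w measure" +
  fixes S :: "'s measure" and \<xi> :: "'w \<Rightarrow> 's" and X :: "'i \<Rightarrow> 'w \<Rightarrow> 's" and I :: "'i set"
    and N0 :: "'t measure" and U :: "'w \<Rightarrow> 't"
  assumes xi_measurable: "\<xi> \<in> M \<rightarrow>\<^sub>M S"
    and iid: "iid_copies M S \<xi> X I"
    and init_indep: "indep_rv M N0 U (Pi\<^sub>M I (\<lambda>_. S)) (\<lambda>\<omega>. \<lambda>i\<in>I. X i \<omega>)"
begin

text \<open>The information contained in the initial value and the samples with index in \<open>J\<close>. As an initial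
  sigma-algebra it is available for every \<open>J\<close> without a measurability proof, and measurability
  with respect to \<open>past J\<close> expresses that a random variable depends on these data only.\<close>

definition past :: "'i set \<Rightarrow> 'w measure" where
  "past J = vimage_algebra (space M) (\<lambda>\<omega>. (U \<omega>, \<lambda>i\<in>J. X i \<omega>)) (N0 \<Otimes>\<^sub>M Pi\<^sub>M J (\<lambda>_. S))"

lemma space_past [simp]: "space (past J) = space M"
  by (simp add: past_def)

lemma U_measurable: "U \<in> M \<rightarrow>\<^sub>M N0"
  using init_indep by (simp add: indep_rv_def)

lemma X_indep: "indep_vars (\<lambda>_. S) X I"
  using iid by (simp add: iid_copies_def)

lemma X_measurable: "i \<in> I \<Longrightarrow> X i \<in> M \<rightarrow>\<^sub>M S"
  using X_indep by (simp add: indep_vars_def)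

lemma tuple_measurable: "J \<subseteq> I \<Longrightarrow> (\<lambda>\<omega>. \<lambda>i\<in>J. X i \<omega>) \<in> M \<rightarrow>\<^sub>M Pi\<^sub>M J (\<lambda>_. S)"
  using X_measurable by (intro measurable_restrict) auto

lemma tuple_past:
  assumes "J \<subseteq> I"
  shows "(\<lambda>\<omega>. (U \<omega>, \<lambda>i\<in>J. X i \<omega>)) \<in> past J \<rightarrow>\<^sub>M N0 \<Otimes>\<^sub>M Pi\<^sub>M J (\<lambda>_. S)"
  unfolding past_def
  using measurable_space[OF U_measurable] measurable_space[OF tuple_measurable[OF assms]]
  by (intro measurable_vimage_algebra1) (auto simp: space_pair_measure)

lemma init_past:
  assumes "J \<subseteq> I"
  shows "U \<in> past J \<rightarrow>\<^sub>M N0"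
  using measurable_compose[OF tuple_past[OF assms] measurable_fst] by simp

lemma sample_past:
  assumes "J \<subseteq> I" "i \<in> J"
  shows "X i \<in> past J \<rightarrow>\<^sub>M S"
  using measurable_compose[OF measurable_compose[OF tuple_past[OF assms(1)] measurable_snd]
      measurable_component_singleton[OF assms(2)]] assms(2) by simp

lemma past_le:
  assumes "J \<subseteq> I" "(\<lambda>\<omega>. (U \<omega>, \<lambda>i\<in>J. X i \<omega>)) \<in> N \<rightarrow>\<^sub>M N0 \<Otimes>\<^sub>M Pi\<^sub>M J (\<lambda>_. S)"
    "space N = space M" "h \<in> past J \<rightarrow>\<^sub>M K"
  shows "h \<in> N \<rightarrow>\<^sub>M K"
proof -
  have "(\<lambda>x. x) \<in> N \<rightarrow>\<^sub>M past J"
    unfolding past_def using assms by (intro measurable_vimage_algebra2) auto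
  from measurable_compose[OF this assms(4)] show ?thesis .
qed

lemma past_measurable: "J \<subseteq> I \<Longrightarrow> h \<in> past J \<rightarrow>\<^sub>M K \<Longrightarrow> h \<in> M \<rightarrow>\<^sub>M K"
  using U_measurable tuple_measurable by (intro past_le[of J M h K]) auto

lemma past_mono:
  assumes "J \<subseteq> J'" "J' \<subseteq> I" "h \<in> past J \<rightarrow>\<^sub>M K"
  shows "h \<in> past J' \<rightarrow>\<^sub>M K"
proof (rule past_le[OF _ _ _ assms(3)])
  show "(\<lambda>\<omega>. (U \<omega>, \<lambda>i\<in>J. X i \<omega>)) \<in> past J' \<rightarrow>\<^sub>M N0 \<Otimes>\<^sub>M Pi\<^sub>M J (\<lambda>_. S)"
    using assms by (intro measurable_Pair init_past measurable_restrict sample_past) auto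
qed (use assms in auto)

text \<open>The preimages of rectangles generate \<open>past J\<close>. On them the claim follows by splitting off the
  initial value first, which is independent of all samples jointly, and then the samples in \<open>J\<close>
  from the sample \<open>i\<close>.\<close>

lemma fresh_sample_independent:
  assumes J: "J \<subseteq> I" and i: "i \<in> I" "i \<notin> J" and E: "E \<in> sets (past J)" and C: "C \<in> sets S"
  shows "prob (E \<inter> (X i -` C \<inter> space M)) = prob E * prob (X i -` C \<inter> space M)"
proof -
  let ?Y = "\<lambda>\<omega>. \<lambda>i\<in>I. X i \<omega>" and ?YJ = "\<lambda>\<omega>. \<lambda>i\<in>J. X i \<omega>"
  let ?T = "\<lambda>\<omega>. (U \<omega>, ?YJ \<omega>)"
  define R where "R = {?T -` (a \<times> c) \<inter> space M | a c. a \<in> sets N0 \<and> c \<in> sets (Pi\<^sub>M J (\<lambda>_. S))}"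
  define F where "F = {X i -` C \<inter> space M | C. C \<in> sets S}"
  note mY = tuple_measurable[OF J] tuple_measurable[of I, OF order_refl]
  have T: "?T \<in> space M \<rightarrow> space N0 \<times> space (Pi\<^sub>M J (\<lambda>_. S))"
    using measurable_space[OF U_measurable] measurable_space[OF mY(1)] by auto
  have sets_past: "sets (past J) = sigma_sets (space M) R"
  proof -
    have "sets (past J) = {?T -` A \<inter> space M | A. A \<in> sets (N0 \<Otimes>\<^sub>M Pi\<^sub>M J (\<lambda>_. S))}"
      unfolding past_def using T by (intro sets_vimage_algebra2) (auto simp: space_pair_measure)
    also have "\<dots> = sigma_sets (space M)
        {?T -` A \<inter> space M | A. A \<in> {a \<times> c | a c. a \<in> sets N0 \<and> c \<in> sets (Pi\<^sub>M J (\<lambda>_. S))}}"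
      unfolding sets_pair_measure by (rule sigma_sets_vimage_commute[OF T])
    also have "{?T -` A \<inter> space M | A. A \<in> {a \<times> c | a c. a \<in> sets N0 \<and> c \<in> sets (Pi\<^sub>M J (\<lambda>_. S))}} = R"
      unfolding R_def by blast
    finally show ?thesis .
  qed
  have ind_init: "prob ((U -` a \<inter> space M) \<inter> (?Y -` D \<inter> space M))
      = prob (U -` a \<inter> space M) * prob (?Y -` D \<inter> space M)"
    if "a \<in> sets N0" "D \<in> sets (Pi\<^sub>M I (\<lambda>_. S))" for a D
    using init_indep that unfolding indep_rv_def by (intro indep_setD) auto
  have ind_samples: "prob ((?YJ -` c \<inter> space M) \<inter> (X i -` C \<inter> space M))
      = prob (?YJ -` c \<inter> space M) * prob (X i -` C \<inter> space M)"
    if c: "c \<in> sets (Pi\<^sub>M J (\<lambda>_. S))" and C: "C \<in> sets S" for c C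
  proof -
    have "indep_var (Pi\<^sub>M J (\<lambda>_. S)) ?YJ (Pi\<^sub>M {i} (\<lambda>_. S)) (\<lambda>\<omega>. \<lambda>j\<in>{i}. X j \<omega>)"
      using indep_var_restrict[OF X_indep, of J "{i}"] J i by auto
    moreover have "(\<lambda>v. v i) -` C \<inter> space (Pi\<^sub>M {i} (\<lambda>_. S)) \<in> sets (Pi\<^sub>M {i} (\<lambda>_. S))"
      using measurable_sets[OF measurable_component_singleton[of i "{i}" "\<lambda>_. S"] C] by simp
    ultimately have "prob ((\<lambda>\<omega>. (?YJ \<omega>, \<lambda>j\<in>{i}. X j \<omega>)) -` (c \<times> ((\<lambda>v. v i) -` C \<inter> space (Pi\<^sub>M {i} (\<lambda>_. S)))) \<inter> space M)
      = prob (?YJ -` c \<inter> space M) * prob ((\<lambda>\<omega>. \<lambda>j\<in>{i}. X j \<omega>) -` ((\<lambda>v. v i) -` C \<inter> space (Pi\<^sub>M {i} (\<lambda>_. S))) \<inter> space M)"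
      by (rule indep_varD[OF _ c])
    moreover have "(\<lambda>\<omega>. \<lambda>j\<in>{i}. X j \<omega>) -` ((\<lambda>v. v i) -` C \<inter> space (Pi\<^sub>M {i} (\<lambda>_. S))) \<inter> space M
        = X i -` C \<inter> space M"
      using measurable_space[OF X_measurable[OF i(1)]] by (auto simp: space_PiM)
    moreover have "(\<lambda>\<omega>. (?YJ \<omega>, \<lambda>j\<in>{i}. X j \<omega>)) -` (c \<times> ((\<lambda>v. v i) -` C \<inter> space (Pi\<^sub>M {i} (\<lambda>_. S)))) \<inter> space M
        = (?YJ -` c \<inter> space M) \<inter> (X i -` C \<inter> space M)"
      using measurable_space[OF X_measurable[OF i(1)]] by (auto simp: space_PiM)
    ultimately show ?thesis by simp
  qed
  have meas_restrict: "(\<lambda>v. restrict v J) \<in> Pi\<^sub>M I (\<lambda>_. S) \<rightarrow>\<^sub>M Pi\<^sub>M J (\<lambda>_. S)"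
    using J by (rule measurable_restrict_subset)
  have meas_comp: "(\<lambda>v. v i) \<in> Pi\<^sub>M I (\<lambda>_. S) \<rightarrow>\<^sub>M S"
    using i(1) by (rule measurable_component_singleton)
  have restr: "restrict (?Y \<omega>) J = ?YJ \<omega>" for \<omega>
    using J by (auto simp: restrict_def fun_eq_iff)
  have "indep_set (sigma_sets (space M) R) (sigma_sets (space M) F)"
  proof (rule indep_set_sigma_sets)
    show "indep_set R F"
    proof (rule indep_setI)
      show "R \<subseteq> events"
        unfolding R_def using measurable_sets[OF measurable_Pair[OF U_measurable mY(1)]] by auto
      show "F \<subseteq> events"
        unfolding F_def using measurable_sets[OF X_measurable[OF i(1)]] by auto
    next
      fix r s assume "r \<in> R" "s \<in> F"
      then obtain a c C where a: "a \<in> sets N0" and c: "c \<in> sets (Pi\<^sub>M J (\<lambda>_. S))" and C: "C \<in> sets S"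
        and r: "r = ?T -` (a \<times> c) \<inter> space M" and s: "s = X i -` C \<inter> space M"
        by (auto simp: R_def F_def)
      define D1 where "D1 = (\<lambda>v. restrict v J) -` c \<inter> space (Pi\<^sub>M I (\<lambda>_. S))"
      define D2 where "D2 = D1 \<inter> ((\<lambda>v. v i) -` C \<inter> space (Pi\<^sub>M I (\<lambda>_. S)))"
      have D: "D1 \<in> sets (Pi\<^sub>M I (\<lambda>_. S))" "D2 \<in> sets (Pi\<^sub>M I (\<lambda>_. S))"
        using measurable_sets[OF meas_restrict c] measurable_sets[OF meas_comp C]
        by (auto simp: D1_def D2_def)
      have YD1: "?Y -` D1 \<inter> space M = ?YJ -` c \<inter> space M"
        using measurable_space[OF mY(2)] restr by (auto simp: D1_def)
      have YD2: "?Y -` D2 \<inter> space M = (?YJ -` c \<inter> space M) \<inter> (X i -` C \<inter> space M)"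
        using measurable_space[OF mY(2)] restr i(1) by (auto simp: D1_def D2_def)
      have r': "r = (U -` a \<inter> space M) \<inter> (?Y -` D1 \<inter> space M)"
        unfolding r YD1 by auto
      have "r \<inter> s = (U -` a \<inter> space M) \<inter> (?Y -` D2 \<inter> space M)"
        unfolding r s YD2 by auto
      then have "prob (r \<inter> s) = prob (U -` a \<inter> space M) * (prob (?YJ -` c \<inter> space M) * prob s)"
        using ind_init[OF a D(2)] ind_samples[OF c C] by (simp add: YD2 s)
      also have "prob (U -` a \<inter> space M) * (prob (?YJ -` c \<inter> space M) * prob s) = prob r * prob s"
        using ind_init[OF a D(1)] by (simp only: r' YD1 mult.assoc)
      finally show "prob (r \<inter> s) = prob r * prob s" .
    qed
    show "Int_stable R"
      unfolding Int_stable_def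
    proof safe
      fix r r' assume "r \<in> R" "r' \<in> R"
      then obtain a c a' c' where *: "a \<in> sets N0" "c \<in> sets (Pi\<^sub>M J (\<lambda>_. S))" "a' \<in> sets N0" "c' \<in> sets (Pi\<^sub>M J (\<lambda>_. S))"
        "r = ?T -` (a \<times> c) \<inter> space M" "r' = ?T -` (a' \<times> c') \<inter> space M"
        unfolding R_def by blast
      then have "r \<inter> r' = ?T -` ((a \<inter> a') \<times> (c \<inter> c')) \<inter> space M" by auto
      then show "r \<inter> r' \<in> R"
        unfolding R_def using sets.Int[OF *(1,3)] sets.Int[OF *(2,4)] by blast
    qed
    show "Int_stable F"
      unfolding Int_stable_def F_def
    proof safe
      fix C C' assume "C \<in> sets S" "C' \<in> sets S"
      then show "\<exists>D. X i -` C \<inter> space M \<inter> (X i -` C' \<inter> space M) = X i -` D \<inter> space M \<and> D \<in> sets S"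
        by (intro exI[of _ "C \<inter> C'"]) auto
    qed
  qed
  moreover have "X i -` C \<inter> space M \<in> sigma_sets (space M) F"
    using C by (intro sigma_sets.Basic) (auto simp: F_def)
  moreover note E[unfolded sets_past]
  ultimately show ?thesis by (blast intro: indep_setD)
qed

text \<open>A sample that is not among those determining \<open>Z\<close> may be integrated out with \<open>Z\<close> kept
  fixed, and it may be replaced by \<open>\<xi>\<close> there.\<close>

lemma nn_integral_fresh_sample:
  assumes J: "J \<subseteq> I" and i: "i \<in> I" "i \<notin> J" and Z: "Z \<in> past J \<rightarrow>\<^sub>M N"
    and h: "h \<in> borel_measurable (N \<Otimes>\<^sub>M S)"
  shows "(\<integral>\<^sup>+\<omega>. h (Z \<omega>, X i \<omega>) \<partial>M) = (\<integral>\<^sup>+\<omega>. (\<integral>\<^sup>+\<omega>'. h (Z \<omega>, \<xi> \<omega>') \<partial>M) \<partial>M)"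
proof -
  note ZM = past_measurable[OF J Z]
  note Xi = X_measurable[OF i(1)]
  interpret D1: prob_space "distr M N Z" by (rule prob_space_distr[OF ZM])
  interpret D2: prob_space "distr M S \<xi>" by (rule prob_space_distr[OF xi_measurable])
  have same: "distr M S (X i) = distr M S \<xi>"
    using iid i(1) by (simp add: iid_copies_def)
  have joint: "distr M N Z \<Otimes>\<^sub>M distr M S \<xi> = distr M (N \<Otimes>\<^sub>M S) (\<lambda>\<omega>. (Z \<omega>, X i \<omega>))"
  proof (rule pair_measure_eqI)
    show "sigma_finite_measure (distr M N Z)" "sigma_finite_measure (distr M S \<xi>)" by unfold_locales
    show "sets (distr M N Z \<Otimes>\<^sub>M distr M S \<xi>) = sets (distr M (N \<Otimes>\<^sub>M S) (\<lambda>\<omega>. (Z \<omega>, X i \<omega>)))"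
      by simp
    fix a c assume "a \<in> sets (distr M N Z)" "c \<in> sets (distr M S \<xi>)"
    then have a: "a \<in> sets N" and c: "c \<in> sets S" by auto
    have "emeasure (distr M (N \<Otimes>\<^sub>M S) (\<lambda>\<omega>. (Z \<omega>, X i \<omega>))) (a \<times> c)
        = emeasure M ((Z -` a \<inter> space M) \<inter> (X i -` c \<inter> space M))"
      using a c ZM Xi by (subst emeasure_distr) (auto intro!: arg_cong[where f = "emeasure M"])
    also have "\<dots> = ennreal (prob (Z -` a \<inter> space M) * prob (X i -` c \<inter> space M))"
      using fresh_sample_independent[OF J i _ c, of "Z -` a \<inter> space M"] measurable_sets[OF Z a]
      by (simp add: emeasure_eq_measure)
    also have "\<dots> = emeasure (distr M N Z) a * emeasure (distr M S (X i)) c"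
      using a c ZM Xi by (simp add: emeasure_distr emeasure_eq_measure ennreal_mult)
    finally show "emeasure (distr M N Z) a * emeasure (distr M S \<xi>) c
        = emeasure (distr M (N \<Otimes>\<^sub>M S) (\<lambda>\<omega>. (Z \<omega>, X i \<omega>))) (a \<times> c)"
      by (simp add: same)
  qed
  have "(\<integral>\<^sup>+\<omega>. h (Z \<omega>, X i \<omega>) \<partial>M) = (\<integral>\<^sup>+p. h p \<partial>distr M (N \<Otimes>\<^sub>M S) (\<lambda>\<omega>. (Z \<omega>, X i \<omega>)))"
    using ZM Xi h by (subst nn_integral_distr) auto
  also have "\<dots> = (\<integral>\<^sup>+z. \<integral>\<^sup>+s. h (z, s) \<partial>distr M S \<xi> \<partial>distr M N Z)"
    unfolding joint[symmetric] using h by (subst D2.nn_integral_fst[symmetric]) auto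
  also have "\<dots> = (\<integral>\<^sup>+\<omega>. \<integral>\<^sup>+s. h (Z \<omega>, s) \<partial>distr M S \<xi> \<partial>M)"
    using ZM h by (subst nn_integral_distr) (auto intro!: D2.borel_measurable_nn_integral)
  also have "\<dots> = (\<integral>\<^sup>+\<omega>. (\<integral>\<^sup>+\<omega>'. h (Z \<omega>, \<xi> \<omega>') \<partial>M) \<partial>M)"
  proof (rule nn_integral_cong)
    fix \<omega> assume "\<omega> \<in> space M"
    then have "Z \<omega> \<in> space N" using ZM by (auto dest: measurable_space)
    then have "(\<lambda>s. h (Z \<omega>, s)) \<in> borel_measurable S" using h by measurable
    then show "(\<integral>\<^sup>+s. h (Z \<omega>, s) \<partial>distr M S \<xi>) = (\<integral>\<^sup>+\<omega>'. h (Z \<omega>, \<xi> \<omega>') \<partial>M)"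
      using xi_measurable by (intro nn_integral_distr) auto
  qed
  finally show ?thesis .
qed

end

section \<open>The stochastic gradient loop\<close>

lemma norm_add_sq_le: "(norm (a + b))\<^sup>2 \<le> 2 * (norm a)\<^sup>2 + 2 * (norm b)\<^sup>2" for a b :: "'v::real_normed_vector"
proof -
  have "(norm (a + b))\<^sup>2 \<le> (norm a + norm b)\<^sup>2"
    by (intro power_mono norm_triangle_ineq) simp
  moreover have "0 \<le> (norm a - norm b)\<^sup>2" by simp
  ultimately show ?thesis by (simp add: power2_eq_square algebra_simps)
qed

lemma integrable_of_nn_integral_le:
  fixes h :: "'w \<Rightarrow> real"
  assumes h: "h \<in> borel_measurable M" "\<And>\<omega>. 0 \<le> h \<omega>" and r: "0 \<le> r"
    and le: "(\<integral>\<^sup>+\<omega>. ennreal (h \<omega>) \<partial>M) \<le> ennreal r"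
  shows "integrable M h" "(\<integral>\<omega>. h \<omega> \<partial>M) \<le> r"
proof -
  show int: "integrable M h"
    using h le by (intro integrableI_nonneg) (auto intro: le_less_trans)
  have "ennreal (\<integral>\<omega>. h \<omega> \<partial>M) \<le> ennreal r"
    using nn_integral_eq_integral[OF int] h le by simp
  then show "(\<integral>\<omega>. h \<omega> \<partial>M) \<le> r" using r by simp
qed

text \<open>A centred perturbation contributes its second moment and no cross term.\<close>

lemma (in prob_space) nn_integral_centred_perturbation:
  fixes a :: "'v::euclidean_space" and w :: "'a \<Rightarrow> 'v"
  assumes w: "has_bochner_integral M w 0" and w2: "integrable M (\<lambda>\<omega>. (norm (w \<omega>))\<^sup>2)"
  shows "(\<integral>\<^sup>+\<omega>. ennreal ((norm (a - \<tau> *\<^sub>R w \<omega>))\<^sup>2) \<partial>M)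
    = ennreal ((norm a)\<^sup>2 + \<tau>\<^sup>2 * (\<integral>\<omega>. (norm (w \<omega>))\<^sup>2 \<partial>M))"
proof -
  have eq: "(norm (a - \<tau> *\<^sub>R w \<omega>))\<^sup>2 = (norm a)\<^sup>2 - 2 * \<tau> * (a \<bullet> w \<omega>) + \<tau>\<^sup>2 * (norm (w \<omega>))\<^sup>2" for \<omega>
    by (simp add: power2_norm_eq_inner inner_diff inner_commute)
      (simp add: power2_eq_square algebra_simps)
  have int: "integrable M w" "(\<integral>\<omega>. w \<omega> \<partial>M) = 0"
    using w by (auto simp: has_bochner_integral_iff)
  then have int': "integrable M (\<lambda>\<omega>. a \<bullet> w \<omega>)" "(\<integral>\<omega>. a \<bullet> w \<omega> \<partial>M) = 0" by auto
  have "integrable M (\<lambda>\<omega>. (norm (a - \<tau> *\<^sub>R w \<omega>))\<^sup>2)"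
    unfolding eq using int' w2 by auto
  moreover have "(\<integral>\<omega>. (norm (a - \<tau> *\<^sub>R w \<omega>))\<^sup>2 \<partial>M) = (norm a)\<^sup>2 + \<tau>\<^sup>2 * (\<integral>\<omega>. (norm (w \<omega>))\<^sup>2 \<partial>M)"
    unfolding eq using int' w2 by (simp add: prob_space)
  ultimately show ?thesis by (subst nn_integral_eq_integral) auto
qed

locale gradient_sampling = sampling M "restrict_space borel \<Xi>" \<xi> X I N0 U
  for M :: "'w measure" and \<Xi> :: "'s::topological_space set" and \<xi> :: "'w \<Rightarrow> 's"
    and X :: "'i \<Rightarrow> 'w \<Rightarrow> 's" and I :: "'i set" and N0 :: "'t measure" and U :: "'w \<Rightarrow> 't"
begin

text \<open>The noise grows with the iterate, so it is split by
  \<open>(norm v)\<^sup>2 \<le> 2 * (norm (v - t))\<^sup>2 + 2 * (norm t)\<^sup>2\<close>: the first part changes the contraction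
  factor only at order \<open>\<tau>\<^sup>2\<close>, the second is the noise floor.\<close>

lemma stochastic_gradient_step:
  fixes ft :: "'v::euclidean_space \<Rightarrow> 's \<Rightarrow> real"
  assumes obj: "stochastic_objective M \<Xi> \<xi> ft f" and noise: "noise_moments M \<xi> ft f v1 v2"
    and sm: "strongly_monotone_map (\<lambda>v. grad f v + H v) c L" and H: "H \<in> borel_measurable borel"
    and J: "J \<subseteq> I" "i \<in> I" "i \<notin> J"
    and V: "V \<in> past J \<rightarrow>\<^sub>M borel" and \<theta>: "\<theta> \<in> past J \<rightarrow>\<^sub>M borel" and \<tau>: "0 \<le> \<tau>"
    and t_def: "t = (\<lambda>\<omega>. strongly_monotone_map.resolvent (\<lambda>v. grad f v + H v) (\<theta> \<omega>))"
    and int: "integrable M (\<lambda>\<omega>. (norm (V \<omega> - t \<omega>))\<^sup>2)" "integrable M (\<lambda>\<omega>. (norm (t \<omega>))\<^sup>2)"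
    and V': "\<And>\<omega>. \<omega> \<in> space M \<Longrightarrow>
      V' \<omega> = V \<omega> - \<tau> *\<^sub>R (grad (\<lambda>z. ft z (X i \<omega>)) (V \<omega>) + H (V \<omega>) + \<theta> \<omega>)"
  shows "V' \<in> past (insert i J) \<rightarrow>\<^sub>M borel"
    and "integrable M (\<lambda>\<omega>. (norm (V' \<omega> - t \<omega>))\<^sup>2)"
    and "(\<integral>\<omega>. (norm (V' \<omega> - t \<omega>))\<^sup>2 \<partial>M)
      \<le> (1 - 2 * c * \<tau> + \<tau>\<^sup>2 * (L\<^sup>2 + 2 * \<bar>v1\<bar>)) * (\<integral>\<omega>. (norm (V \<omega> - t \<omega>))\<^sup>2 \<partial>M)
        + \<tau>\<^sup>2 * (2 * \<bar>v1\<bar> * (\<integral>\<omega>. (norm (t \<omega>))\<^sup>2 \<partial>M) + \<bar>v2\<bar>)"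
proof -
  interpret N: strongly_monotone_map "\<lambda>v. grad f v + H v" c L by (rule sm)
  have res[measurable]: "N.resolvent \<in> borel_measurable borel"
    by (rule borel_measurable_continuous_onI[OF N.resolvent_continuous])
  note [measurable] = H
  let ?S = "restrict_space borel \<Xi>"
  have iJ: "insert i J \<subseteq> I" using J by auto
  have grad_meas: "(\<lambda>\<omega>. grad (\<lambda>z. ft z (X i \<omega>)) (V \<omega>)) \<in> past (insert i J) \<rightarrow>\<^sub>M borel"
    using past_mono[OF _ iJ V] sample_past[OF iJ, of i] by (intro random_gradient_measurable[OF obj]) auto
  have "(\<lambda>\<omega>. V \<omega> - \<tau> *\<^sub>R (grad (\<lambda>z. ft z (X i \<omega>)) (V \<omega>) + H (V \<omega>) + \<theta> \<omega>)) \<in> past (insert i J) \<rightarrow>\<^sub>M borel"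
    using past_mono[OF subset_insertI iJ V] past_mono[OF subset_insertI iJ \<theta>] grad_meas by measurable
  then show V'_past: "V' \<in> past (insert i J) \<rightarrow>\<^sub>M borel"
    by (subst measurable_cong[OF V']) auto
  have t_past: "t \<in> past J \<rightarrow>\<^sub>M borel" unfolding t_def using \<theta> by measurable
  have tM: "t \<in> borel_measurable M" by (rule past_measurable[OF J(1) t_past])
  have V'M: "V' \<in> borel_measurable M" by (rule past_measurable[OF iJ V'_past])
  have meas: "(\<lambda>\<omega>. (norm (V' \<omega> - t \<omega>))\<^sup>2) \<in> borel_measurable M"
    using tM V'M by measurable
  \<comment> \<open>The squared error after the step, as a function of the state before it and the sample.\<close>
  define h where "h p = (case p of ((v, \<zeta>), s) \<Rightarrow>
      ennreal ((norm (v - \<tau> *\<^sub>R (grad (\<lambda>z. ft z s) v + H v + \<zeta>) - N.resolvent \<zeta>))\<^sup>2))" for p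
  have h: "h \<in> borel_measurable ((borel \<Otimes>\<^sub>M borel) \<Otimes>\<^sub>M ?S)"
  proof -
    have "(\<lambda>p. grad (\<lambda>z. ft z (snd p)) (fst (fst p))) \<in> borel_measurable ((borel \<Otimes>\<^sub>M borel) \<Otimes>\<^sub>M ?S)"
      by (rule random_gradient_measurable[OF obj]) measurable
    then show ?thesis unfolding h_def case_prod_beta by measurable
  qed
  define q where "q = 1 - 2 * c * \<tau> + \<tau>\<^sup>2 * L\<^sup>2"
  define m where "m = 1 - 2 * c * \<tau> + \<tau>\<^sup>2 * (L\<^sup>2 + 2 * \<bar>v1\<bar>)"
  define F where "F \<omega> = m * (norm (V \<omega> - t \<omega>))\<^sup>2 + \<tau>\<^sup>2 * (2 * \<bar>v1\<bar> * (norm (t \<omega>))\<^sup>2 + \<bar>v2\<bar>)" for \<omega>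
  have inner_int: "(\<integral>\<^sup>+\<omega>'. h ((V \<omega>, \<theta> \<omega>), \<xi> \<omega>') \<partial>M) \<le> ennreal (F \<omega>) \<and> 0 \<le> F \<omega>" for \<omega>
  proof -
    define v where "v = V \<omega>"
    define w where "w \<omega>' = grad (\<lambda>z. ft z (\<xi> \<omega>')) v - grad f v" for \<omega>'
    define d where "d = grad f v + H v + \<theta> \<omega>"
    define a where "a = v - t \<omega> - \<tau> *\<^sub>R d"
    have t0: "grad f (t \<omega>) + H (t \<omega>) + \<theta> \<omega> = 0" unfolding t_def by (rule N.resolvent)
    have d: "d = (grad f v + H v) - (grad f (t \<omega>) + H (t \<omega>))"
      using t0 by (simp add: d_def eq_neg_iff_add_eq_0 algebra_simps)
    have w: "has_bochner_integral M w 0" "integrable M (\<lambda>\<omega>. (norm (w \<omega>))\<^sup>2)"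
        "(\<integral>\<omega>. (norm (w \<omega>))\<^sup>2 \<partial>M) \<le> v1 * (norm v)\<^sup>2 + v2"
      using noise unfolding noise_moments_def w_def Let_def by blast+
    have "(\<integral>\<^sup>+\<omega>'. h ((V \<omega>, \<theta> \<omega>), \<xi> \<omega>') \<partial>M) = (\<integral>\<^sup>+\<omega>'. ennreal ((norm (a - \<tau> *\<^sub>R w \<omega>'))\<^sup>2) \<partial>M)"
      by (simp add: h_def v_def[symmetric] a_def w_def d_def t_def algebra_simps)
    also have "\<dots> = ennreal ((norm a)\<^sup>2 + \<tau>\<^sup>2 * (\<integral>\<omega>. (norm (w \<omega>))\<^sup>2 \<partial>M))"
      by (rule nn_integral_centred_perturbation[OF w(1,2)])
    finally have eq: "(\<integral>\<^sup>+\<omega>'. h ((V \<omega>, \<theta> \<omega>), \<xi> \<omega>') \<partial>M)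
      = ennreal ((norm a)\<^sup>2 + \<tau>\<^sup>2 * (\<integral>\<omega>. (norm (w \<omega>))\<^sup>2 \<partial>M))" .
    have "(norm a)\<^sup>2 = (norm (v - t \<omega>))\<^sup>2 - 2 * \<tau> * (d \<bullet> (v - t \<omega>)) + \<tau>\<^sup>2 * (norm d)\<^sup>2"
      unfolding a_def by (simp add: power2_norm_eq_inner inner_diff inner_commute algebra_simps)
        (simp add: power2_eq_square algebra_simps)
    also have "\<dots> \<le> (norm (v - t \<omega>))\<^sup>2 - 2 * \<tau> * (c * (norm (v - t \<omega>))\<^sup>2) + \<tau>\<^sup>2 * (L * norm (v - t \<omega>))\<^sup>2"
      unfolding d using \<tau>
      by (intro add_mono diff_left_mono mult_left_mono N.strong_mono power_mono N.lip) auto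
    also have "\<dots> = q * (norm (v - t \<omega>))\<^sup>2"
      by (simp add: q_def power_mult_distrib algebra_simps)
    finally have a: "(norm a)\<^sup>2 \<le> q * (norm (v - t \<omega>))\<^sup>2" .
    have "(\<integral>\<omega>. (norm (w \<omega>))\<^sup>2 \<partial>M) \<le> \<bar>v1\<bar> * (norm v)\<^sup>2 + \<bar>v2\<bar>"
      using w(3) mult_right_mono[OF abs_ge_self[of v1], of "(norm v)\<^sup>2"] by simp
    also have "(norm v)\<^sup>2 \<le> 2 * (norm (v - t \<omega>))\<^sup>2 + 2 * (norm (t \<omega>))\<^sup>2"
      using norm_add_sq_le[of "v - t \<omega>" "t \<omega>"] by simp
    finally have "(\<integral>\<omega>. (norm (w \<omega>))\<^sup>2 \<partial>M)
        \<le> \<bar>v1\<bar> * (2 * (norm (v - t \<omega>))\<^sup>2 + 2 * (norm (t \<omega>))\<^sup>2) + \<bar>v2\<bar>"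
      by (simp add: mult_left_mono)
    then have "\<tau>\<^sup>2 * (\<integral>\<omega>. (norm (w \<omega>))\<^sup>2 \<partial>M)
        \<le> \<tau>\<^sup>2 * (\<bar>v1\<bar> * (2 * (norm (v - t \<omega>))\<^sup>2 + 2 * (norm (t \<omega>))\<^sup>2) + \<bar>v2\<bar>)"
      by (rule mult_left_mono) simp
    with a have le: "(norm a)\<^sup>2 + \<tau>\<^sup>2 * (\<integral>\<omega>. (norm (w \<omega>))\<^sup>2 \<partial>M) \<le> F \<omega>"
      by (simp add: F_def q_def m_def v_def[symmetric] algebra_simps)
    moreover have "0 \<le> (norm a)\<^sup>2 + \<tau>\<^sup>2 * (\<integral>\<omega>. (norm (w \<omega>))\<^sup>2 \<partial>M)" by simp
    ultimately have "0 \<le> F \<omega>" by (rule order_trans[rotated])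
    with le show ?thesis unfolding eq by (intro conjI ennreal_leI)
  qed
  have F_int: "integrable M F" unfolding F_def using int by auto
  have "(\<integral>\<^sup>+\<omega>. ennreal ((norm (V' \<omega> - t \<omega>))\<^sup>2) \<partial>M) = (\<integral>\<^sup>+\<omega>. h ((V \<omega>, \<theta> \<omega>), X i \<omega>) \<partial>M)"
    by (intro nn_integral_cong) (simp add: V' h_def t_def)
  also have "\<dots> = (\<integral>\<^sup>+\<omega>. (\<integral>\<^sup>+\<omega>'. h ((V \<omega>, \<theta> \<omega>), \<xi> \<omega>') \<partial>M) \<partial>M)"
    using V \<theta> by (intro nn_integral_fresh_sample[OF J _ h]) measurable
  also have "\<dots> \<le> (\<integral>\<^sup>+\<omega>. ennreal (F \<omega>) \<partial>M)"
    using inner_int by (intro nn_integral_mono) auto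
  also have "\<dots> = ennreal (\<integral>\<omega>. F \<omega> \<partial>M)"
    using inner_int by (intro nn_integral_eq_integral[OF F_int]) auto
  finally have le: "(\<integral>\<^sup>+\<omega>. ennreal ((norm (V' \<omega> - t \<omega>))\<^sup>2) \<partial>M) \<le> ennreal (\<integral>\<omega>. F \<omega> \<partial>M)" .
  have F_nn: "0 \<le> (\<integral>\<omega>. F \<omega> \<partial>M)" using inner_int by (intro integral_nonneg_AE) auto
  from integrable_of_nn_integral_le[OF meas _ F_nn le]
  have *: "integrable M (\<lambda>\<omega>. (norm (V' \<omega> - t \<omega>))\<^sup>2)"
    "(\<integral>\<omega>. (norm (V' \<omega> - t \<omega>))\<^sup>2 \<partial>M) \<le> (\<integral>\<omega>. F \<omega> \<partial>M)" by auto
  show "integrable M (\<lambda>\<omega>. (norm (V' \<omega> - t \<omega>))\<^sup>2)" by (rule *(1))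
  have "(\<integral>\<omega>. F \<omega> \<partial>M) = m * (\<integral>\<omega>. (norm (V \<omega> - t \<omega>))\<^sup>2 \<partial>M)
        + \<tau>\<^sup>2 * (2 * \<bar>v1\<bar> * (\<integral>\<omega>. (norm (t \<omega>))\<^sup>2 \<partial>M) + \<bar>v2\<bar>)"
    unfolding F_def using int by (simp add: prob_space)
  then show "(\<integral>\<omega>. (norm (V' \<omega> - t \<omega>))\<^sup>2 \<partial>M)
      \<le> (1 - 2 * c * \<tau> + \<tau>\<^sup>2 * (L\<^sup>2 + 2 * \<bar>v1\<bar>)) * (\<integral>\<omega>. (norm (V \<omega> - t \<omega>))\<^sup>2 \<partial>M)
        + \<tau>\<^sup>2 * (2 * \<bar>v1\<bar> * (\<integral>\<omega>. (norm (t \<omega>))\<^sup>2 \<partial>M) + \<bar>v2\<bar>)"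
    using *(2) by (simp add: m_def)
qed

text \<open>The constant \<open>K\<close> is chosen before the length of the loop, its starting point and its target, so
  that one constant serves all major iterations.\<close>

lemma stochastic_gradient_loop:
  fixes ft :: "'v::euclidean_space \<Rightarrow> 's \<Rightarrow> real"
  assumes obj: "stochastic_objective M \<Xi> \<xi> ft f" and noise: "noise_moments M \<xi> ft f v1 v2"
    and sm: "strongly_monotone_map (\<lambda>v. grad f v + H v) c L" and H: "H \<in> borel_measurable borel"
    and step: "1 < 2 * c * s"
  obtains K where "K > 0"
    "\<And>J idx n V \<theta> t.
      J \<subseteq> I \<Longrightarrow> idx ` {1..<n} \<subseteq> I - J \<Longrightarrow> inj_on idx {1..<n} \<Longrightarrow> 1 \<le> n \<Longrightarrow>
      V 1 \<in> past J \<rightarrow>\<^sub>M borel \<Longrightarrow> \<theta> \<in> past J \<rightarrow>\<^sub>M borel \<Longrightarrow>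
      t = (\<lambda>\<omega>. strongly_monotone_map.resolvent (\<lambda>v. grad f v + H v) (\<theta> \<omega>)) \<Longrightarrow>
      integrable M (\<lambda>\<omega>. (norm (V 1 \<omega> - t \<omega>))\<^sup>2) \<Longrightarrow> integrable M (\<lambda>\<omega>. (norm (t \<omega>))\<^sup>2) \<Longrightarrow>
      (\<And>j \<omega>. j \<in> {1..<n} \<Longrightarrow> \<omega> \<in> space M \<Longrightarrow>
        V (Suc j) \<omega> = V j \<omega> - (s / real j) *\<^sub>R (grad (\<lambda>z. ft z (X (idx j) \<omega>)) (V j \<omega>) + H (V j \<omega>) + \<theta> \<omega>)) \<Longrightarrow>
      V n \<in> past (J \<union> idx ` {1..<n}) \<rightarrow>\<^sub>M borel \<and>
      integrable M (\<lambda>\<omega>. (norm (V n \<omega> - t \<omega>))\<^sup>2) \<and>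
      (\<integral>\<omega>. (norm (V n \<omega> - t \<omega>))\<^sup>2 \<partial>M)
        \<le> K / real n * ((\<integral>\<omega>. (norm (V 1 \<omega> - t \<omega>))\<^sup>2 \<partial>M) + (\<integral>\<omega>. (norm (t \<omega>))\<^sup>2 \<partial>M) + 1)"
proof -
  have "0 < c" using sm by (simp add: strongly_monotone_map_def)
  then have s: "s > 0" using step zero_less_mult_pos[of "2 * c" s] by simp
  define a where "a = 2 * c * s"
  define D where "D = s\<^sup>2 * (L\<^sup>2 + 2 * \<bar>v1\<bar>)"
  define W where "W = s\<^sup>2 * (2 * \<bar>v1\<bar> + \<bar>v2\<bar>)"
  have nn: "0 \<le> D" "0 \<le> W" by (auto simp: D_def W_def)
  obtain C where C: "C > 0"
    "\<And>d n N. N \<ge> 0 \<Longrightarrow> (\<And>j. 1 \<le> j \<Longrightarrow> j \<le> n \<Longrightarrow> 0 \<le> d j) \<Longrightarrow>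
      (\<And>j. 1 \<le> j \<Longrightarrow> j < n \<Longrightarrow>
        d (Suc j) \<le> (1 - a / real j + D / (real j)\<^sup>2) * d j + N / (real j)\<^sup>2) \<Longrightarrow>
      1 \<le> n \<Longrightarrow> d n \<le> C * (d 1 + N) / real n"
    using robbins_monro_recurrence[of a D] step nn unfolding a_def by metis
  show ?thesis
  proof (rule that)
    show "C * (1 + W) > 0" using C(1) nn by simp
    fix J :: "'i set" and idx n and V :: "nat \<Rightarrow> 'w \<Rightarrow> 'v" and \<theta> t
    assume J: "J \<subseteq> I" and idx: "idx ` {1..<n} \<subseteq> I - J" "inj_on idx {1..<n}" and n: "1 \<le> n"
      and V1: "V 1 \<in> past J \<rightarrow>\<^sub>M borel" and \<theta>: "\<theta> \<in> past J \<rightarrow>\<^sub>M borel"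
      and t: "t = (\<lambda>\<omega>. strongly_monotone_map.resolvent (\<lambda>v. grad f v + H v) (\<theta> \<omega>))"
      and int: "integrable M (\<lambda>\<omega>. (norm (V 1 \<omega> - t \<omega>))\<^sup>2)" "integrable M (\<lambda>\<omega>. (norm (t \<omega>))\<^sup>2)"
      and rec: "\<And>j \<omega>. j \<in> {1..<n} \<Longrightarrow> \<omega> \<in> space M \<Longrightarrow>
        V (Suc j) \<omega> = V j \<omega> - (s / real j) *\<^sub>R (grad (\<lambda>z. ft z (X (idx j) \<omega>)) (V j \<omega>) + H (V j \<omega>) + \<theta> \<omega>)"
    define d where "d j = (\<integral>\<omega>. (norm (V j \<omega> - t \<omega>))\<^sup>2 \<partial>M)" for j
    define E where "E = (\<integral>\<omega>. (norm (t \<omega>))\<^sup>2 \<partial>M)"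
    define N where "N = s\<^sup>2 * (2 * \<bar>v1\<bar> * E + \<bar>v2\<bar>)"
    have E: "0 \<le> E" unfolding E_def by simp
    then have N: "0 \<le> N" by (simp add: N_def)
    have d: "0 \<le> d j" for j unfolding d_def by simp
    have main: "V j \<in> past (J \<union> idx ` {1..<j}) \<rightarrow>\<^sub>M borel \<and> integrable M (\<lambda>\<omega>. (norm (V j \<omega> - t \<omega>))\<^sup>2) \<and>
        (1 < j \<longrightarrow> d j \<le> (1 - a / real (j - 1) + D / (real (j - 1))\<^sup>2) * d (j - 1) + N / (real (j - 1))\<^sup>2)"
      if "1 \<le> j" "j \<le> n" for j
      using that
    proof (induction j rule: nat_induct_at_least)
      case base
      then show ?case using V1 int by simp
    next
      case (Suc j)
      have j: "j \<in> {1..<n}" "j \<ge> 1" using Suc by auto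
      let ?J = "J \<union> idx ` {1..<j}"
      have "idx ` {1..<j} \<subseteq> idx ` {1..<n}" using j by (intro image_mono) auto
      then have sub: "?J \<subseteq> I" using J idx(1) by blast
      have i: "idx j \<in> I" "idx j \<notin> ?J"
      proof -
        have "idx j \<in> idx ` {1..<n}" using j(1) by (rule imageI)
        then have *: "idx j \<in> I" "idx j \<notin> J" using idx(1) by auto
        show "idx j \<in> I" by (rule *(1))
        have "idx j \<notin> idx ` {1..<j}"
        proof
          assume "idx j \<in> idx ` {1..<j}"
          then obtain j' where "j' \<in> {1..<j}" "idx j = idx j'" by blast
          then show False using inj_onD[OF idx(2), of j j'] j by auto
        qed
        with *(2) show "idx j \<notin> ?J" by simp
      qed
      have ins: "insert (idx j) ?J = J \<union> idx ` {1..<Suc j}"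
        using j by (auto simp: atLeastLessThanSuc)
      have IH: "V j \<in> past ?J \<rightarrow>\<^sub>M borel" "integrable M (\<lambda>\<omega>. (norm (V j \<omega> - t \<omega>))\<^sup>2)"
        using Suc by auto
      have \<theta>': "\<theta> \<in> past ?J \<rightarrow>\<^sub>M borel" by (rule past_mono[OF Un_upper1 sub \<theta>])
      have \<tau>: "0 \<le> s / real j" using s by simp
      note st = stochastic_gradient_step[OF obj noise sm H sub i IH(1) \<theta>' \<tau> t IH(2) int(2) rec[OF j(1)]]
      have eq: "2 * c * (s / real j) = a / real j" "(s / real j)\<^sup>2 * (L\<^sup>2 + 2 * \<bar>v1\<bar>) = D / (real j)\<^sup>2"
        "(s / real j)\<^sup>2 * (2 * \<bar>v1\<bar> * E + \<bar>v2\<bar>) = N / (real j)\<^sup>2"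
        by (simp_all add: a_def D_def N_def power_divide)
      show ?case
        using st(1,2) st(3)[folded E_def, unfolded eq] unfolding ins d_def by simp
    qed
    have "d n \<le> C * (d 1 + N) / real n"
      using N d main[of "Suc _"] n by (intro C(2)) auto
    also have "\<dots> = C / real n * (d 1 + N)" by simp
    also have "\<dots> \<le> C / real n * ((1 + W) * (d 1 + E + 1))"
    proof (rule mult_left_mono)
      have "N \<le> W * (E + 1)"
        using E by (simp add: N_def W_def algebra_simps)
      moreover have "W * (E + 1) \<le> W * (d 1 + E + 1)" using d nn by (intro mult_left_mono) auto
      moreover have "d 1 \<le> d 1 + E + 1" using E by simp
      ultimately show "d 1 + N \<le> (1 + W) * (d 1 + E + 1)"
        unfolding distrib_right[of 1 W] mult_1 by linarith
    qed (use C in simp)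
    finally have "d n \<le> C * (1 + W) / real n * (d 1 + E + 1)" by simp
    then show "V n \<in> past (J \<union> idx ` {1..<n}) \<rightarrow>\<^sub>M borel \<and>
      integrable M (\<lambda>\<omega>. (norm (V n \<omega> - t \<omega>))\<^sup>2) \<and>
      (\<integral>\<omega>. (norm (V n \<omega> - t \<omega>))\<^sup>2 \<partial>M)
        \<le> C * (1 + W) / real n * ((\<integral>\<omega>. (norm (V 1 \<omega> - t \<omega>))\<^sup>2 \<partial>M) + (\<integral>\<omega>. (norm (t \<omega>))\<^sup>2 \<partial>M) + 1)"
      using main[of n] n unfolding d_def E_def by simp
  qed
qed

end

section \<open>Quadratic forms and the G-norm\<close>

\<comment> \<open>Transposes act from the left throughout; this rule would turn them into row vector products.\<close>
declare transpose_matrix_vector [simp del]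

lemma matrix_bound: "norm (K *v z) \<le> onorm ((*v) K) * norm z" for K :: "real^'n^'m"
  by (rule onorm) (rule matrix_vector_mul_bounded_linear)

lemma onorm_matrix_nonneg: "0 \<le> onorm ((*v) K)" for K :: "real^'n^'m"
  by (rule onorm_pos_le) (rule matrix_vector_mul_bounded_linear)

lemma inner_matrix_right: "z \<bullet> (K *v w) = (transpose K *v z) \<bullet> w" for K :: "real^'n^'m"
  by (metis dot_lmul_matrix transpose_matrix_vector)

lemma inner_transpose_left: "(transpose K *v z) \<bullet> w = z \<bullet> (K *v w)" for K :: "real^'n^'m"
  by (simp only: inner_matrix_right)

lemma inner_transpose_right: "w \<bullet> (transpose K *v z) = (K *v w) \<bullet> z" for K :: "real^'n^'m"
  by (metis inner_commute inner_transpose_left)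

lemma pos_def_mat_symm: "pos_def_mat K \<Longrightarrow> z \<bullet> (K *v w) = w \<bullet> (K *v z)"
  by (metis inner_commute inner_matrix_right pos_def_mat_def)

lemma pos_def_mat_coercive:
  assumes "pos_def_mat K"
  obtains k where "k > 0" "\<And>z. k * (norm z)\<^sup>2 \<le> qform K z"
proof -
  let ?S = "sphere (0::real^'a) 1"
  have "?S \<noteq> {}" by simp
  moreover have "continuous_on ?S (qform K)"
    unfolding qform_def
    by (intro continuous_intros linear_continuous_on matrix_vector_mul_bounded_linear)
  ultimately obtain m where m: "m \<in> ?S" "\<And>z. z \<in> ?S \<Longrightarrow> qform K m \<le> qform K z"
    using continuous_attains_inf[of ?S "qform K"] by auto
  have "qform K m * (norm z)\<^sup>2 \<le> qform K z" for z
  proof (cases "z = 0")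
    case False
    have "qform K m \<le> qform K (z /\<^sub>R norm z)" using False by (intro m(2)) simp
    also have "\<dots> = qform K z / (norm z)\<^sup>2"
      by (simp add: qform_def scaleR_vector_matrix_assoc matrix_vector_mult_scaleR power2_eq_square divide_inverse)
    finally show ?thesis using False by (simp add: pos_le_divide_eq)
  qed (simp add: qform_def)
  moreover have "qform K m > 0"
    using assms m(1) by (cases "m = 0") (auto simp: pos_def_mat_def qform_def)
  ultimately show ?thesis using that by blast
qed

lemma qform_le: "qform K z \<le> onorm ((*v) K) * (norm z)\<^sup>2"
proof -
  have "qform K z \<le> norm z * norm (K *v z)" unfolding qform_def by (rule norm_cauchy_schwarz)
  also have "\<dots> \<le> norm z * (onorm ((*v) K) * norm z)"
    by (intro mult_left_mono matrix_bound) simp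
  finally show ?thesis by (simp add: power2_eq_square mult_ac)
qed

lemma qform_add:
  assumes "pos_def_mat K"
  shows "qform K (z + w) = qform K z + 2 * (z \<bullet> (K *v w)) + qform K w"
  using pos_def_mat_symm[OF assms, of z w]
  by (simp add: qform_def matrix_vector_right_distrib inner_add_left inner_add_right)

lemma qform_nonneg: "pos_def_mat K \<Longrightarrow> 0 \<le> qform K z"
  by (cases "z = 0") (auto simp: qform_def pos_def_mat_def less_imp_le)

text \<open>Young's inequality: the cross term is absorbed because the form is nonnegative at
  \<open>\<alpha> z - w\<close>.\<close>

lemma qform_young:
  assumes "pos_def_mat K" "\<alpha> > 0"
  shows "qform K (z + w) \<le> (1 + \<alpha>) * qform K z + (1 + 1 / \<alpha>) * qform K w"
proof -
  have minus: "K *v (- v) = - (K *v v)" for v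
    by (metis matrix_vector_mult_scaleR scaleR_minus1_left)
  have "0 \<le> qform K (\<alpha> *\<^sub>R z + (- 1) *\<^sub>R w)" using assms(1) by (rule qform_nonneg)
  also have "\<dots> = \<alpha>\<^sup>2 * qform K z - 2 * \<alpha> * (z \<bullet> (K *v w)) + qform K w"
    unfolding qform_add[OF assms(1)]
    by (simp add: qform_def matrix_vector_mult_scaleR power2_eq_square minus)
  finally have "\<alpha> * (2 * (z \<bullet> (K *v w))) \<le> \<alpha> * (\<alpha> * qform K z + 1 / \<alpha> * qform K w)"
    using assms(2) by (simp add: power2_eq_square algebra_simps)
  then have "2 * (z \<bullet> (K *v w)) \<le> \<alpha> * qform K z + 1 / \<alpha> * qform K w"
    using assms(2) by (rule mult_left_le_imp_le)
  then show ?thesis unfolding qform_add[OF assms(1)] by (simp add: algebra_simps)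
qed

lemma scalar_mat_mult: "(mat k :: real^'n^'n) *v z = k *\<^sub>R z"
proof -
  have "(mat k :: real^'n^'n) = k *\<^sub>R mat 1" by (simp add: mat_def vec_eq_iff)
  then show ?thesis by (simp add: scaleR_matrix_vector_assoc[symmetric])
qed

lemma pos_def_mat_scalar: "k > 0 \<Longrightarrow> pos_def_mat (mat k :: real^'n^'n)"
  by (simp add: pos_def_mat_def transpose_mat scalar_mat_mult)

lemma qform_scalar: "qform (mat k :: real^'n^'n) z = k * (norm z)\<^sup>2"
  by (simp add: qform_def scalar_mat_mult power2_norm_eq_inner)

lemma norm_triple_sq: "(norm (x, y, l))\<^sup>2 = (norm x)\<^sup>2 + (norm y)\<^sup>2 + (norm l)\<^sup>2"
  by (simp add: norm_Pair)

text \<open>Full row rank of \<open>[A B]\<close> means that the linear map \<open>l \<mapsto> (A\<^sup>T l, B\<^sup>T l)\<close> is injective.\<close>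

lemma full_row_rank_bounded_below:
  fixes A :: "real^'n^'p" and B :: "real^'m^'p"
  assumes "rank (hconcat A B) = CARD('p)"
  obtains k where "k > 0" "\<And>l. norm l \<le> k * (norm (transpose A *v l) + norm (transpose B *v l))"
proof -
  have "inj ((*v) (transpose (hconcat A B)))"
    using assms by (simp add: full_rank_injective[symmetric] rank_transpose)
  then have *: "l = 0" if "transpose (hconcat A B) *v l = 0" for l
    using that by (metis injD matrix_vector_mult_0_right)
  define F where "F l = (transpose A *v l, transpose B *v l)" for l
  have lin: "linear F"
    unfolding F_def
    by (rule linearI) (simp_all add: matrix_vector_right_distrib matrix_vector_mult_scaleR)
  have "l = 0" if "F l = 0" for l
  proof (rule *)
    have "(transpose A *v l) $ i = 0" "(transpose B *v l) $ j = 0" for i j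
      using that by (auto simp: F_def zero_prod_def)
    then have "(transpose (hconcat A B) *v l) $ k = 0" for k
      by (cases k) (simp_all add: matrix_vector_mult_def transpose_def hconcat_def)
    then show "transpose (hconcat A B) *v l = 0" by (simp add: vec_eq_iff)
  qed
  then have "inj F" using lin by (simp add: linear_injective_0)
  then obtain c where c: "c > 0" "\<And>l. c * norm l \<le> norm (F l)"
    using linear_inj_bounded_below_pos[OF lin] by auto
  show ?thesis
  proof (rule that)
    fix l
    have "c * norm l \<le> norm (transpose A *v l) + norm (transpose B *v l)"
      using c(2)[of l] norm_Pair_le[of "transpose A *v l" "transpose B *v l"]
      by (simp add: F_def)
    then show "norm l \<le> 1 / c * (norm (transpose A *v l) + norm (transpose B *v l))"
      using c(1) by (simp add: field_simps)
  qed (use c in simp)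
qed

section \<open>The exact update as a pair of resolvents\<close>

text \<open>The part of the gradient of a subproblem that does not involve the variable \<open>v\<close> of the
  subproblem: the gradient of the augmented Lagrangian plus the proximal term is
  \<open>\<nabla> h v + P_hat v + linear_part\<close>, see \<open>linear_part_eq\<close>.\<close>

definition linear_part ::
  "real^'n^'p \<Rightarrow> real^'m^'p \<Rightarrow> real^'p \<Rightarrow> real \<Rightarrow> real^'n^'n \<Rightarrow> real^'m \<Rightarrow> real^'p \<Rightarrow> real^'n \<Rightarrow> real^'n" where
  "linear_part A B b \<rho> P w l z = \<rho> *\<^sub>R (transpose A *v (B *v w - b)) - transpose A *v l - P *v z"

lemma aug_lag_swap: "aug_lag A B b \<rho> f g x y l = aug_lag B A b \<rho> g f y x l"
  by (simp add: aug_lag_def add.commute)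

lemma P_hat_mult: "P_hat A \<rho> P *v v = P *v v + \<rho> *\<^sub>R (transpose A *v (A *v v))"
  by (simp add: P_hat_def matrix_vector_mult_add_rdistrib scaleR_matrix_vector_assoc[symmetric]
      matrix_vector_mul_assoc)

lemma transpose_P_hat: "transpose (P_hat A \<rho> P) = P_hat A \<rho> P \<longleftrightarrow> transpose P = P"
proof -
  have "transpose (P_hat A \<rho> P) = P_hat A \<rho> (transpose P)"
    by (simp add: P_hat_def transpose_def vec_eq_iff matrix_matrix_mult_def mult.commute)
  then show ?thesis by (simp add: P_hat_def)
qed

lemma linear_part_eq:
  "D - transpose A *v l + \<rho> *\<^sub>R (transpose A *v (A *v v + B *v w - b)) + P *v (v - z)
    = D + P_hat A \<rho> P *v v + linear_part A B b \<rho> P w l z"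
  by (simp add: P_hat_mult linear_part_def algebra_simps matrix_vector_right_distrib
      matrix_vector_mult_diff_distrib)

lemma GDERIV_subproblem:
  assumes "GDERIV h v :> D" "transpose P = P"
  shows "GDERIV (\<lambda>v. aug_lag A B b \<rho> h g v w l + 1/2 * qform P (v - z)) v :>
    D + P_hat A \<rho> P *v v + linear_part A B b \<rho> P w l z"
  unfolding linear_part_eq[symmetric]
  by (intro GDERIV_add GDERIV_aug_lag_x GDERIV_half_qform_diff assms)

lemma strongly_monotone_subproblem:
  assumes sc: "strongly_convex c (\<lambda>v. aug_lag A B b \<rho> h g v w l + 1/2 * qform P (v - z))"
    and sm: "lipschitz_gradient L (\<lambda>v. aug_lag A B b \<rho> h g v w l + 1/2 * qform P (v - z))"
    and h: "\<And>v. h differentiable (at v)" and P: "transpose P = P"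
  shows "strongly_monotone_map (\<lambda>v. grad h v + P_hat A \<rho> P *v v) c L"
proof
  note D = GDERIV_subproblem[OF GDERIV_grad[OF h] P, of A B b \<rho> g w l z]
  show "0 < c" using sc by (simp add: strongly_convex_def)
  fix v v'
  show "c * (norm (v - v'))\<^sup>2 \<le> (grad h v + P_hat A \<rho> P *v v - (grad h v' + P_hat A \<rho> P *v v')) \<bullet> (v - v')"
    using strongly_convex_strongly_monotone[OF sc D D, of v v'] by simp
  show "norm (grad h v + P_hat A \<rho> P *v v - (grad h v' + P_hat A \<rho> P *v v')) \<le> L * norm (v - v')"
    using lipschitz_onD[OF conjunct2[OF sm[unfolded lipschitz_gradient_def]], of v v']
    unfolding grad_eqI[OF D] by (simp add: dist_norm)
qed

locale admm =
  fixes A :: "real^'n^'p" and B :: "real^'m^'p" and b :: "real^'p"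
    and P :: "real^'n^'n" and Q :: "real^'m^'m" and \<rho> \<gamma> :: real
    and f :: "real^'n \<Rightarrow> real" and g :: "real^'m \<Rightarrow> real"
    and xs :: "real^'n" and ys :: "real^'m" and ls :: "real^'p"
    and \<mu>f \<sigma>g Lf Lg cx Lx cy Ly :: real
  assumes scalars: "\<rho> > 0" "\<gamma> > 0"
    and kkt: "is_KKT A B b f g (xs, ys, ls)"
    and pd: "pos_def_mat Q" "pos_def_mat (P_hat A \<rho> P)"
    and sc: "strongly_convex \<mu>f f" "strongly_convex \<sigma>g g"
    and smooth: "lipschitz_gradient Lf f" "lipschitz_gradient Lg g"
    and full_row_rank: "rank (hconcat A B) = CARD('p)"
    and gamma_cond: "P \<noteq> 0 \<longrightarrow> pos_def_mat ((2 - \<gamma>) *\<^sub>R P - ((\<gamma> - 1) * \<rho>) *\<^sub>R (transpose A ** A))"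
      "P = 0 \<longrightarrow> \<gamma> = 1"
    and cy: "\<And>x0 l0 z. strongly_convex cy (\<lambda>v. aug_lag A B b \<rho> f g x0 v l0 + 1/2 * qform Q (v - z))"
    and Ly: "\<And>x0 l0 z. lipschitz_gradient Ly (\<lambda>v. aug_lag A B b \<rho> f g x0 v l0 + 1/2 * qform Q (v - z))"
    and cx: "\<And>y0 l0 z. strongly_convex cx (\<lambda>v. aug_lag A B b \<rho> f g v y0 l0 + 1/2 * qform P (v - z))"
    and Lx: "\<And>y0 l0 z. lipschitz_gradient Lx (\<lambda>v. aug_lag A B b \<rho> f g v y0 l0 + 1/2 * qform P (v - z))"
begin

abbreviation "us \<equiv> (xs, ys, ls)"
abbreviation "G \<equiv> G_sqnorm A \<rho> \<gamma> P Q"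
abbreviation "upd \<equiv> exact_update A B b \<rho> \<gamma> P Q f g"

lemma symm: "transpose P = P" "transpose Q = Q"
  using pd transpose_P_hat[of A \<rho> P] by (auto simp: pos_def_mat_def)

lemma diff: "f differentiable (at v)" "g differentiable (at w)"
  using smooth by (auto simp: lipschitz_gradient_def)

lemma kkt_eqs:
  "grad f xs = transpose A *v ls" "grad g ys = transpose B *v ls" "A *v xs + B *v ys = b"
  using kkt diff by (auto simp: is_KKT_def intro!: subdifferential_grad)

abbreviation "Nx \<equiv> \<lambda>v. grad f v + P_hat A \<rho> P *v v"
abbreviation "Ny \<equiv> \<lambda>v. grad g v + P_hat B \<rho> Q *v v"

sublocale X: strongly_monotone_map Nx cx Lx
  by (rule strongly_monotone_subproblem[OF cx Lx diff(1) symm(1)])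

sublocale Y: strongly_monotone_map Ny cy Ly
  by (rule strongly_monotone_subproblem[OF cy[unfolded aug_lag_swap[of A]]
        Ly[unfolded aug_lag_swap[of A]] diff(2) symm(2)])

text \<open>The exact minimisers of the two subproblems. The argument \<open>y'\<close> of \<open>prox_x\<close> is kept separate
  because the algorithm solves the \<open>x\<close>-problem with an inexact \<open>y'\<close>.\<close>

definition prox_y :: "real^'n \<Rightarrow> real^'m \<Rightarrow> real^'p \<Rightarrow> real^'m" where
  "prox_y x y l = Y.resolvent (linear_part B A b \<rho> Q x l y)"

definition prox_x :: "real^'n \<Rightarrow> real^'m \<Rightarrow> real^'p \<Rightarrow> real^'n" where
  "prox_x x y' l = X.resolvent (linear_part A B b \<rho> P y' l x)"

definition dual_step :: "real^'n \<Rightarrow> real^'m \<Rightarrow> real^'p \<Rightarrow> real^'p" where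
  "dual_step x' y' l = l - (\<gamma> * \<rho>) *\<^sub>R (A *v x' + B *v y' - b)"

lemma exact_update_eq:
  "upd (x, y, l) = (prox_x x (prox_y x y l) l, prox_y x y l,
     dual_step (prox_x x (prox_y x y l) l) (prox_y x y l) l)"
proof -
  have "arg_min (\<lambda>v. aug_lag A B b \<rho> f g x v l + 1/2 * qform Q (v - y)) (\<lambda>_. True) = prox_y x y l"
  proof (rule strongly_convex_arg_min[OF cy])
    show "GDERIV (\<lambda>v. aug_lag A B b \<rho> f g x v l + 1/2 * qform Q (v - y)) (prox_y x y l) :> 0"
      using GDERIV_subproblem[OF GDERIV_grad[OF diff(2)] symm(2),
          of B A b \<rho> f x l y "prox_y x y l"]
        Y.resolvent[of "linear_part B A b \<rho> Q x l y"]
      by (simp add: prox_y_def aug_lag_swap[of A])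
  qed
  moreover have "arg_min (\<lambda>v. aug_lag A B b \<rho> f g v y' l + 1/2 * qform P (v - x)) (\<lambda>_. True)
      = prox_x x y' l" for y'
  proof (rule strongly_convex_arg_min[OF cx])
    show "GDERIV (\<lambda>v. aug_lag A B b \<rho> f g v y' l + 1/2 * qform P (v - x)) (prox_x x y' l) :> 0"
      using GDERIV_subproblem[OF GDERIV_grad[OF diff(1)] symm(1),
          of A B b \<rho> g y' l x "prox_x x y' l"]
        X.resolvent[of "linear_part A B b \<rho> P y' l x"]
      by (simp add: prox_x_def)
  qed
  ultimately show ?thesis by (simp add: exact_update_def Let_def dual_step_def)
qed

lemma prox_y_stationary:
  "grad g (prox_y x y l) - transpose B *v l
    + \<rho> *\<^sub>R (transpose B *v (A *v x + B *v prox_y x y l - b)) + Q *v (prox_y x y l - y) = 0"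
  using linear_part_eq[of "grad g (prox_y x y l)" B l \<rho> "prox_y x y l" A x b Q y]
    Y.resolvent[of "linear_part B A b \<rho> Q x l y"]
  by (simp add: prox_y_def add.commute[of "A *v _"])

lemma prox_x_stationary:
  "grad f (prox_x x y' l) - transpose A *v l
    + \<rho> *\<^sub>R (transpose A *v (A *v prox_x x y' l + B *v y' - b)) + P *v (prox_x x y' l - x) = 0"
  using linear_part_eq[of "grad f (prox_x x y' l)" A l \<rho> "prox_x x y' l" B y' b P x]
    X.resolvent[of "linear_part A B b \<rho> P y' l x"]
  by (simp add: prox_x_def)

lemma prox_fixed: "prox_y xs ys ls = ys" "prox_x xs ys ls = xs"
proof -
  have "Ny ys + linear_part B A b \<rho> Q xs ls ys = 0" "Nx xs + linear_part A B b \<rho> P ys ls xs = 0"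
    using kkt_eqs by (simp_all add: linear_part_eq[symmetric] add.commute[of "B *v _"])
  then show "prox_y xs ys ls = ys" "prox_x xs ys ls = xs"
    by (auto simp: prox_y_def prox_x_def Y.resolvent_eqI X.resolvent_eqI)
qed

end

section \<open>Contraction of the exact update\<close>

lemma sum5_square_le:
  fixes a b c d e :: real
  shows "(a + b + c + d + e)\<^sup>2 \<le> 5 * (a\<^sup>2 + b\<^sup>2 + c\<^sup>2 + d\<^sup>2 + e\<^sup>2)"
proof -
  have "0 \<le> (a-b)\<^sup>2 + (a-c)\<^sup>2 + (a-d)\<^sup>2 + (a-e)\<^sup>2 + (b-c)\<^sup>2 + (b-d)\<^sup>2 + (b-e)\<^sup>2 + (c-d)\<^sup>2 + (c-e)\<^sup>2 + (d-e)\<^sup>2"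
    by simp
  then show ?thesis by (simp add: power2_eq_square algebra_simps)
qed

context admm
begin

lemma scpos: "\<mu>f > 0" "\<sigma>g > 0" "0 < 1 / (\<rho> * \<gamma>)"
  using sc scalars by (auto simp: strongly_convex_def)

lemma strong_mono_f: "\<mu>f * (norm (v - w))\<^sup>2 \<le> (grad f v - grad f w) \<bullet> (v - w)"
  by (rule strongly_convex_strongly_monotone[OF sc(1) GDERIV_grad[OF diff(1)] GDERIV_grad[OF diff(1)]])

lemma strong_mono_g: "\<sigma>g * (norm (v - w))\<^sup>2 \<le> (grad g v - grad g w) \<bullet> (v - w)"
  by (rule strongly_convex_strongly_monotone[OF sc(2) GDERIV_grad[OF diff(2)] GDERIV_grad[OF diff(2)]])

lemma lip_f: "norm (grad f v - grad f w) \<le> Lf * norm (v - w)"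
  using smooth(1) lipschitz_onD[of Lf UNIV "grad f" v w]
  by (simp add: lipschitz_gradient_def dist_norm)

lemma lip_g: "norm (grad g v - grad g w) \<le> Lg * norm (v - w)"
  using smooth(2) lipschitz_onD[of Lg UNIV "grad g" v w]
  by (simp add: lipschitz_gradient_def dist_norm)

lemma Lf_Lg_nonneg: "0 \<le> Lf" "0 \<le> Lg"
  using smooth by (auto simp: lipschitz_gradient_def lipschitz_on_def)

lemma G_eq: "G (ex, ey, el) = qform (P_hat A \<rho> P) ex + qform Q ey + 1 / (\<rho> * \<gamma>) * (norm el)\<^sup>2"
  by (simp add: G_sqnorm_def qform_scalar)

lemma G_nonneg: "0 \<le> G u"
  using pd scpos by (cases u) (simp add: G_eq qform_nonneg)

lemma G_young:
  assumes "\<alpha> > 0"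
  shows "G (u + v) \<le> (1 + \<alpha>) * G u + (1 + 1 / \<alpha>) * G v"
proof -
  obtain x y l x' y' l' where [simp]: "u = (x, y, l)" "v = (x', y', l')" by (metis prod_cases3)
  show ?thesis
    using qform_young[OF pd(2) assms, of x x'] qform_young[OF pd(1) assms, of y y']
      qform_young[OF pos_def_mat_scalar[OF scpos(3)] assms, of l l']
    by (simp add: G_sqnorm_def algebra_simps)
qed

lemma G_upper: obtains K where "K > 0" "\<And>u. G u \<le> K * (norm u)\<^sup>2"
proof
  define K where "K = onorm ((*v) (P_hat A \<rho> P)) + onorm ((*v) Q) + 1 / (\<rho> * \<gamma>)"
  have nn: "0 \<le> onorm ((*v) (P_hat A \<rho> P))" "0 \<le> onorm ((*v) Q)" "0 < 1 / (\<rho> * \<gamma>)"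
    using scpos by (auto intro: onorm_matrix_nonneg)
  then show "K > 0" unfolding K_def by linarith
  fix u show "G u \<le> K * (norm u)\<^sup>2"
  proof (cases u)
    case (fields x y l)
    have "G u \<le> onorm ((*v) (P_hat A \<rho> P)) * (norm x)\<^sup>2 + onorm ((*v) Q) * (norm y)\<^sup>2
        + 1 / (\<rho> * \<gamma>) * (norm l)\<^sup>2"
      unfolding fields G_eq by (intro add_mono qform_le) simp
    also have "\<dots> \<le> K * (norm x)\<^sup>2 + K * (norm y)\<^sup>2 + K * (norm l)\<^sup>2"
      using nn by (intro add_mono mult_right_mono) (auto simp: K_def)
    finally show ?thesis by (simp add: fields norm_triple_sq distrib_left)
  qed
qed

lemma G_lower: obtains k where "k > 0" "\<And>u. (norm u)\<^sup>2 \<le> k * G u"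
proof -
  obtain a where a: "a > 0" "\<And>z. a * (norm z)\<^sup>2 \<le> qform (P_hat A \<rho> P) z"
    using pos_def_mat_coercive[OF pd(2)] by blast
  obtain c where c: "c > 0" "\<And>z. c * (norm z)\<^sup>2 \<le> qform Q z"
    using pos_def_mat_coercive[OF pd(1)] by blast
  define k where "k = Min {a, c, 1 / (\<rho> * \<gamma>)}"
  have k: "k > 0" "k \<le> a" "k \<le> c" "k \<le> 1 / (\<rho> * \<gamma>)"
    using a(1) c(1) scpos(3) by (auto simp: k_def)
  have "(norm u)\<^sup>2 \<le> 1 / k * G u" for u
  proof (cases u)
    case (fields x y l)
    have "k * (norm x)\<^sup>2 + k * (norm y)\<^sup>2 + k * (norm l)\<^sup>2 \<le> G u"
      unfolding fields G_eq
      using k by (intro add_mono order_trans[OF mult_right_mono a(2)] order_trans[OF mult_right_mono c(2)]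
          mult_right_mono) auto
    then show ?thesis using k(1) by (simp add: fields norm_triple_sq field_simps)
  qed
  then show ?thesis using k(1) by (intro that[of "1 / k"]) auto
qed

text \<open>Expanding the G-norm of the old error around the new one gives the squared steps and cross
  terms; the cross terms are those that strong monotonicity of the two gradients bounds from below.
  They combine because the primal residual \<open>r = A ex + B ey\<close> equals \<open>(\<lambda> - \<lambda>') / (\<gamma> \<rho>)\<close>.\<close>

lemma fejer_inequality:
  fixes x' x :: "real^'n" and y' y :: "real^'m" and l :: "real^'p"
  defines "ex \<equiv> x' - xs" and "ey \<equiv> y' - ys" and "dx \<equiv> x - x'" and "dy \<equiv> y - y'"
  defines "r \<equiv> A *v ex + B *v ey"
  defines "el \<equiv> l - (\<gamma> * \<rho>) *\<^sub>R r - ls"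
  assumes fx: "grad f x' - grad f xs = transpose A *v (el + ((\<gamma> - 1) * \<rho>) *\<^sub>R r) + P *v dx"
    and gy: "grad g y' - grad g ys = transpose B *v (el + ((\<gamma> - 1) * \<rho>) *\<^sub>R r - \<rho> *\<^sub>R (A *v dx)) + Q *v dy"
  shows "2 * \<mu>f * (norm ex)\<^sup>2 + 2 * \<sigma>g * (norm ey)\<^sup>2 + qform (P_hat A \<rho> P) dx + qform Q dy
      + (2 - \<gamma>) * \<rho> * (norm r)\<^sup>2 + 2 * \<rho> * ((A *v dx) \<bullet> r)
    \<le> G ((x, y, l) - us) - G (ex, ey, el)"
proof -
  \<comment> \<open>The error of \<open>\<lambda> - \<rho> r\<close>, the multiplier for which \<open>x'\<close> is stationary up to the term
    \<open>P dx\<close>; it agrees with \<open>\<lambda>'\<close> for \<open>\<gamma> = 1\<close>.\<close>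
  define h where "h = el + ((\<gamma> - 1) * \<rho>) *\<^sub>R r"
  have "\<mu>f * (norm ex)\<^sup>2 + \<sigma>g * (norm ey)\<^sup>2
      \<le> (grad f x' - grad f xs) \<bullet> ex + (grad g y' - grad g ys) \<bullet> ey"
    unfolding ex_def ey_def by (intro add_mono strong_mono_f strong_mono_g)
  also have "\<dots> = h \<bullet> (A *v ex) + (P *v dx) \<bullet> ex + (h - \<rho> *\<^sub>R (A *v dx)) \<bullet> (B *v ey) + (Q *v dy) \<bullet> ey"
    unfolding fx gy h_def[symmetric] by (simp add: inner_add_left inner_transpose_left)
  also have "\<dots> = h \<bullet> r + (P *v dx) \<bullet> ex + \<rho> * ((A *v dx) \<bullet> (A *v ex)) - \<rho> * ((A *v dx) \<bullet> r) + (Q *v dy) \<bullet> ey"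
    by (simp add: r_def inner_add_right inner_diff_left algebra_simps)
  finally have "\<mu>f * (norm ex)\<^sup>2 + \<sigma>g * (norm ey)\<^sup>2
      \<le> h \<bullet> r + (P *v dx) \<bullet> ex + \<rho> * ((A *v dx) \<bullet> (A *v ex)) - \<rho> * ((A *v dx) \<bullet> r) + (Q *v dy) \<bullet> ey" .
  moreover have "(P *v dx) \<bullet> ex + \<rho> * ((A *v dx) \<bullet> (A *v ex)) = ex \<bullet> (P_hat A \<rho> P *v dx)"
    by (simp add: P_hat_mult inner_add_right inner_transpose_right inner_commute)
  moreover have "h \<bullet> r = el \<bullet> r + (\<gamma> - 1) * \<rho> * (norm r)\<^sup>2"
    by (simp add: h_def inner_add_left power2_norm_eq_inner)
  moreover have "(Q *v dy) \<bullet> ey = ey \<bullet> (Q *v dy)" by (rule inner_commute)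
  ultimately have main: "\<mu>f * (norm ex)\<^sup>2 + \<sigma>g * (norm ey)\<^sup>2 \<le> el \<bullet> r + (\<gamma> - 1) * \<rho> * (norm r)\<^sup>2
      + ex \<bullet> (P_hat A \<rho> P *v dx) - \<rho> * ((A *v dx) \<bullet> r) + ey \<bullet> (Q *v dy)"
    by linarith
  have "(x, y, l) - us = (ex + dx, ey + dy, el + (\<gamma> * \<rho>) *\<^sub>R r)"
    by (simp add: ex_def dx_def ey_def dy_def el_def)
  then have "G ((x, y, l) - us) = qform (P_hat A \<rho> P) ex + 2 * (ex \<bullet> (P_hat A \<rho> P *v dx)) + qform (P_hat A \<rho> P) dx
      + (qform Q ey + 2 * (ey \<bullet> (Q *v dy)) + qform Q dy)
      + 1 / (\<rho> * \<gamma>) * (norm (el + (\<gamma> * \<rho>) *\<^sub>R r))\<^sup>2"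
    by (simp add: G_eq qform_add[OF pd(1)] qform_add[OF pd(2)])
  also have "1 / (\<rho> * \<gamma>) * (norm (el + (\<gamma> * \<rho>) *\<^sub>R r))\<^sup>2
      = 1 / (\<rho> * \<gamma>) * (norm el)\<^sup>2 + 2 * (el \<bullet> r) + \<gamma> * \<rho> * (norm r)\<^sup>2"
  proof -
    have "(norm (el + (\<gamma> * \<rho>) *\<^sub>R r))\<^sup>2 = (norm el)\<^sup>2 + (\<rho> * \<gamma>) * (2 * (el \<bullet> r) + \<gamma> * \<rho> * (norm r)\<^sup>2)"
      by (simp add: power2_norm_eq_inner inner_add_left inner_add_right inner_commute algebra_simps)
    then show ?thesis using scalars by (simp add: distrib_left)
  qed
  finally have "G ((x, y, l) - us) - G (ex, ey, el) = 2 * (ex \<bullet> (P_hat A \<rho> P *v dx)) + qform (P_hat A \<rho> P) dx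
      + (2 * (ey \<bullet> (Q *v dy)) + qform Q dy) + 2 * (el \<bullet> r) + \<gamma> * \<rho> * (norm r)\<^sup>2"
    by (simp add: G_eq)
  then show ?thesis using main by (simp add: algebra_simps)
qed

text \<open>If \<open>P \<noteq> 0\<close>, then \<open>(2 - \<gamma>) P_hat - \<rho> A\<^sup>T A\<close> is positive definite, and completing the square
  leaves a multiple of \<open>norm dx\<close> squared. If \<open>P = 0\<close> and \<open>\<gamma> = 1\<close>, the form is only
  \<open>\<rho>\<close> times the square of \<open>norm (A dx + r)\<close>, and the residual \<open>r\<close> is paid for by the strong
  convexity terms.\<close>

lemma cross_form_lower:
  obtains \<kappa> where "\<kappa> > 0"
    "\<And>dx ex ey r. r = A *v ex + B *v ey \<Longrightarrow>
      \<kappa> * ((norm (P *v dx))\<^sup>2 + (norm (A *v dx))\<^sup>2)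
      \<le> \<mu>f * (norm ex)\<^sup>2 + \<sigma>g * (norm ey)\<^sup>2 + qform (P_hat A \<rho> P) dx
        + (2 - \<gamma>) * \<rho> * (norm r)\<^sup>2 + 2 * \<rho> * ((A *v dx) \<bullet> r)"
proof (cases "P = 0")
  case False
  define s where "s = 2 - \<gamma>"
  define W where "W = (2 - \<gamma>) *\<^sub>R P - ((\<gamma> - 1) * \<rho>) *\<^sub>R (transpose A ** A)"
  have W: "pos_def_mat W" using gamma_cond(1) False unfolding W_def by blast
  obtain k where k: "k > 0" "\<And>z. k * (norm z)\<^sup>2 \<le> qform W z"
    using pos_def_mat_coercive[OF W] by blast
  have W_eq: "qform W z = s * qform (P_hat A \<rho> P) z - \<rho> * (norm (A *v z))\<^sup>2" for z
    by (simp add: W_def s_def qform_def P_hat_mult matrix_vector_mult_diff_rdistrib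
        scaleR_matrix_vector_assoc[symmetric] matrix_vector_mul_assoc[symmetric] inner_diff_right
        inner_add_right inner_transpose_right power2_norm_eq_inner algebra_simps)
  have s: "s > 0"
  proof (rule ccontr)
    assume "\<not> s > 0"
    define z :: "real^'n" where "z = axis undefined 1"
    have "s * qform (P_hat A \<rho> P) z \<le> 0"
      using \<open>\<not> s > 0\<close> qform_nonneg[OF pd(2)] by (simp add: mult_nonpos_nonneg)
    moreover have "0 < qform W z" using W by (simp add: pos_def_mat_def qform_def z_def)
    moreover have "0 \<le> \<rho> * (norm (A *v z))\<^sup>2" using scalars by simp
    ultimately show False unfolding W_eq by linarith
  qed
  define K where "K = (onorm ((*v) P))\<^sup>2 + (onorm ((*v) A))\<^sup>2 + 1"
  have K: "K > 0" unfolding K_def by (intro add_nonneg_pos) auto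
  show ?thesis
  proof (rule that)
    show "k / (s * K) > 0" using k s K by simp
    fix dx ex ey r assume r: "r = A *v ex + B *v ey"
    have "k * (norm dx)\<^sup>2 + \<rho> * (norm (A *v dx + s *\<^sub>R r))\<^sup>2
        \<le> s * (qform (P_hat A \<rho> P) dx + s * \<rho> * (norm r)\<^sup>2 + 2 * \<rho> * ((A *v dx) \<bullet> r))"
      using k(2)[of dx] unfolding W_eq
      by (simp add: power2_norm_eq_inner inner_add_left inner_add_right inner_commute algebra_simps)
    moreover have "0 \<le> \<rho> * (norm (A *v dx + s *\<^sub>R r))\<^sup>2" using scalars by simp
    ultimately have "k / s * (norm dx)\<^sup>2
        \<le> qform (P_hat A \<rho> P) dx + s * \<rho> * (norm r)\<^sup>2 + 2 * \<rho> * ((A *v dx) \<bullet> r)"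
      using s by (simp add: field_simps)
    moreover have "k / (s * K) * ((norm (P *v dx))\<^sup>2 + (norm (A *v dx))\<^sup>2) \<le> k / s * (norm dx)\<^sup>2"
    proof -
      have "(norm (P *v dx))\<^sup>2 + (norm (A *v dx))\<^sup>2
          \<le> (onorm ((*v) P) * norm dx)\<^sup>2 + (onorm ((*v) A) * norm dx)\<^sup>2"
        by (intro add_mono power_mono matrix_bound) auto
      also have "\<dots> \<le> K * (norm dx)\<^sup>2" by (simp add: K_def power_mult_distrib algebra_simps)
      finally have "k / (s * K) * ((norm (P *v dx))\<^sup>2 + (norm (A *v dx))\<^sup>2) \<le> k / (s * K) * (K * (norm dx)\<^sup>2)"
        using k s K by (intro mult_left_mono) auto
      then show ?thesis using K by simp
    qed
    moreover have "0 \<le> \<mu>f * (norm ex)\<^sup>2" "0 \<le> \<sigma>g * (norm ey)\<^sup>2" using scpos by auto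
    ultimately show "k / (s * K) * ((norm (P *v dx))\<^sup>2 + (norm (A *v dx))\<^sup>2)
      \<le> \<mu>f * (norm ex)\<^sup>2 + \<sigma>g * (norm ey)\<^sup>2 + qform (P_hat A \<rho> P) dx
        + (2 - \<gamma>) * \<rho> * (norm r)\<^sup>2 + 2 * \<rho> * ((A *v dx) \<bullet> r)"
      unfolding s_def by linarith
  qed
next
  case True
  then have \<gamma>: "\<gamma> = 1" using gamma_cond(2) by simp
  define K where "K = 2 * (onorm ((*v) A))\<^sup>2 / \<mu>f + 2 * (onorm ((*v) B))\<^sup>2 / \<sigma>g + 1"
  have K: "K > 0" unfolding K_def using scpos by (intro add_nonneg_pos) auto
  define \<kappa> where "\<kappa> = min (\<rho> / 2) (1 / (2 * K))"
  have \<kappa>: "\<kappa> > 0" "2 * \<kappa> \<le> \<rho>" "2 * \<kappa> * K \<le> 1"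
    using K scalars by (auto simp: \<kappa>_def min_def field_simps)
  show ?thesis
  proof (rule that[OF \<kappa>(1)])
    fix dx ex ey r assume r: "r = A *v ex + B *v ey"
    have "(norm r)\<^sup>2 \<le> 2 * (norm (A *v ex))\<^sup>2 + 2 * (norm (B *v ey))\<^sup>2"
      unfolding r by (rule norm_add_sq_le)
    also have "\<dots> \<le> 2 * (onorm ((*v) A) * norm ex)\<^sup>2 + 2 * (onorm ((*v) B) * norm ey)\<^sup>2"
      by (intro add_mono mult_left_mono power_mono matrix_bound) auto
    also have "\<dots> = (2 * (onorm ((*v) A))\<^sup>2 / \<mu>f) * (\<mu>f * (norm ex)\<^sup>2)
        + (2 * (onorm ((*v) B))\<^sup>2 / \<sigma>g) * (\<sigma>g * (norm ey)\<^sup>2)"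
      using scpos by (simp add: power_mult_distrib)
    also have "\<dots> \<le> K * (\<mu>f * (norm ex)\<^sup>2) + K * (\<sigma>g * (norm ey)\<^sup>2)"
      using scpos by (intro add_mono mult_right_mono) (auto simp: K_def)
    finally have r2: "(norm r)\<^sup>2 \<le> K * (\<mu>f * (norm ex)\<^sup>2 + \<sigma>g * (norm ey)\<^sup>2)"
      by (simp add: distrib_left)
    have "(norm (A *v dx))\<^sup>2 \<le> 2 * (norm (A *v dx + r))\<^sup>2 + 2 * (norm r)\<^sup>2"
      using norm_add_sq_le[of "A *v dx + r" "- r"] by simp
    then have "\<kappa> * (norm (A *v dx))\<^sup>2 \<le> \<kappa> * (2 * (norm (A *v dx + r))\<^sup>2 + 2 * (norm r)\<^sup>2)"
      using \<kappa>(1) by (intro mult_left_mono) auto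
    also have "\<dots> = 2 * \<kappa> * (norm (A *v dx + r))\<^sup>2 + 2 * \<kappa> * (norm r)\<^sup>2" by (simp add: algebra_simps)
    also have "\<dots> \<le> \<rho> * (norm (A *v dx + r))\<^sup>2 + 2 * \<kappa> * (K * (\<mu>f * (norm ex)\<^sup>2 + \<sigma>g * (norm ey)\<^sup>2))"
      using \<kappa> r2 by (intro add_mono mult_right_mono mult_left_mono) auto
    also have "2 * \<kappa> * (K * (\<mu>f * (norm ex)\<^sup>2 + \<sigma>g * (norm ey)\<^sup>2)) \<le> 1 * (\<mu>f * (norm ex)\<^sup>2 + \<sigma>g * (norm ey)\<^sup>2)"
      using \<kappa> scpos unfolding mult.assoc[symmetric] by (intro mult_right_mono) auto
    finally have "\<kappa> * (norm (A *v dx))\<^sup>2 \<le> \<rho> * (norm (A *v dx + r))\<^sup>2 + (\<mu>f * (norm ex)\<^sup>2 + \<sigma>g * (norm ey)\<^sup>2)"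
      by simp
    moreover have "qform (P_hat A \<rho> P) dx = \<rho> * (norm (A *v dx))\<^sup>2"
      by (simp add: qform_def P_hat_mult True inner_transpose_right power2_norm_eq_inner)
    moreover have "P *v dx = 0" by (simp add: True)
    moreover have "\<rho> * (norm (A *v dx + r))\<^sup>2 = \<rho> * (norm (A *v dx))\<^sup>2 + \<rho> * (norm r)\<^sup>2 + 2 * \<rho> * ((A *v dx) \<bullet> r)"
      by (simp add: power2_norm_eq_inner inner_add_left inner_add_right inner_commute algebra_simps)
    ultimately show "\<kappa> * ((norm (P *v dx))\<^sup>2 + (norm (A *v dx))\<^sup>2)
      \<le> \<mu>f * (norm ex)\<^sup>2 + \<sigma>g * (norm ey)\<^sup>2 + qform (P_hat A \<rho> P) dx
        + (2 - \<gamma>) * \<rho> * (norm r)\<^sup>2 + 2 * \<rho> * ((A *v dx) \<bullet> r)"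
      by (simp add: \<gamma>)
  qed
qed

text \<open>The multiplier error is recovered from the two stationarity conditions because
  \<open>l \<mapsto> (A\<^sup>T l, B\<^sup>T l)\<close> is injective.\<close>

lemma multiplier_bound:
  obtains K where "K \<ge> 0"
    "\<And>ex ey dx dy r el df dg.
      r = A *v ex + B *v ey \<Longrightarrow> norm df \<le> Lf * norm ex \<Longrightarrow> norm dg \<le> Lg * norm ey \<Longrightarrow>
      df = transpose A *v (el + ((\<gamma> - 1) * \<rho>) *\<^sub>R r) + P *v dx \<Longrightarrow>
      dg = transpose B *v (el + ((\<gamma> - 1) * \<rho>) *\<^sub>R r - \<rho> *\<^sub>R (A *v dx)) + Q *v dy \<Longrightarrow>
      norm el \<le> K * (norm ex + norm ey + norm (P *v dx) + norm (A *v dx) + norm dy)"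
proof -
  obtain k where k: "k > 0"
    "\<And>l. norm l \<le> k * (norm (transpose A *v l) + norm (transpose B *v l))"
    using full_row_rank_bounded_below[OF full_row_rank] by blast
  define a where "a = onorm ((*v) A)"
  define b' where "b' = onorm ((*v) B)"
  define a' where "a' = onorm ((*v) (transpose A))"
  define bt where "bt = onorm ((*v) (transpose B))"
  define q where "q = onorm ((*v) Q)"
  have nn: "0 \<le> a" "0 \<le> b'" "0 \<le> a'" "0 \<le> bt" "0 \<le> q"
    by (auto simp: a_def b'_def a'_def bt_def q_def onorm_matrix_nonneg)
  define K1 where "K1 = k * (Lf + Lg + 1 + bt * \<rho> + q)"
  define c where "c = \<bar>(\<gamma> - 1) * \<rho>\<bar>"
  define K2 where "K2 = c * (a + b')"
  have K1: "K1 \<ge> 0" using k nn scalars Lf_Lg_nonneg by (simp add: K1_def)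
  have K2: "K2 \<ge> 0" using nn by (simp add: K2_def c_def)
  show ?thesis
  proof (rule that)
    show "K1 + K2 \<ge> 0" using K1 K2 by simp
    fix ex ey dx dy r el df dg
    assume r: "r = A *v ex + B *v ey" and "norm df \<le> Lf * norm ex" "norm dg \<le> Lg * norm ey"
      and df: "df = transpose A *v (el + ((\<gamma> - 1) * \<rho>) *\<^sub>R r) + P *v dx"
      and dg: "dg = transpose B *v (el + ((\<gamma> - 1) * \<rho>) *\<^sub>R r - \<rho> *\<^sub>R (A *v dx)) + Q *v dy"
    define S where "S = norm ex + norm ey + norm (P *v dx) + norm (A *v dx) + norm dy"
    define h where "h = el + ((\<gamma> - 1) * \<rho>) *\<^sub>R r"
    have S: "norm ex \<le> S" "norm ey \<le> S" "norm (P *v dx) \<le> S" "norm (A *v dx) \<le> S" "norm dy \<le> S" "0 \<le> S"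
      by (simp_all add: S_def)
    have "transpose A *v h = df - P *v dx" by (simp add: df h_def)
    then have "norm (transpose A *v h) \<le> norm df + norm (P *v dx)" by (simp add: norm_triangle_ineq4)
    also have "\<dots> \<le> Lf * S + S"
      using \<open>norm df \<le> _\<close> S mult_left_mono[OF S(1) Lf_Lg_nonneg(1)] by linarith
    finally have 1: "norm (transpose A *v h) \<le> Lf * S + S" .
    have "transpose B *v h = dg + \<rho> *\<^sub>R (transpose B *v (A *v dx)) - Q *v dy"
      by (simp add: dg h_def[symmetric] matrix_vector_mult_diff_distrib matrix_vector_mult_scaleR)
    then have "norm (transpose B *v h) \<le> norm dg + norm (\<rho> *\<^sub>R (transpose B *v (A *v dx))) + norm (Q *v dy)"
      using norm_triangle_ineq4 norm_triangle_ineq by (metis add_right_mono order_trans)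
    also have "\<dots> \<le> Lg * S + \<rho> * (bt * S) + q * S"
    proof (intro add_mono)
      show "norm dg \<le> Lg * S"
        using \<open>norm dg \<le> _\<close> mult_left_mono[OF S(2) Lf_Lg_nonneg(2)] by linarith
      have "norm (transpose B *v (A *v dx)) \<le> bt * S"
        using matrix_bound[of "transpose B" "A *v dx"] mult_left_mono[OF S(4) nn(4)]
        unfolding bt_def by linarith
      then show "norm (\<rho> *\<^sub>R (transpose B *v (A *v dx))) \<le> \<rho> * (bt * S)"
        using scalars by simp
      show "norm (Q *v dy) \<le> q * S"
        using matrix_bound[of Q dy] mult_left_mono[OF S(5) nn(5)] unfolding q_def by linarith
    qed
    finally have 2: "norm (transpose B *v h) \<le> Lg * S + \<rho> * (bt * S) + q * S" .
    have "norm h \<le> k * ((Lf * S + S) + (Lg * S + \<rho> * (bt * S) + q * S))"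
      using k(1) by (intro order_trans[OF k(2)] mult_left_mono add_mono 1 2) auto
    then have h: "norm h \<le> K1 * S" by (simp add: K1_def algebra_simps)
    have "norm r \<le> a * norm ex + b' * norm ey"
      unfolding r a_def b'_def by (intro order_trans[OF norm_triangle_ineq] add_mono matrix_bound)
    also have "\<dots> \<le> a * S + b' * S" by (intro add_mono mult_left_mono S nn)
    finally have "c * norm r \<le> c * (a * S + b' * S)" by (intro mult_left_mono) (simp_all add: c_def)
    moreover have "norm (((\<gamma> - 1) * \<rho>) *\<^sub>R r) = c * norm r" by (simp only: c_def norm_scaleR)
    ultimately have "norm (((\<gamma> - 1) * \<rho>) *\<^sub>R r) \<le> K2 * S" by (simp add: K2_def algebra_simps)
    moreover have "norm el \<le> norm h + norm (((\<gamma> - 1) * \<rho>) *\<^sub>R r)"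
      using norm_triangle_ineq4[of h "((\<gamma> - 1) * \<rho>) *\<^sub>R r"] by (simp add: h_def)
    ultimately show "norm el \<le> (K1 + K2) * (norm ex + norm ey + norm (P *v dx) + norm (A *v dx) + norm dy)"
      using h unfolding S_def[symmetric] by (simp add: distrib_right)
  qed
qed

text \<open>The drop in \<open>fejer_inequality\<close> dominates a multiple of the sum \<open>W\<close> of all squared quantities that
  bound the new error, half of the strong convexity terms being spent on \<open>cross_form_lower\<close>. Since
  only the stationarity conditions of the update itself are used, the estimate holds at every
  \<open>u\<close>, as it must for the inexact iterates.\<close>

theorem exact_contraction:
  obtains \<delta> where "\<delta> > 0" "\<And>u. G (upd u - us) \<le> 1 / (1 + \<delta>) * G (u - us)"
proof -
  obtain \<kappa> where \<kappa>: "\<kappa> > 0" "\<And>dx ex ey r. r = A *v ex + B *v ey \<Longrightarrow>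
      \<kappa> * ((norm (P *v dx))\<^sup>2 + (norm (A *v dx))\<^sup>2)
      \<le> \<mu>f * (norm ex)\<^sup>2 + \<sigma>g * (norm ey)\<^sup>2 + qform (P_hat A \<rho> P) dx
        + (2 - \<gamma>) * \<rho> * (norm r)\<^sup>2 + 2 * \<rho> * ((A *v dx) \<bullet> r)"
    using cross_form_lower by blast
  obtain K where K: "K \<ge> 0" "\<And>ex ey dx dy r el df dg.
      r = A *v ex + B *v ey \<Longrightarrow> norm df \<le> Lf * norm ex \<Longrightarrow> norm dg \<le> Lg * norm ey \<Longrightarrow>
      df = transpose A *v (el + ((\<gamma> - 1) * \<rho>) *\<^sub>R r) + P *v dx \<Longrightarrow>
      dg = transpose B *v (el + ((\<gamma> - 1) * \<rho>) *\<^sub>R r - \<rho> *\<^sub>R (A *v dx)) + Q *v dy \<Longrightarrow>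
      norm el \<le> K * (norm ex + norm ey + norm (P *v dx) + norm (A *v dx) + norm dy)"
    using multiplier_bound by blast
  obtain q where q: "q > 0" "\<And>z. q * (norm z)\<^sup>2 \<le> qform Q z"
    using pos_def_mat_coercive[OF pd(1)] by blast
  obtain KG where KG: "KG > 0" "\<And>u. G u \<le> KG * (norm u)\<^sup>2"
    using G_upper by blast
  define m where "m = Min {\<mu>f, \<sigma>g, \<kappa>, q}"
  have m: "m > 0" "m \<le> \<mu>f" "m \<le> \<sigma>g" "m \<le> \<kappa>" "m \<le> q"
    using \<kappa>(1) q(1) scpos by (auto simp: m_def)
  define \<delta> where "\<delta> = m / (KG * (1 + 5 * K\<^sup>2))"
  have S: "0 < 1 + 5 * K\<^sup>2" by (simp add: add_pos_nonneg)
  have \<delta>: "\<delta> > 0" "\<delta> * (KG * (1 + 5 * K\<^sup>2)) = m" using m(1) KG(1) S by (auto simp: \<delta>_def)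
  have "G (upd u - us) \<le> 1 / (1 + \<delta>) * G (u - us)" for u
  proof (cases u)
    case (fields x y l)
    define y' where "y' = prox_y x y l"
    define x' where "x' = prox_x x y' l"
    define ex where "ex = x' - xs"
    define ey where "ey = y' - ys"
    define dx where "dx = x - x'"
    define dy where "dy = y - y'"
    define r where "r = A *v ex + B *v ey"
    define el where "el = l - (\<gamma> * \<rho>) *\<^sub>R r - ls"
    define df where "df = grad f x' - grad f xs"
    define dg where "dg = grad g y' - grad g ys"
    have r: "A *v x' + B *v y' - b = r"
      using kkt_eqs(3) by (simp add: r_def ex_def ey_def matrix_vector_mult_diff_distrib algebra_simps)
    then have r': "A *v x + B *v y' - b = r + A *v dx"
      by (simp add: dx_def matrix_vector_mult_diff_distrib algebra_simps)
    have h: "el + ((\<gamma> - 1) * \<rho>) *\<^sub>R r = l - \<rho> *\<^sub>R r - ls" by (simp add: el_def algebra_simps)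
    have upd: "upd u - us = (ex, ey, el)"
      by (simp add: fields exact_update_eq dual_step_def y'_def[symmetric] x'_def[symmetric] ex_def ey_def el_def r)
    have "grad f x' = transpose A *v l - \<rho> *\<^sub>R (transpose A *v r) - P *v (x' - x)"
      using prox_x_stationary[of x y' l] unfolding x'_def[symmetric] r by (simp add: algebra_simps eq_neg_iff_add_eq_0)
    then have fx: "df = transpose A *v (el + ((\<gamma> - 1) * \<rho>) *\<^sub>R r) + P *v dx"
      unfolding h df_def kkt_eqs(1)
      by (simp add: dx_def matrix_vector_mult_diff_distrib matrix_vector_mult_scaleR algebra_simps)
    have "grad g y' = transpose B *v l - \<rho> *\<^sub>R (transpose B *v (r + A *v dx)) - Q *v (y' - y)"
      using prox_y_stationary[of x y l] unfolding y'_def[symmetric] r' by (simp add: algebra_simps eq_neg_iff_add_eq_0)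
    then have gy: "dg = transpose B *v (el + ((\<gamma> - 1) * \<rho>) *\<^sub>R r - \<rho> *\<^sub>R (A *v dx)) + Q *v dy"
      unfolding h dg_def kkt_eqs(2)
      by (simp add: dy_def matrix_vector_mult_diff_distrib matrix_vector_right_distrib matrix_vector_mult_scaleR algebra_simps)
    define W where "W = (norm ex)\<^sup>2 + (norm ey)\<^sup>2 + (norm (P *v dx))\<^sup>2 + (norm (A *v dx))\<^sup>2 + (norm dy)\<^sup>2"
    have "norm el \<le> K * (norm ex + norm ey + norm (P *v dx) + norm (A *v dx) + norm dy)"
      by (rule K(2)[OF r_def _ _ fx gy]) (simp_all add: df_def dg_def ex_def ey_def lip_f lip_g)
    then have "(norm el)\<^sup>2 \<le> (K * (norm ex + norm ey + norm (P *v dx) + norm (A *v dx) + norm dy))\<^sup>2"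
      by (rule power_mono) simp
    also have "\<dots> \<le> K\<^sup>2 * (5 * W)"
      unfolding power_mult_distrib W_def by (intro mult_left_mono sum5_square_le) simp
    finally have el: "(norm el)\<^sup>2 \<le> 5 * K\<^sup>2 * W" by simp
    have "G (ex, ey, el) \<le> KG * (norm (ex, ey, el))\<^sup>2" by (rule KG)
    also have "\<dots> \<le> KG * (W + 5 * K\<^sup>2 * W)"
      unfolding norm_triple_sq using KG(1) el by (intro mult_left_mono add_mono) (auto simp: W_def)
    also have "\<dots> = KG * (1 + 5 * K\<^sup>2) * W" by (simp add: algebra_simps)
    finally have "\<delta> * G (ex, ey, el) \<le> \<delta> * (KG * (1 + 5 * K\<^sup>2) * W)"
      using \<delta>(1) by (intro mult_left_mono) auto
    also have "\<dots> = m * W" using \<delta>(2) by (simp add: mult.assoc[symmetric])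
    also have "\<dots> \<le> \<mu>f * (norm ex)\<^sup>2 + \<sigma>g * (norm ey)\<^sup>2 + \<kappa> * ((norm (P *v dx))\<^sup>2 + (norm (A *v dx))\<^sup>2) + q * (norm dy)\<^sup>2"
      unfolding W_def distrib_left add.assoc[symmetric]
      by (intro add_mono mult_right_mono m) auto
    also have "\<dots> \<le> 2 * \<mu>f * (norm ex)\<^sup>2 + 2 * \<sigma>g * (norm ey)\<^sup>2 + qform (P_hat A \<rho> P) dx + qform Q dy
      + (2 - \<gamma>) * \<rho> * (norm r)\<^sup>2 + 2 * \<rho> * ((A *v dx) \<bullet> r)"
      using \<kappa>(2)[OF r_def, of dx] q(2)[of dy] by simp
    also have "\<dots> \<le> G ((x, y, l) - us) - G (ex, ey, el)"
      using fejer_inequality[where x' = x' and y' = y' and x = x and y = y and l = l] fx gy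
      by (simp only: ex_def ey_def dx_def dy_def r_def el_def df_def dg_def)
    finally have "(1 + \<delta>) * G (ex, ey, el) \<le> G (u - us)" by (simp add: fields algebra_simps)
    then show ?thesis using \<delta>(1) by (simp add: upd field_simps)
  qed
  with \<delta>(1) show ?thesis using that by blast
qed

end

section \<open>Sensitivity of the exact update\<close>

lemma sum3_square_le: "(a + b + c)\<^sup>2 \<le> 3 * (a\<^sup>2 + b\<^sup>2 + c\<^sup>2)" for a b c :: real
proof -
  have "0 \<le> (a - b)\<^sup>2 + (a - c)\<^sup>2 + (b - c)\<^sup>2" by simp
  then show ?thesis by (simp add: power2_eq_square algebra_simps)
qed

lemma linear_part_lipschitz:
  fixes A :: "real^'n^'p" and B :: "real^'m^'p"
  obtains K where "K > 0"
    "\<And>w l z w' l' z'. norm (linear_part A B b \<rho> P w l z - linear_part A B b \<rho> P w' l' z')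
      \<le> K * (norm (w - w') + norm (l - l') + norm (z - z'))"
proof -
  define a where "a = onorm ((*v) (transpose A))"
  define b' where "b' = onorm ((*v) B)"
  define p where "p = onorm ((*v) P)"
  have nn: "0 \<le> a" "0 \<le> b'" "0 \<le> p" by (simp_all add: a_def b'_def p_def onorm_matrix_nonneg)
  define K where "K = \<bar>\<rho>\<bar> * (a * b') + a + p + 1"
  have K: "K > 0" "\<bar>\<rho>\<bar> * (a * b') \<le> K" "a \<le> K" "p \<le> K"
    using nn by (auto simp: K_def intro!: add_nonneg_pos add_nonneg_nonneg)
  have "norm (linear_part A B b \<rho> P w l z - linear_part A B b \<rho> P w' l' z')
      \<le> K * (norm (w - w') + norm (l - l') + norm (z - z'))" for w l z w' l' z'
  proof -
    have eq: "linear_part A B b \<rho> P w l z - linear_part A B b \<rho> P w' l' z'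
      = \<rho> *\<^sub>R (transpose A *v (B *v (w - w'))) - transpose A *v (l - l') - P *v (z - z')"
      by (simp add: linear_part_def matrix_vector_mult_diff_distrib algebra_simps)
    have "norm (transpose A *v (B *v (w - w'))) \<le> a * (b' * norm (w - w'))"
      unfolding a_def b'_def
      by (rule order_trans[OF matrix_bound mult_left_mono[OF matrix_bound onorm_matrix_nonneg]])
    then have "norm (\<rho> *\<^sub>R (transpose A *v (B *v (w - w')))) \<le> \<bar>\<rho>\<bar> * (a * (b' * norm (w - w')))"
      by (simp add: mult_left_mono)
    also have "\<dots> = (\<bar>\<rho>\<bar> * (a * b')) * norm (w - w')" by simp
    also have "\<dots> \<le> K * norm (w - w')" using K by (intro mult_right_mono) auto
    finally have 1: "norm (\<rho> *\<^sub>R (transpose A *v (B *v (w - w')))) \<le> K * norm (w - w')" .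
    have 2: "norm (transpose A *v (l - l')) \<le> K * norm (l - l')"
      using matrix_bound[of "transpose A" "l - l'"] mult_right_mono[OF K(3), of "norm (l - l')"]
      by (simp add: a_def)
    have 3: "norm (P *v (z - z')) \<le> K * norm (z - z')"
      using matrix_bound[of P "z - z'"] mult_right_mono[OF K(4), of "norm (z - z')"]
      by (simp add: p_def)
    show ?thesis
      unfolding eq distrib_left
      by (intro order_trans[OF norm_triangle_ineq4] add_mono 1 2 3)
  qed
  with K(1) show ?thesis by (rule that)
qed

context admm
begin

text \<open>The inexact \<open>x\<close>-loop aims at \<open>prox_x x y' l\<close> with the inexact \<open>y'\<close>, so the error of
  \<open>y'\<close> enters both the location of this target and its distance to the exact update.\<close>

lemma prox_bounds:
  obtains K where "K > 0"
    "\<And>x y l. (norm (prox_y x y l - ys))\<^sup>2 \<le> K * (norm ((x, y, l) - us))\<^sup>2"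
    "\<And>x y l y'. (norm (prox_x x y' l - xs))\<^sup>2
      \<le> K * ((norm ((x, y, l) - us))\<^sup>2 + (norm (y' - prox_y x y l))\<^sup>2)"
    "\<And>x y l x' y'. (norm ((x', y', dual_step x' y' l) - upd (x, y, l)))\<^sup>2
      \<le> K * ((norm (x' - prox_x x y' l))\<^sup>2 + (norm (y' - prox_y x y l))\<^sup>2)"
proof -
  obtain K1 where K1: "K1 > 0"
    "\<And>w l z w' l' z'. norm (linear_part B A b \<rho> Q w l z - linear_part B A b \<rho> Q w' l' z')
      \<le> K1 * (norm (w - w') + norm (l - l') + norm (z - z'))"
    using linear_part_lipschitz by metis
  obtain K2 where K2: "K2 > 0"
    "\<And>w l z w' l' z'. norm (linear_part A B b \<rho> P w l z - linear_part A B b \<rho> P w' l' z')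
      \<le> K2 * (norm (w - w') + norm (l - l') + norm (z - z'))"
    using linear_part_lipschitz by metis
  define ky where "ky = 1 / cy * K1"
  define kx where "kx = 1 / cx * K2"
  have k: "ky > 0" "kx > 0" using K1(1) K2(1) X.c_pos Y.c_pos by (auto simp: ky_def kx_def)
  have py: "norm (prox_y x y l - prox_y x2 y2 l2) \<le> ky * (norm (x - x2) + norm (l - l2) + norm (y - y2))"
    for x y l x2 y2 l2
  proof -
    have "norm (prox_y x y l - prox_y x2 y2 l2)
        \<le> 1 / cy * norm (linear_part B A b \<rho> Q x l y - linear_part B A b \<rho> Q x2 l2 y2)"
      unfolding prox_y_def by (rule Y.resolvent_lipschitz)
    also have "\<dots> \<le> 1 / cy * (K1 * (norm (x - x2) + norm (l - l2) + norm (y - y2)))"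
      using Y.c_pos by (intro mult_left_mono K1) auto
    finally show ?thesis by (simp add: ky_def)
  qed
  have px: "norm (prox_x x y l - prox_x x2 y2 l2) \<le> kx * (norm (y - y2) + norm (l - l2) + norm (x - x2))"
    for x y l x2 y2 l2
  proof -
    have "norm (prox_x x y l - prox_x x2 y2 l2)
        \<le> 1 / cx * norm (linear_part A B b \<rho> P y l x - linear_part A B b \<rho> P y2 l2 x2)"
      unfolding prox_x_def by (rule X.resolvent_lipschitz)
    also have "\<dots> \<le> 1 / cx * (K2 * (norm (y - y2) + norm (l - l2) + norm (x - x2)))"
      using X.c_pos by (intro mult_left_mono K2) auto
    finally show ?thesis by (simp add: kx_def)
  qed
  define Ky where "Ky = 3 * ky\<^sup>2"
  have Ky: "Ky \<ge> 0" by (simp add: Ky_def)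
  have b1: "(norm (prox_y x y l - ys))\<^sup>2 \<le> Ky * (norm ((x, y, l) - us))\<^sup>2" for x y l
  proof -
    have "(norm (prox_y x y l - ys))\<^sup>2 \<le> (ky * (norm (x - xs) + norm (l - ls) + norm (y - ys)))\<^sup>2"
      using py[of x y l xs ys ls] by (intro power_mono) (simp_all add: prox_fixed)
    also have "\<dots> \<le> ky\<^sup>2 * (3 * ((norm (x - xs))\<^sup>2 + (norm (l - ls))\<^sup>2 + (norm (y - ys))\<^sup>2))"
      unfolding power_mult_distrib by (intro mult_left_mono sum3_square_le) simp
    finally show ?thesis by (simp add: Ky_def norm_triple_sq algebra_simps)
  qed
  define Kx where "Kx = 3 * kx\<^sup>2 * (3 + 2 * Ky)"
  have Kx: "Kx \<ge> 0" using Ky by (simp add: Kx_def)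
  have b2: "(norm (prox_x x y' l - xs))\<^sup>2 \<le> Kx * ((norm ((x, y, l) - us))\<^sup>2 + (norm (y' - prox_y x y l))\<^sup>2)"
    for x y l y'
  proof -
    define t where "t = prox_y x y l"
    define e where "e = (norm ((x, y, l) - us))\<^sup>2"
    have e: "(norm (x - xs))\<^sup>2 \<le> e" "(norm (l - ls))\<^sup>2 \<le> e" "0 \<le> e" by (auto simp: e_def norm_triple_sq)
    have "(norm (prox_x x y' l - xs))\<^sup>2 \<le> (kx * (norm (y' - ys) + norm (l - ls) + norm (x - xs)))\<^sup>2"
      using px[of x y' l xs ys ls] by (intro power_mono) (simp_all add: prox_fixed)
    also have "\<dots> \<le> kx\<^sup>2 * (3 * ((norm (y' - ys))\<^sup>2 + (norm (l - ls))\<^sup>2 + (norm (x - xs))\<^sup>2))"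
      unfolding power_mult_distrib by (intro mult_left_mono sum3_square_le) simp
    also have "\<dots> \<le> kx\<^sup>2 * (3 * ((3 + 2 * Ky) * (e + (norm (y' - t))\<^sup>2)))"
    proof (intro mult_left_mono)
      have "(norm (y' - ys))\<^sup>2 \<le> 2 * (norm (y' - t))\<^sup>2 + 2 * (norm (t - ys))\<^sup>2"
        using norm_add_sq_le[of "y' - t" "t - ys"] by simp
      moreover have "(norm (t - ys))\<^sup>2 \<le> Ky * e" unfolding t_def e_def by (rule b1)
      moreover have "0 \<le> Ky * (norm (y' - t))\<^sup>2" "0 \<le> (norm (y' - t))\<^sup>2" using Ky by auto
      ultimately have "(norm (y' - ys))\<^sup>2 + (norm (l - ls))\<^sup>2 + (norm (x - xs))\<^sup>2
          \<le> 2 * (norm (y' - t))\<^sup>2 + 2 * (Ky * e) + e + e + (norm (y' - t))\<^sup>2 + 2 * (Ky * (norm (y' - t))\<^sup>2) + e"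
        using e by linarith
      then show "(norm (y' - ys))\<^sup>2 + (norm (l - ls))\<^sup>2 + (norm (x - xs))\<^sup>2 \<le> (3 + 2 * Ky) * (e + (norm (y' - t))\<^sup>2)"
        by (simp add: algebra_simps)
    qed auto
    finally show ?thesis by (simp add: Kx_def e_def t_def mult_ac)
  qed
  define a where "a = onorm ((*v) A)"
  define b' where "b' = onorm ((*v) B)"
  define D where "D = 1 + 2 * (\<gamma> * \<rho>)\<^sup>2 * (a\<^sup>2 + b'\<^sup>2)"
  have D: "D \<ge> 1" by (simp add: D_def)
  define Ku where "Ku = D * (2 + 2 * kx\<^sup>2 + 1)"
  have b3: "(norm ((x', y', dual_step x' y' l) - upd (x, y, l)))\<^sup>2
      \<le> Ku * ((norm (x' - prox_x x y' l))\<^sup>2 + (norm (y' - prox_y x y l))\<^sup>2)" for x y l x' y'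
  proof -
    define t where "t = prox_y x y l"
    define t' where "t' = prox_x x y' l"
    define t'' where "t'' = prox_x x t l"
    define dx where "dx = x' - t''"
    define dy where "dy = y' - t"
    have "(x', y', dual_step x' y' l) - upd (x, y, l) = (dx, dy, - ((\<gamma> * \<rho>) *\<^sub>R (A *v dx + B *v dy)))"
      by (simp add: exact_update_eq t_def[symmetric] t''_def[symmetric] dx_def dy_def dual_step_def
          matrix_vector_mult_diff_distrib algebra_simps)
    then have eq: "(norm ((x', y', dual_step x' y' l) - upd (x, y, l)))\<^sup>2
      = (norm dx)\<^sup>2 + (norm dy)\<^sup>2 + (\<gamma> * \<rho>)\<^sup>2 * (norm (A *v dx + B *v dy))\<^sup>2"
      by (simp only: norm_triple_sq norm_minus_cancel norm_scaleR power_mult_distrib power2_abs)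
    have "(norm (A *v dx + B *v dy))\<^sup>2 \<le> 2 * (norm (A *v dx))\<^sup>2 + 2 * (norm (B *v dy))\<^sup>2"
      by (rule norm_add_sq_le)
    also have "\<dots> \<le> 2 * (a * norm dx)\<^sup>2 + 2 * (b' * norm dy)\<^sup>2"
      unfolding a_def b'_def by (intro add_mono mult_left_mono power_mono matrix_bound) auto
    also have "\<dots> \<le> 2 * (a\<^sup>2 + b'\<^sup>2) * ((norm dx)\<^sup>2 + (norm dy)\<^sup>2)"
      by (simp add: power_mult_distrib algebra_simps)
    finally have "(\<gamma> * \<rho>)\<^sup>2 * (norm (A *v dx + B *v dy))\<^sup>2
        \<le> (\<gamma> * \<rho>)\<^sup>2 * (2 * (a\<^sup>2 + b'\<^sup>2) * ((norm dx)\<^sup>2 + (norm dy)\<^sup>2))"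
      by (rule mult_left_mono) simp
    also have "\<dots> = 2 * (\<gamma> * \<rho>)\<^sup>2 * (a\<^sup>2 + b'\<^sup>2) * ((norm dx)\<^sup>2 + (norm dy)\<^sup>2)"
      by (simp only: mult_ac)
    finally have le: "(norm dx)\<^sup>2 + (norm dy)\<^sup>2 + (\<gamma> * \<rho>)\<^sup>2 * (norm (A *v dx + B *v dy))\<^sup>2
        \<le> D * ((norm dx)\<^sup>2 + (norm dy)\<^sup>2)"
      unfolding D_def distrib_right[of 1] mult_1 by linarith
    have "(norm dx)\<^sup>2 \<le> 2 * (norm (x' - t'))\<^sup>2 + 2 * (norm (t' - t''))\<^sup>2"
      using norm_add_sq_le[of "x' - t'" "t' - t''"] by (simp add: dx_def)
    moreover have "(norm (t' - t''))\<^sup>2 \<le> (kx * norm dy)\<^sup>2"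
      using px[of x y' l x t l] by (intro power_mono) (simp_all add: t'_def t''_def dy_def)
    moreover have "0 \<le> (norm dy)\<^sup>2" "0 \<le> (norm (x' - t'))\<^sup>2" "0 \<le> kx\<^sup>2 * (norm (x' - t'))\<^sup>2" by auto
    ultimately have "(norm dx)\<^sup>2 + (norm dy)\<^sup>2
        \<le> 2 * (norm (x' - t'))\<^sup>2 + 2 * (kx\<^sup>2 * (norm dy)\<^sup>2) + (norm dy)\<^sup>2
          + ((norm (x' - t'))\<^sup>2 + 2 * (kx\<^sup>2 * (norm (x' - t'))\<^sup>2) + 2 * (norm dy)\<^sup>2)"
      unfolding power_mult_distrib by linarith
    also have "\<dots> = (2 + 2 * kx\<^sup>2 + 1) * ((norm (x' - t'))\<^sup>2 + (norm dy)\<^sup>2)"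
      by (simp add: algebra_simps)
    finally have "D * ((norm dx)\<^sup>2 + (norm dy)\<^sup>2) \<le> D * ((2 + 2 * kx\<^sup>2 + 1) * ((norm (x' - t'))\<^sup>2 + (norm dy)\<^sup>2))"
      using D by (intro mult_left_mono) auto
    then show ?thesis unfolding eq using le by (simp only: Ku_def mult.assoc dy_def t_def t'_def)
  qed
  have Ku: "Ku \<ge> 0" using D by (simp add: Ku_def)
  define K where "K = Ky + Kx + Ku + 1"
  have K: "K > 0" "Ky \<le> K" "Kx \<le> K" "Ku \<le> K" using Ky Kx Ku by (auto simp: K_def)
  show ?thesis
  proof (rule that[OF K(1)])
    fix x y l x' y'
    show "(norm (prox_y x y l - ys))\<^sup>2 \<le> K * (norm ((x, y, l) - us))\<^sup>2"
      by (rule order_trans[OF b1 mult_right_mono[OF K(2)]]) simp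
    show "(norm (prox_x x y' l - xs))\<^sup>2 \<le> K * ((norm ((x, y, l) - us))\<^sup>2 + (norm (y' - prox_y x y l))\<^sup>2)"
      by (rule order_trans[OF b2 mult_right_mono[OF K(3)]]) simp
    show "(norm ((x', y', dual_step x' y' l) - upd (x, y, l)))\<^sup>2
      \<le> K * ((norm (x' - prox_x x y' l))\<^sup>2 + (norm (y' - prox_y x y l))\<^sup>2)"
      by (rule order_trans[OF b3 mult_right_mono[OF K(4)]]) simp
  qed
qed

end

section \<open>One major iteration\<close>

lemma matrix_measurable [measurable]:
  fixes K :: "real^'n^'m"
  assumes "h \<in> borel_measurable N"
  shows "(\<lambda>\<omega>. K *v h \<omega>) \<in> borel_measurable N"
  using assms
  by (rule borel_measurable_continuous_on[OF linear_continuous_on[OF matrix_vector_mul_bounded_linear]])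

lemma integrable_dominated:
  fixes h F :: "'w \<Rightarrow> real"
  assumes "h \<in> borel_measurable M" "integrable M F" "\<And>\<omega>. 0 \<le> h \<omega>" "\<And>\<omega>. h \<omega> \<le> F \<omega>"
  shows "integrable M h \<and> (\<integral>\<omega>. h \<omega> \<partial>M) \<le> (\<integral>\<omega>. F \<omega> \<partial>M)"
proof
  show "integrable M h"
    using assms order_trans[OF assms(3,4)] by (intro Bochner_Integration.integrable_bound[OF assms(2,1)]) auto
  then show "(\<integral>\<omega>. h \<omega> \<partial>M) \<le> (\<integral>\<omega>. F \<omega> \<partial>M)"
    using assms by (intro integral_mono) auto
qed

lemma linear_part_measurable [measurable]:
  fixes A :: "real^'n^'p" and B :: "real^'m^'p"
  assumes "w \<in> borel_measurable N" "l \<in> borel_measurable N" "z \<in> borel_measurable N"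
  shows "(\<lambda>\<omega>. linear_part A B b \<rho> P (w \<omega>) (l \<omega>) (z \<omega>)) \<in> borel_measurable N"
  unfolding linear_part_def
  by (intro borel_measurable_diff borel_measurable_scaleR matrix_measurable borel_measurable_const assms)

text \<open>The past of the sampling process starts with the initial point of the algorithm; \<open>kx\<close> and \<open>ky\<close>
  are minimal loop lengths.\<close>

locale si_admm =
  admm A B b P Q \<rho> \<gamma> f g xs ys ls \<mu>f \<sigma>g Lf Lg cx Lx cy Ly +
  gradient_sampling M \<Xi> \<xi> "samples \<xi>x \<xi>y" "sample_index Tx Ty" borel "\<lambda>\<omega>. (x 0 \<omega>, y 0 \<omega>, l 0 \<omega>)"
  for A :: "real^'n^'p" and B :: "real^'m^'p" and b P Q \<rho> \<gamma> f g xs ys ls \<mu>f \<sigma>g Lf Lg cx Lx cy Ly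
    and M :: "'w measure" and \<Xi> :: "(real^'d) set" and \<xi> \<xi>x \<xi>y Tx Ty
    and x :: "nat \<Rightarrow> 'w \<Rightarrow> real^'n" and y :: "nat \<Rightarrow> 'w \<Rightarrow> real^'m" and l :: "nat \<Rightarrow> 'w \<Rightarrow> real^'p" +
  fixes ft :: "real^'n \<Rightarrow> real^'d \<Rightarrow> real" and gt :: "real^'m \<Rightarrow> real^'d \<Rightarrow> real"
    and xi :: "nat \<Rightarrow> nat \<Rightarrow> 'w \<Rightarrow> real^'n" and yi :: "nat \<Rightarrow> nat \<Rightarrow> 'w \<Rightarrow> real^'m"
    and \<gamma>x \<gamma>y v1x v2x v1y v2y T \<eta> :: real and kx ky :: nat
  assumes objectives: "stochastic_objective M \<Xi> \<xi> ft f" "stochastic_objective M \<Xi> \<xi> gt g"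
    and moments: "noise_moments M \<xi> ft f v1x v2x" "noise_moments M \<xi> gt g v1y v2y"
    and run: "\<And>\<omega>. \<omega> \<in> space M \<Longrightarrow>
      si_admm_path A B b \<rho> \<gamma> \<gamma>x \<gamma>y P Q f g ft gt Tx Ty
        (\<lambda>k j. \<xi>x k j \<omega>) (\<lambda>k j. \<xi>y k j \<omega>) (\<lambda>k j. xi k j \<omega>) (\<lambda>k j. yi k j \<omega>)
        (\<lambda>k. x k \<omega>) (\<lambda>k. y k \<omega>) (\<lambda>k. l k \<omega>)"
    and steps: "2 * cx * \<gamma>x > 1" "2 * cy * \<gamma>y > 1"
    and params: "T > 0" "0 < \<eta>" "\<eta> < 1" "1 \<le> kx" "1 \<le> ky"
    and Ty_eq: "\<And>k. Ty (Suc k) = max ky (nat \<lceil>T / \<eta> ^ k\<rceil>)"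
    and Tx_eq: "\<And>k. Tx (Suc k) = max kx (nat \<lceil>T / \<eta> ^ k\<rceil>)"
    and init_moment: "integrable M (\<lambda>\<omega>. G ((x 0 \<omega>, y 0 \<omega>, l 0 \<omega>) - (xs, ys, ls)))"
begin

abbreviation "u k \<omega> \<equiv> (x k \<omega>, y k \<omega>, l k \<omega>)"

lemma loop_length_pos: "1 \<le> Tx (Suc k)" "1 \<le> Ty (Suc k)"
  using params unfolding Tx_eq Ty_eq by auto

lemma loop_length_large: "1 / real (Tx (Suc k)) \<le> \<eta> ^ k / T" "1 / real (Ty (Suc k)) \<le> \<eta> ^ k / T"
proof -
  have "T / \<eta> ^ k \<le> real (nat \<lceil>T / \<eta> ^ k\<rceil>)" by (rule real_nat_ceiling_ge)
  then have "T / \<eta> ^ k \<le> real (Tx (Suc k))" "T / \<eta> ^ k \<le> real (Ty (Suc k))"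
    unfolding Tx_eq Ty_eq by auto
  moreover have "0 < T / \<eta> ^ k" using params by simp
  ultimately show "1 / real (Tx (Suc k)) \<le> \<eta> ^ k / T" "1 / real (Ty (Suc k)) \<le> \<eta> ^ k / T"
    using le_imp_inverse_le[of "T / \<eta> ^ k"] by (auto simp: inverse_eq_divide)
qed

lemma sample_range: "i \<in> sample_index Tx Ty \<Longrightarrow> \<omega> \<in> space M \<Longrightarrow> samples \<xi>x \<xi>y i \<omega> \<in> \<Xi>"
  using measurable_space[OF X_measurable[of i]] by (auto simp: space_restrict_space)

lemma index_mem:
  "j \<in> {1..<Tx (Suc k)} \<Longrightarrow> Inl (k, j) \<in> sample_index Tx Ty"
  "j \<in> {1..<Ty (Suc k)} \<Longrightarrow> Inr (k, j) \<in> sample_index Tx Ty"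
  unfolding sample_index_def by auto

text \<open>One inner step in the form required by \<open>stochastic_gradient_loop\<close>, and likewise for the
  \<open>x\<close>-loop below.\<close>

lemma y_step:
  assumes w: "\<omega> \<in> space M" and j: "j \<in> {1..<Ty (Suc k)}"
  shows "yi k (Suc j) \<omega> = yi k j \<omega> - (\<gamma>y / real j) *\<^sub>R
    (grad (\<lambda>z. gt z (samples \<xi>x \<xi>y (Inr (k, j)) \<omega>)) (yi k j \<omega>) + P_hat B \<rho> Q *v yi k j \<omega>
      + linear_part B A b \<rho> Q (x k \<omega>) (l k \<omega>) (y k \<omega>))"
proof -
  have "samples \<xi>x \<xi>y (Inr (k, j)) \<omega> \<in> \<Xi>" by (rule sample_range[OF index_mem(2)[OF j] w])
  then have "(\<lambda>z. gt z (\<xi>y k j \<omega>)) differentiable (at (yi k j \<omega>))"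
    using objectives(2) by (simp add: stochastic_objective_def samples_def)
  from grad_eqI[OF GDERIV_aug_lag_y[OF GDERIV_grad[OF this], of A B b \<rho> f "x k \<omega>" "l k \<omega>"]]
  have "grad (\<lambda>v. aug_lag A B b \<rho> f (\<lambda>w. gt w (\<xi>y k j \<omega>)) (x k \<omega>) v (l k \<omega>)) (yi k j \<omega>)
       + Q *v (yi k j \<omega> - y k \<omega>)
    = grad (\<lambda>z. gt z (\<xi>y k j \<omega>)) (yi k j \<omega>) + P_hat B \<rho> Q *v yi k j \<omega>
      + linear_part B A b \<rho> Q (x k \<omega>) (l k \<omega>) (y k \<omega>)"
    unfolding linear_part_eq[symmetric] by (simp add: add.commute[of "A *v _"])
  then show ?thesis
    using run[OF w] j unfolding si_admm_path_def samples_def by simp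
qed

lemma x_step:
  assumes w: "\<omega> \<in> space M" and j: "j \<in> {1..<Tx (Suc k)}"
  shows "xi k (Suc j) \<omega> = xi k j \<omega> - (\<gamma>x / real j) *\<^sub>R
    (grad (\<lambda>z. ft z (samples \<xi>x \<xi>y (Inl (k, j)) \<omega>)) (xi k j \<omega>) + P_hat A \<rho> P *v xi k j \<omega>
      + linear_part A B b \<rho> P (y (Suc k) \<omega>) (l k \<omega>) (x k \<omega>))"
proof -
  have "samples \<xi>x \<xi>y (Inl (k, j)) \<omega> \<in> \<Xi>" by (rule sample_range[OF index_mem(1)[OF j] w])
  then have "(\<lambda>z. ft z (\<xi>x k j \<omega>)) differentiable (at (xi k j \<omega>))"
    using objectives(1) by (simp add: stochastic_objective_def samples_def)
  from grad_eqI[OF GDERIV_aug_lag_x[OF GDERIV_grad[OF this], of A B b \<rho> g "y (Suc k) \<omega>" "l k \<omega>"]]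
  have "grad (\<lambda>v. aug_lag A B b \<rho> (\<lambda>w. ft w (\<xi>x k j \<omega>)) g v (y (Suc k) \<omega>) (l k \<omega>)) (xi k j \<omega>)
       + P *v (xi k j \<omega> - x k \<omega>)
    = grad (\<lambda>z. ft z (\<xi>x k j \<omega>)) (xi k j \<omega>) + P_hat A \<rho> P *v xi k j \<omega>
      + linear_part A B b \<rho> P (y (Suc k) \<omega>) (l k \<omega>) (x k \<omega>)"
    unfolding linear_part_eq[symmetric] by simp
  then show ?thesis
    using run[OF w] j unfolding si_admm_path_def samples_def by simp
qed

lemma outer_eqs:
  assumes "\<omega> \<in> space M"
  shows "yi k 1 \<omega> = y k \<omega>" "y (Suc k) \<omega> = yi k (Ty (Suc k)) \<omega>"
    "xi k 1 \<omega> = x k \<omega>" "x (Suc k) \<omega> = xi k (Tx (Suc k)) \<omega>"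
    "l (Suc k) \<omega> = dual_step (x (Suc k) \<omega>) (y (Suc k) \<omega>) (l k \<omega>)"
  using run[OF assms] unfolding si_admm_path_def dual_step_def by auto

text \<open>The samples drawn in the major iterations before \<open>k\<close>.\<close>

definition drawn :: "nat \<Rightarrow> (nat \<times> nat + nat \<times> nat) set" where
  "drawn k = {i \<in> sample_index Tx Ty. case_sum fst fst i < k}"

lemma drawn_subset: "drawn k \<subseteq> sample_index Tx Ty"
  by (auto simp: drawn_def)

lemma drawn_Suc:
  "drawn (Suc k) = drawn k \<union> (\<lambda>j. Inr (k, j)) ` {1..<Ty (Suc k)} \<union> (\<lambda>j. Inl (k, j)) ` {1..<Tx (Suc k)}"
  unfolding drawn_def sample_index_def by (auto simp: less_Suc_eq)

text \<open>The induction hypothesis on major iterates: they are determined by the initial value and the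
  samples drawn so far, which makes the next samples fresh, and they have finite mean square error.\<close>

definition known :: "nat \<Rightarrow> bool" where
  "known k \<longleftrightarrow> x k \<in> borel_measurable (past (drawn k)) \<and> y k \<in> borel_measurable (past (drawn k)) \<and>
     l k \<in> borel_measurable (past (drawn k)) \<and> integrable M (\<lambda>\<omega>. (norm (u k \<omega> - us))\<^sup>2)"

lemma err_eq: "(norm (u k \<omega> - us))\<^sup>2 = (norm (x k \<omega> - xs))\<^sup>2 + (norm (y k \<omega> - ys))\<^sup>2 + (norm (l k \<omega> - ls))\<^sup>2"
  by (simp add: norm_triple_sq)

lemma prox_y_measurable:
  "x k \<in> borel_measurable N \<Longrightarrow> y k \<in> borel_measurable N \<Longrightarrow> l k \<in> borel_measurable N \<Longrightarrow>
    (\<lambda>\<omega>. prox_y (x k \<omega>) (y k \<omega>) (l k \<omega>)) \<in> borel_measurable N"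
  unfolding prox_y_def
  by (intro measurable_compose[OF _ borel_measurable_continuous_onI[OF Y.resolvent_continuous]]
      linear_part_measurable)

lemma prox_x_measurable:
  "x k \<in> borel_measurable N \<Longrightarrow> w \<in> borel_measurable N \<Longrightarrow> l k \<in> borel_measurable N \<Longrightarrow>
    (\<lambda>\<omega>. prox_x (x k \<omega>) (w \<omega>) (l k \<omega>)) \<in> borel_measurable N"
  unfolding prox_x_def
  by (intro measurable_compose[OF _ borel_measurable_continuous_onI[OF X.resolvent_continuous]]
      linear_part_measurable)

text \<open>Each loop leaves an error of order one over its length relative to its own target, and the
  target of the \<open>x\<close>-loop differs from the exact update only through the error of the
  \<open>y\<close>-loop.\<close>

lemma major_iteration_error:
  obtains C where "C > 0"
    "\<And>k. known k \<Longrightarrow> known (Suc k) \<and> integrable M (\<lambda>\<omega>. (norm (u (Suc k) \<omega> - upd (u k \<omega>)))\<^sup>2) \<and>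
      (\<integral>\<omega>. (norm (u (Suc k) \<omega> - upd (u k \<omega>)))\<^sup>2 \<partial>M)
        \<le> C * \<eta> ^ k * ((\<integral>\<omega>. (norm (u k \<omega> - us))\<^sup>2 \<partial>M) + 1)"
proof -
  obtain K where K: "K > 0"
    "\<And>x y l. (norm (prox_y x y l - ys))\<^sup>2 \<le> K * (norm ((x, y, l) - us))\<^sup>2"
    "\<And>x y l y'. (norm (prox_x x y' l - xs))\<^sup>2
      \<le> K * ((norm ((x, y, l) - us))\<^sup>2 + (norm (y' - prox_y x y l))\<^sup>2)"
    "\<And>x y l x' y'. (norm ((x', y', dual_step x' y' l) - upd (x, y, l)))\<^sup>2
      \<le> K * ((norm (x' - prox_x x y' l))\<^sup>2 + (norm (y' - prox_y x y l))\<^sup>2)"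
    using prox_bounds by blast
  obtain \<delta> where \<delta>: "\<delta> > 0" "\<And>u. G (upd u - us) \<le> 1 / (1 + \<delta>) * G (u - us)"
    using exact_contraction by blast
  obtain K1 where K1: "K1 > 0" "\<And>u. G u \<le> K1 * (norm u)\<^sup>2" using G_upper by blast
  obtain K2 where K2: "K2 > 0" "\<And>u. (norm u)\<^sup>2 \<le> K2 * G u" using G_lower by blast
  have upd_bound: "(norm (upd u - us))\<^sup>2 \<le> K2 * K1 * (norm (u - us))\<^sup>2" for u
  proof -
    have "1 / (1 + \<delta>) * G (u - us) \<le> 1 * G (u - us)"
      using \<delta>(1) by (intro mult_right_mono G_nonneg) auto
    then have "G (upd u - us) \<le> K1 * (norm (u - us))\<^sup>2"
      using \<delta>(2)[of u] K1(2)[of "u - us"] by linarith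
    then have "K2 * G (upd u - us) \<le> K2 * (K1 * (norm (u - us))\<^sup>2)"
      using K2(1) by (intro mult_left_mono) auto
    then show ?thesis using K2(2)[of "upd u - us"] by (simp add: mult.assoc)
  qed
  have mult_meas: "(*v) K \<in> borel_measurable borel" for K :: "real^'i^'i"
    by (rule borel_measurable_continuous_onI[OF linear_continuous_on[OF matrix_vector_mul_bounded_linear]])
  note y_loop = stochastic_gradient_loop[OF objectives(2) moments(2) Y.strongly_monotone_map_axioms
      mult_meas steps(2)]
  note x_loop = stochastic_gradient_loop[OF objectives(1) moments(1) X.strongly_monotone_map_axioms
      mult_meas steps(1)]
  show ?thesis
  proof (rule y_loop, goal_cases)
    case Y: (1 Ky)
    show ?case
    proof (rule x_loop, goal_cases)
      case X: (1 Kx)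
      \<comment> \<open>The loop constants times what \<open>K\<close> makes of the distance of the starting point to the target
        and of the size of the target; \<open>4 * K * c1\<close> is the influence of the error in \<open>y\<close> on the
        target of the \<open>x\<close>-loop.\<close>
      define c1 where "c1 = Ky * (2 + 4 * K + 2 * (norm ys)\<^sup>2 + 1) / T"
      define c2 where "c2 = Kx * (2 + 4 * K + 2 * (norm xs)\<^sup>2 + 1 + 4 * K * c1) / T"
      have c1: "c1 > 0" using Y(1) K(1) params
        unfolding c1_def by (intro divide_pos_pos mult_pos_pos add_nonneg_pos) auto
      then have c2: "c2 > 0" using X(1) K(1) params
        unfolding c2_def by (intro divide_pos_pos mult_pos_pos add_pos_nonneg) auto
      have main: "known (Suc k) \<and> integrable M (\<lambda>\<omega>. (norm (u (Suc k) \<omega> - upd (u k \<omega>)))\<^sup>2) \<and>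
          (\<integral>\<omega>. (norm (u (Suc k) \<omega> - upd (u k \<omega>)))\<^sup>2 \<partial>M)
          \<le> K * (c1 + c2) * \<eta> ^ k * ((\<integral>\<omega>. (norm (u k \<omega> - us))\<^sup>2 \<partial>M) + 1)"
        if known: "known k" for k
      proof -
        let ?J1 = "drawn k \<union> (\<lambda>j. Inr (k, j)) ` {1..<Ty (Suc k)}"
        have J1: "?J1 \<subseteq> sample_index Tx Ty" "drawn k \<subseteq> ?J1" "?J1 \<subseteq> drawn (Suc k)"
          using drawn_subset[of "Suc k"] by (auto simp: drawn_Suc)
        define e where "e \<omega> = (norm (u k \<omega> - us))\<^sup>2" for \<omega>
        define t where "t \<omega> = prox_y (x k \<omega>) (y k \<omega>) (l k \<omega>)" for \<omega>
        define t' where "t' \<omega> = prox_x (x k \<omega>) (y (Suc k) \<omega>) (l k \<omega>)" for \<omega>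
        define ey where "ey \<omega> = (norm (y (Suc k) \<omega> - t \<omega>))\<^sup>2" for \<omega>
        define ex where "ex \<omega> = (norm (x (Suc k) \<omega> - t' \<omega>))\<^sup>2" for \<omega>
        have m: "x k \<in> borel_measurable (past (drawn k))" "y k \<in> borel_measurable (past (drawn k))"
          "l k \<in> borel_measurable (past (drawn k))" and e_int: "integrable M e"
          using known unfolding known_def e_def[abs_def] by blast+
        note m1 = m[THEN past_mono[OF J1(2,1)]]
        note mM = m[THEN past_measurable[OF drawn_subset]]
        have t_past: "t \<in> borel_measurable (past (drawn k))"
          unfolding t_def by (rule prox_y_measurable[OF m])
        note tM = past_measurable[OF drawn_subset t_past]
        have t_le: "(norm (t \<omega> - ys))\<^sup>2 \<le> K * e \<omega>" for \<omega>
          unfolding t_def e_def by (rule K(2))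
        have t_int: "integrable M (\<lambda>\<omega>. (norm (t \<omega>))\<^sup>2) \<and>
            (\<integral>\<omega>. (norm (t \<omega>))\<^sup>2 \<partial>M) \<le> (\<integral>\<omega>. 2 * K * e \<omega> + 2 * (norm ys)\<^sup>2 \<partial>M)"
        proof (rule integrable_dominated)
          fix \<omega> show "(norm (t \<omega>))\<^sup>2 \<le> 2 * K * e \<omega> + 2 * (norm ys)\<^sup>2"
            using norm_add_sq_le[of "t \<omega> - ys" ys] t_le[of \<omega>] by simp
        qed (use tM e_int in auto)
        have y1_int: "integrable M (\<lambda>\<omega>. (norm (y k \<omega> - t \<omega>))\<^sup>2) \<and>
            (\<integral>\<omega>. (norm (y k \<omega> - t \<omega>))\<^sup>2 \<partial>M) \<le> (\<integral>\<omega>. (2 + 2 * K) * e \<omega> \<partial>M)"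
        proof (rule integrable_dominated)
          fix \<omega>
          have "(norm (y k \<omega> - ys))\<^sup>2 \<le> e \<omega>" unfolding e_def err_eq by simp
          then show "(norm (y k \<omega> - t \<omega>))\<^sup>2 \<le> (2 + 2 * K) * e \<omega>"
            using norm_add_sq_le[of "y k \<omega> - ys" "ys - t \<omega>"] t_le[of \<omega>]
            by (simp add: norm_minus_commute distrib_right)
        qed (use tM mM e_int in auto)
        define E where "E = (\<integral>\<omega>. e \<omega> \<partial>M)"
        have E: "0 \<le> E" unfolding E_def e_def by simp
        have "yi k (Ty (Suc k)) \<in> borel_measurable (past ?J1) \<and>
          integrable M (\<lambda>\<omega>. (norm (yi k (Ty (Suc k)) \<omega> - t \<omega>))\<^sup>2) \<and>
          (\<integral>\<omega>. (norm (yi k (Ty (Suc k)) \<omega> - t \<omega>))\<^sup>2 \<partial>M)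
            \<le> Ky / real (Ty (Suc k)) * ((\<integral>\<omega>. (norm (yi k 1 \<omega> - t \<omega>))\<^sup>2 \<partial>M) + (\<integral>\<omega>. (norm (t \<omega>))\<^sup>2 \<partial>M) + 1)"
        proof (rule Y(2))
          show "(\<lambda>j. Inr (k, j)) ` {1..<Ty (Suc k)} \<subseteq> sample_index Tx Ty - drawn k"
            using index_mem(2)[of _ k] by (auto simp: drawn_def)
          show "(\<lambda>\<omega>. linear_part B A b \<rho> Q (x k \<omega>) (l k \<omega>) (y k \<omega>)) \<in> borel_measurable (past (drawn k))"
            by (rule linear_part_measurable[OF m(1,3,2)])
          show "t = (\<lambda>\<omega>. Y.resolvent (linear_part B A b \<rho> Q (x k \<omega>) (l k \<omega>) (y k \<omega>)))"
            by (simp add: t_def prox_y_def fun_eq_iff)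
          show "yi k 1 \<in> borel_measurable (past (drawn k))"
            using m(2) outer_eqs(1) by (subst measurable_cong[of _ _ "y k"]) auto
          show "integrable M (\<lambda>\<omega>. (norm (yi k 1 \<omega> - t \<omega>))\<^sup>2)"
            using y1_int[THEN conjunct1] outer_eqs(1) by (subst Bochner_Integration.integrable_cong) auto
        qed (use drawn_subset loop_length_pos t_int y_step in \<open>auto intro: inj_onI\<close>)
        moreover have "(\<integral>\<omega>. (norm (yi k 1 \<omega> - t \<omega>))\<^sup>2 \<partial>M) = (\<integral>\<omega>. (norm (y k \<omega> - t \<omega>))\<^sup>2 \<partial>M)"
          using outer_eqs(1) by (intro Bochner_Integration.integral_cong) auto
        moreover have "(\<integral>\<omega>. (norm (yi k (Ty (Suc k)) \<omega> - t \<omega>))\<^sup>2 \<partial>M) = (\<integral>\<omega>. ey \<omega> \<partial>M)"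
          using outer_eqs(2) by (intro Bochner_Integration.integral_cong) (auto simp: ey_def)
        moreover have "integrable M (\<lambda>\<omega>. (norm (yi k (Ty (Suc k)) \<omega> - t \<omega>))\<^sup>2) = integrable M ey"
          using outer_eqs(2) by (intro Bochner_Integration.integrable_cong) (auto simp: ey_def)
        moreover have "yi k (Ty (Suc k)) \<in> borel_measurable (past ?J1) \<longleftrightarrow> y (Suc k) \<in> borel_measurable (past ?J1)"
          using outer_eqs(2) by (intro measurable_cong) auto
        ultimately have y': "y (Suc k) \<in> borel_measurable (past ?J1)" "integrable M ey"
          "(\<integral>\<omega>. ey \<omega> \<partial>M) \<le> Ky / real (Ty (Suc k)) *
            ((\<integral>\<omega>. (norm (y k \<omega> - t \<omega>))\<^sup>2 \<partial>M) + (\<integral>\<omega>. (norm (t \<omega>))\<^sup>2 \<partial>M) + 1)"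
          by auto
        define Ey where "Ey = (\<integral>\<omega>. ey \<omega> \<partial>M)"
        have Ey0: "0 \<le> Ey" unfolding Ey_def ey_def by simp
        have "Ey \<le> Ky / real (Ty (Suc k)) * ((2 + 2 * K) * E + (2 * K * E + 2 * (norm ys)\<^sup>2) + 1)"
          unfolding Ey_def using Y(1) y1_int[THEN conjunct2] t_int[THEN conjunct2] e_int
          by (intro order_trans[OF y'(3)] mult_left_mono add_mono) (auto simp: E_def prob_space)
        also have "\<dots> = Ky * (1 / real (Ty (Suc k))) * ((2 + 4 * K) * E + 2 * (norm ys)\<^sup>2 + 1)"
          by (simp add: algebra_simps)
        also have "\<dots> \<le> Ky * (\<eta> ^ k / T) * ((2 + 4 * K + 2 * (norm ys)\<^sup>2 + 1) * (E + 1))"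
        proof (intro mult_mono loop_length_large)
          have "0 \<le> 2 * (norm ys)\<^sup>2 * E" using E by simp
          then show "(2 + 4 * K) * E + 2 * (norm ys)\<^sup>2 + 1 \<le> (2 + 4 * K + 2 * (norm ys)\<^sup>2 + 1) * (E + 1)"
            using E K(1) by (simp add: algebra_simps)
        qed (use Y(1) K(1) E params in auto)
        also have "\<dots> = c1 * \<eta> ^ k * (E + 1)" by (simp add: c1_def)
        finally have Ey: "Ey \<le> c1 * \<eta> ^ k * (E + 1)" .
        also have "\<dots> \<le> c1 * 1 * (E + 1)"
          using c1 E params by (intro mult_right_mono mult_left_mono power_le_one) auto
        finally have Ey': "Ey \<le> c1 * (E + 1)" by simp

        have yM: "y (Suc k) \<in> borel_measurable M" by (rule past_measurable[OF J1(1) y'(1)])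
        have t'_past: "t' \<in> borel_measurable (past ?J1)"
          unfolding t'_def by (rule prox_x_measurable[OF m1(1) y'(1) m1(3)])
        note t'M = past_measurable[OF J1(1) t'_past]
        have t'_le: "(norm (t' \<omega> - xs))\<^sup>2 \<le> K * (e \<omega> + ey \<omega>)" for \<omega>
          unfolding t'_def e_def ey_def t_def by (rule K(3))
        have t'_int: "integrable M (\<lambda>\<omega>. (norm (t' \<omega>))\<^sup>2) \<and>
            (\<integral>\<omega>. (norm (t' \<omega>))\<^sup>2 \<partial>M) \<le> (\<integral>\<omega>. 2 * K * e \<omega> + 2 * K * ey \<omega> + 2 * (norm xs)\<^sup>2 \<partial>M)"
        proof (rule integrable_dominated)
          fix \<omega> show "(norm (t' \<omega>))\<^sup>2 \<le> 2 * K * e \<omega> + 2 * K * ey \<omega> + 2 * (norm xs)\<^sup>2"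
            using norm_add_sq_le[of "t' \<omega> - xs" xs] t'_le[of \<omega>] by (simp add: distrib_left)
        qed (use t'M e_int y'(2) in auto)
        have x1_int: "integrable M (\<lambda>\<omega>. (norm (x k \<omega> - t' \<omega>))\<^sup>2) \<and>
            (\<integral>\<omega>. (norm (x k \<omega> - t' \<omega>))\<^sup>2 \<partial>M) \<le> (\<integral>\<omega>. (2 + 2 * K) * e \<omega> + 2 * K * ey \<omega> \<partial>M)"
        proof (rule integrable_dominated)
          fix \<omega>
          have "(norm (x k \<omega> - xs))\<^sup>2 \<le> e \<omega>" unfolding e_def err_eq by simp
          then show "(norm (x k \<omega> - t' \<omega>))\<^sup>2 \<le> (2 + 2 * K) * e \<omega> + 2 * K * ey \<omega>"
            using norm_add_sq_le[of "x k \<omega> - xs" "xs - t' \<omega>"] t'_le[of \<omega>]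
            by (simp add: norm_minus_commute distrib_right distrib_left)
        qed (use t'M mM e_int y'(2) in auto)
        have J2: "?J1 \<union> (\<lambda>j. Inl (k, j)) ` {1..<Tx (Suc k)} = drawn (Suc k)"
          by (simp add: drawn_Suc)
        have "xi k (Tx (Suc k)) \<in> borel_measurable (past (?J1 \<union> (\<lambda>j. Inl (k, j)) ` {1..<Tx (Suc k)})) \<and>
          integrable M (\<lambda>\<omega>. (norm (xi k (Tx (Suc k)) \<omega> - t' \<omega>))\<^sup>2) \<and>
          (\<integral>\<omega>. (norm (xi k (Tx (Suc k)) \<omega> - t' \<omega>))\<^sup>2 \<partial>M)
            \<le> Kx / real (Tx (Suc k)) * ((\<integral>\<omega>. (norm (xi k 1 \<omega> - t' \<omega>))\<^sup>2 \<partial>M) + (\<integral>\<omega>. (norm (t' \<omega>))\<^sup>2 \<partial>M) + 1)"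
        proof (rule X(2))
          show "(\<lambda>j. Inl (k, j)) ` {1..<Tx (Suc k)} \<subseteq> sample_index Tx Ty - ?J1"
            using index_mem(1)[of _ k] by (auto simp: drawn_def)
          show "(\<lambda>\<omega>. linear_part A B b \<rho> P (y (Suc k) \<omega>) (l k \<omega>) (x k \<omega>)) \<in> borel_measurable (past ?J1)"
            by (rule linear_part_measurable[OF y'(1) m1(3,1)])
          show "t' = (\<lambda>\<omega>. X.resolvent (linear_part A B b \<rho> P (y (Suc k) \<omega>) (l k \<omega>) (x k \<omega>)))"
            by (simp add: t'_def prox_x_def fun_eq_iff)
          show "xi k 1 \<in> borel_measurable (past ?J1)"
            using m1(1) outer_eqs(3) by (subst measurable_cong[of _ _ "x k"]) auto
          show "integrable M (\<lambda>\<omega>. (norm (xi k 1 \<omega> - t' \<omega>))\<^sup>2)"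
            using x1_int[THEN conjunct1] outer_eqs(3) by (subst Bochner_Integration.integrable_cong) auto
        qed (use J1(1) loop_length_pos t'_int x_step in \<open>auto intro: inj_onI\<close>)
        moreover have "(\<integral>\<omega>. (norm (xi k 1 \<omega> - t' \<omega>))\<^sup>2 \<partial>M) = (\<integral>\<omega>. (norm (x k \<omega> - t' \<omega>))\<^sup>2 \<partial>M)"
          using outer_eqs(3) by (intro Bochner_Integration.integral_cong) auto
        moreover have "(\<integral>\<omega>. (norm (xi k (Tx (Suc k)) \<omega> - t' \<omega>))\<^sup>2 \<partial>M) = (\<integral>\<omega>. ex \<omega> \<partial>M)"
          using outer_eqs(4) by (intro Bochner_Integration.integral_cong) (auto simp: ex_def)
        moreover have "integrable M (\<lambda>\<omega>. (norm (xi k (Tx (Suc k)) \<omega> - t' \<omega>))\<^sup>2) = integrable M ex"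
          using outer_eqs(4) by (intro Bochner_Integration.integrable_cong) (auto simp: ex_def)
        moreover have "xi k (Tx (Suc k)) \<in> borel_measurable (past (drawn (Suc k)))
            \<longleftrightarrow> x (Suc k) \<in> borel_measurable (past (drawn (Suc k)))"
          using outer_eqs(4) by (intro measurable_cong) auto
        ultimately have x': "x (Suc k) \<in> borel_measurable (past (drawn (Suc k)))" "integrable M ex"
          "(\<integral>\<omega>. ex \<omega> \<partial>M) \<le> Kx / real (Tx (Suc k)) *
            ((\<integral>\<omega>. (norm (x k \<omega> - t' \<omega>))\<^sup>2 \<partial>M) + (\<integral>\<omega>. (norm (t' \<omega>))\<^sup>2 \<partial>M) + 1)"
          unfolding J2 by auto
        define Ex where "Ex = (\<integral>\<omega>. ex \<omega> \<partial>M)"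
        have "Ex \<le> Kx / real (Tx (Suc k)) * (((2 + 2 * K) * E + 2 * K * Ey) + (2 * K * E + 2 * K * Ey + 2 * (norm xs)\<^sup>2) + 1)"
          unfolding Ex_def using X(1) x1_int[THEN conjunct2] t'_int[THEN conjunct2] e_int y'(2)
          by (intro order_trans[OF x'(3)] mult_left_mono add_mono) (auto simp: E_def Ey_def prob_space)
        also have "\<dots> = Kx * (1 / real (Tx (Suc k))) * ((2 + 4 * K) * E + 2 * (norm xs)\<^sup>2 + 1 + 4 * K * Ey)"
          by (simp add: algebra_simps)
        also have "\<dots> \<le> Kx * (\<eta> ^ k / T) * ((2 + 4 * K + 2 * (norm xs)\<^sup>2 + 1 + 4 * K * c1) * (E + 1))"
        proof (intro mult_mono loop_length_large)
          have "0 \<le> 2 * (norm xs)\<^sup>2 * E" using E by simp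
          moreover have "4 * K * Ey \<le> 4 * K * (c1 * (E + 1))" using Ey' K(1) by (intro mult_left_mono) auto
          moreover have "(2 + 4 * K + 2 * (norm xs)\<^sup>2 + 1 + 4 * K * c1) * (E + 1)
              = (2 + 4 * K) * E + 2 * (norm xs)\<^sup>2 + 1 + 4 * K * (c1 * (E + 1))
                + (2 + 4 * K + 2 * (norm xs)\<^sup>2 * E + E)"
            by (simp add: algebra_simps)
          ultimately show "(2 + 4 * K) * E + 2 * (norm xs)\<^sup>2 + 1 + 4 * K * Ey
              \<le> (2 + 4 * K + 2 * (norm xs)\<^sup>2 + 1 + 4 * K * c1) * (E + 1)"
            using E K(1) by linarith
        qed (use X(1) K(1) E Ey0 params in auto)
        also have "\<dots> = c2 * \<eta> ^ k * (E + 1)" by (simp add: c2_def)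
        finally have Ex: "Ex \<le> c2 * \<eta> ^ k * (E + 1)" .

        have y2: "y (Suc k) \<in> borel_measurable (past (drawn (Suc k)))"
          by (rule past_mono[OF J1(3) drawn_subset y'(1)])
        have "dual_step (x (Suc k) \<omega>) (y (Suc k) \<omega>) (l k \<omega>) = l k \<omega>
            - (\<gamma> * \<rho>) *\<^sub>R (A *v x (Suc k) \<omega> + B *v y (Suc k) \<omega> - b)" for \<omega>
          by (simp add: dual_step_def)
        then have "(\<lambda>\<omega>. dual_step (x (Suc k) \<omega>) (y (Suc k) \<omega>) (l k \<omega>)) \<in> borel_measurable (past (drawn (Suc k)))"
          using past_mono[OF J1(3) drawn_subset m1(3)] x'(1) y2
          by (simp only:, intro borel_measurable_diff borel_measurable_scaleR borel_measurable_add
              matrix_measurable borel_measurable_const)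
        then have l2: "l (Suc k) \<in> borel_measurable (past (drawn (Suc k)))"
          using outer_eqs(5) by (subst measurable_cong) auto
        note M2 = x'(1)[THEN past_measurable[OF drawn_subset]] yM l2[THEN past_measurable[OF drawn_subset]]
        define d where "d \<omega> = (norm (u (Suc k) \<omega> - upd (u k \<omega>)))\<^sup>2" for \<omega>
        define d' where "d' \<omega> = (norm ((x (Suc k) \<omega>, y (Suc k) \<omega>, dual_step (x (Suc k) \<omega>) (y (Suc k) \<omega>) (l k \<omega>))
            - upd (u k \<omega>)))\<^sup>2" for \<omega>
        have dd': "d \<omega> = d' \<omega>" if "\<omega> \<in> space M" for \<omega>
          using outer_eqs(5)[OF that] by (simp add: d_def d'_def)
        have updM: "(\<lambda>\<omega>. upd (u k \<omega>)) \<in> borel_measurable M"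
        proof -
          have "(\<lambda>\<omega>. prox_x (x k \<omega>) (t \<omega>) (l k \<omega>)) \<in> borel_measurable M"
            by (rule prox_x_measurable[OF mM(1) tM mM(3)])
          moreover from this have "(\<lambda>\<omega>. dual_step (prox_x (x k \<omega>) (t \<omega>) (l k \<omega>)) (t \<omega>) (l k \<omega>)) \<in> borel_measurable M"
            unfolding dual_step_def using tM mM(3)
            by (intro borel_measurable_diff borel_measurable_scaleR borel_measurable_add
              matrix_measurable borel_measurable_const)
          ultimately show ?thesis
            unfolding exact_update_eq t_def[symmetric] using tM by (intro borel_measurable_Pair)
        qed
        have uM: "u (Suc k) \<in> borel_measurable M" by (intro borel_measurable_Pair M2)
        have dM: "d \<in> borel_measurable M" unfolding d_def using updM uM by measurable
        then have d'M: "d' \<in> borel_measurable M" by (subst measurable_cong[OF dd'[symmetric]])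
        have d': "integrable M d' \<and>
            (\<integral>\<omega>. d' \<omega> \<partial>M) \<le> (\<integral>\<omega>. K * (ex \<omega> + ey \<omega>) \<partial>M)"
        proof (rule integrable_dominated[OF d'M])
          fix \<omega> show "d' \<omega> \<le> K * (ex \<omega> + ey \<omega>)"
            unfolding d'_def ex_def ey_def t_def t'_def by (rule K(4))
        qed (use x'(2) y'(2) in \<open>auto simp: d'_def\<close>)
        have d_int: "integrable M d" using d'[THEN conjunct1] dd' by (subst Bochner_Integration.integrable_cong) auto
        have "(\<integral>\<omega>. d \<omega> \<partial>M) = (\<integral>\<omega>. d' \<omega> \<partial>M)" using dd' by (intro Bochner_Integration.integral_cong) auto
        also have "\<dots> \<le> K * (Ex + Ey)" using d'[THEN conjunct2] x'(2) y'(2) by (simp add: Ex_def Ey_def)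
        also have "\<dots> \<le> K * (c2 * \<eta> ^ k * (E + 1) + c1 * \<eta> ^ k * (E + 1))"
          using K(1) Ex Ey by (intro mult_left_mono add_mono) auto
        finally have d_le: "(\<integral>\<omega>. d \<omega> \<partial>M) \<le> K * (c1 + c2) * \<eta> ^ k * (E + 1)" by (simp add: algebra_simps)
        have "integrable M (\<lambda>\<omega>. (norm (u (Suc k) \<omega> - us))\<^sup>2)"
        proof (rule integrable_dominated[THEN conjunct1])
          show "integrable M (\<lambda>\<omega>. 2 * d \<omega> + 2 * (K2 * K1 * e \<omega>))" using d_int e_int by auto
          fix \<omega>
          have "(norm (upd (u k \<omega>) - us))\<^sup>2 \<le> K2 * K1 * e \<omega>" unfolding e_def by (rule upd_bound)
          then show "(norm (u (Suc k) \<omega> - us))\<^sup>2 \<le> 2 * d \<omega> + 2 * (K2 * K1 * e \<omega>)"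
            using norm_add_sq_le[of "u (Suc k) \<omega> - upd (u k \<omega>)" "upd (u k \<omega>) - us"]
            unfolding d_def by simp
          show "(\<lambda>\<omega>. (norm (u (Suc k) \<omega> - us))\<^sup>2) \<in> borel_measurable M" using uM by measurable
        qed simp
        then have "known (Suc k)" using x'(1) y2 l2 by (simp add: known_def)
        with d_int d_le show ?thesis unfolding d_def E_def e_def by blast
      qed
      have "K * (c1 + c2) > 0" using K(1) c1 c2 by simp
      from that[OF this main] show ?case .
    qed
  qed
qed

lemma all_known: "known k"
proof (induction k)
  case 0
  have "drawn 0 = {}" by (simp add: drawn_def)
  then have U: "u 0 \<in> borel_measurable (past (drawn 0))"
    using init_past[of "{}"] by simp
  have c: "continuous_on UNIV (fst :: (real^'n) \<times> (real^'m) \<times> (real^'p) \<Rightarrow> _)"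
    "continuous_on UNIV (\<lambda>p :: (real^'n) \<times> (real^'m) \<times> (real^'p). fst (snd p))"
    "continuous_on UNIV (\<lambda>p :: (real^'n) \<times> (real^'m) \<times> (real^'p). snd (snd p))"
    by (intro continuous_intros)+
  have m: "x 0 \<in> borel_measurable (past (drawn 0))" "y 0 \<in> borel_measurable (past (drawn 0))"
    "l 0 \<in> borel_measurable (past (drawn 0))"
    using c[THEN borel_measurable_continuous_onI, THEN measurable_compose[OF U]] by simp_all
  obtain K where K: "K > 0" "\<And>u. (norm u)\<^sup>2 \<le> K * G u" using G_lower by blast
  have "integrable M (\<lambda>\<omega>. (norm (u 0 \<omega> - us))\<^sup>2)"
  proof (rule integrable_dominated[THEN conjunct1])
    show "integrable M (\<lambda>\<omega>. K * G (u 0 \<omega> - us))" using init_moment by simp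
    show "(\<lambda>\<omega>. (norm (u 0 \<omega> - us))\<^sup>2) \<in> borel_measurable M"
      using past_measurable[OF drawn_subset U] by measurable
  qed (use K in auto)
  then show ?case using m by (simp add: known_def)
next
  case (Suc k)
  then show ?case using major_iteration_error by blast
qed

lemma G_integrable: "integrable M (\<lambda>\<omega>. G (u k \<omega> - us))"
proof -
  obtain K where K: "K > 0" "\<And>u. G u \<le> K * (norm u)\<^sup>2" using G_upper by blast
  have m: "x k \<in> borel_measurable M" "y k \<in> borel_measurable M" "l k \<in> borel_measurable M"
    using all_known[of k] past_measurable[OF drawn_subset] by (auto simp: known_def)
  have eq: "G (u k \<omega> - us) = (x k \<omega> - xs) \<bullet> (P_hat A \<rho> P *v (x k \<omega> - xs))
      + (y k \<omega> - ys) \<bullet> (Q *v (y k \<omega> - ys)) + 1 / (\<rho> * \<gamma>) * (norm (l k \<omega> - ls))\<^sup>2" for \<omega>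
    by (simp add: G_eq qform_def)
  show ?thesis
  proof (rule integrable_dominated[THEN conjunct1])
    show "(\<lambda>\<omega>. G (u k \<omega> - us)) \<in> borel_measurable M"
      unfolding eq using m
      by (intro borel_measurable_add borel_measurable_times borel_measurable_inner borel_measurable_power
          measurable_compose[OF _ borel_measurable_norm] matrix_measurable borel_measurable_diff borel_measurable_const)
    show "integrable M (\<lambda>\<omega>. K * (norm (u k \<omega> - us))\<^sup>2)" using all_known[of k] by (simp add: known_def)
  qed (use K G_nonneg in auto)
qed

abbreviation "err k \<equiv> \<integral>\<omega>. G (u k \<omega> - us) \<partial>M"

text \<open>Young's inequality splits the new error into that of the exact update and the distance to it;
  its parameter is chosen so that the contraction factor only rises to the midpoint \<open>s\<close> between
  \<open>1 / (1 + \<delta>)\<close> and \<open>q\<close>.\<close>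

theorem geometric_decay:
  assumes \<delta>: "\<delta> > 0" and contr: "\<And>k. AE \<omega> in M. G (upd (u k \<omega>) - us) \<le> 1 / (1 + \<delta>) * G (u k \<omega> - us)"
    and q: "1 / (1 + \<delta>) < q" "\<eta> \<le> q" "q < 1"
  obtains D where "D > 0" "\<And>k. err k \<le> D * q ^ k"
proof -
  obtain C where C: "C > 0" "\<And>k. known k \<Longrightarrow> known (Suc k) \<and> integrable M (\<lambda>\<omega>. (norm (u (Suc k) \<omega> - upd (u k \<omega>)))\<^sup>2) \<and>
      (\<integral>\<omega>. (norm (u (Suc k) \<omega> - upd (u k \<omega>)))\<^sup>2 \<partial>M)
        \<le> C * \<eta> ^ k * ((\<integral>\<omega>. (norm (u k \<omega> - us))\<^sup>2 \<partial>M) + 1)"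
    using major_iteration_error by blast
  obtain K1 where K1: "K1 > 0" "\<And>u. G u \<le> K1 * (norm u)\<^sup>2" using G_upper by blast
  obtain K2 where K2: "K2 > 0" "\<And>u. (norm u)\<^sup>2 \<le> K2 * G u" using G_lower by blast
  define r where "r = 1 / (1 + \<delta>)"
  define s where "s = (r + q) / 2"
  define \<alpha> where "\<alpha> = s * (1 + \<delta>) - 1"
  have "0 < r" "r < q" using q \<delta> by (auto simp: r_def)
  then have s: "r < s" "s < q" "0 \<le> s" by (auto simp: s_def)
  then have \<alpha>: "\<alpha> > 0" using \<delta> by (simp add: \<alpha>_def r_def pos_divide_less_eq)
  have s_eq: "(1 + \<alpha>) * (1 / (1 + \<delta>)) = s" using \<delta> by (simp add: \<alpha>_def)
  define c where "c = (1 + 1 / \<alpha>) * K1 * C * (K2 + 1)"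
  have c: "0 \<le> c" using \<alpha> K1(1) K2(1) C(1) by (simp add: c_def)
  have nn: "0 \<le> err k" for k using G_nonneg by simp
  have rec: "err (Suc k) \<le> s * err k + c * \<eta> ^ k * (err k + 1)" for k
  proof -
    define d where "d \<omega> = (norm (u (Suc k) \<omega> - upd (u k \<omega>)))\<^sup>2" for \<omega>
    have d: "integrable M d" "(\<integral>\<omega>. d \<omega> \<partial>M) \<le> C * \<eta> ^ k * ((\<integral>\<omega>. (norm (u k \<omega> - us))\<^sup>2 \<partial>M) + 1)"
      using C(2)[OF all_known[of k]] unfolding d_def[abs_def] by blast+
    have "(\<integral>\<omega>. (norm (u k \<omega> - us))\<^sup>2 \<partial>M) \<le> (\<integral>\<omega>. K2 * G (u k \<omega> - us) \<partial>M)"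
      using all_known[of k] G_integrable[of k] K2(2) by (intro integral_mono) (auto simp: known_def)
    then have n: "(\<integral>\<omega>. (norm (u k \<omega> - us))\<^sup>2 \<partial>M) \<le> K2 * err k" by simp
    have "AE \<omega> in M. G (u (Suc k) \<omega> - us) \<le> s * G (u k \<omega> - us) + (1 + 1 / \<alpha>) * K1 * d \<omega>"
      using contr[of k]
    proof eventually_elim
      case (elim \<omega>)
      have "G (u (Suc k) \<omega> - us) \<le> (1 + \<alpha>) * G (upd (u k \<omega>) - us) + (1 + 1 / \<alpha>) * G (u (Suc k) \<omega> - upd (u k \<omega>))"
        using G_young[OF \<alpha>, of "upd (u k \<omega>) - us" "u (Suc k) \<omega> - upd (u k \<omega>)"] by simp
      also have "\<dots> \<le> (1 + \<alpha>) * (1 / (1 + \<delta>) * G (u k \<omega> - us)) + (1 + 1 / \<alpha>) * (K1 * d \<omega>)"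
        using elim K1(2)[of "u (Suc k) \<omega> - upd (u k \<omega>)"] \<alpha>
        by (intro add_mono mult_left_mono) (auto simp: d_def)
      finally show ?case using s_eq by (simp only: mult.assoc[symmetric])
    qed
    then have "err (Suc k) \<le> (\<integral>\<omega>. s * G (u k \<omega> - us) + (1 + 1 / \<alpha>) * K1 * d \<omega> \<partial>M)"
      using G_integrable d(1) by (intro integral_mono_AE) auto
    also have "\<dots> = s * err k + (1 + 1 / \<alpha>) * K1 * (\<integral>\<omega>. d \<omega> \<partial>M)"
      using G_integrable d(1) by simp
    also have "\<dots> \<le> s * err k + (1 + 1 / \<alpha>) * K1 * (C * \<eta> ^ k * ((K2 + 1) * (err k + 1)))"
    proof (intro add_left_mono mult_left_mono order_trans[OF d(2)])
      show "(\<integral>\<omega>. (norm (u k \<omega> - us))\<^sup>2 \<partial>M) + 1 \<le> (K2 + 1) * (err k + 1)"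
        using n nn[of k] K2(1) by (simp add: algebra_simps)
    qed (use \<alpha> K1(1) C(1) params in auto)
    also have "\<dots> = s * err k + c * \<eta> ^ k * (err k + 1)" by (simp only: c_def mult_ac)
    finally show ?thesis .
  qed
  from perturbed_linear_recurrence[OF s(3,2) q(3) params(2) q(2) c nn rec] that show ?thesis by blast
qed

end

section \<open>From geometric decay to sample complexity\<close>

text \<open>The loop lengths grow geometrically, so their sum is of the order of its last term, which is
  inversely proportional to the error bound. By minimality of the number \<open>Suc m\<close> of major
  iterations, some iterate from \<open>m\<close> on has error above \<open>\<epsilon>\<close>, so the error bound at \<open>m\<close>
  exceeds \<open>\<epsilon>\<close>.\<close>

lemma sample_complexity_bound:
  fixes e :: "nat \<Rightarrow> real"
  assumes \<eta>: "0 < \<eta>" "\<eta> < 1" and T: "0 < T" and D: "0 < D" "\<And>k. e k \<le> D * \<eta> ^ k"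
    and Ty: "\<And>k. Ty (Suc k) = max ky (nat \<lceil>T / \<eta> ^ k\<rceil>)"
    and Tx: "\<And>k. Tx (Suc k) = max kx (nat \<lceil>T / \<eta> ^ k\<rceil>)"
  shows "\<exists>C>0. \<forall>\<epsilon>>0. real (sample_complexity e Tx Ty \<epsilon>) \<le> C * (1 / \<epsilon>)"
proof -
  define r where "r = 1 / \<eta>"
  have r: "r > 1" using \<eta> by (simp add: r_def)
  define c where "c = (real kx + T + 1) + (real ky + T + 1)"
  have c: "c > 0" using T by (simp add: c_def)
  have len: "real (max m (nat \<lceil>T / \<eta> ^ k\<rceil>)) \<le> (real m + T + 1) * r ^ k" for m k
  proof -
    have "T / \<eta> ^ k = T * r ^ k" by (simp add: r_def power_divide)
    moreover have "real (nat \<lceil>T / \<eta> ^ k\<rceil>) \<le> T / \<eta> ^ k + 1"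
      using T \<eta> by (simp add: of_nat_ceiling)
    ultimately have 1: "real (nat \<lceil>T / \<eta> ^ k\<rceil>) \<le> T * r ^ k + 1" by linarith
    have "real (max m (nat \<lceil>T / \<eta> ^ k\<rceil>)) \<le> real m + real (nat \<lceil>T / \<eta> ^ k\<rceil>)" by simp
    also have "\<dots> \<le> real m * 1 + (T * r ^ k + 1)" using 1 by simp
    also have "\<dots> \<le> real m * r ^ k + (T * r ^ k + r ^ k)"
      using r T by (intro add_mono mult_left_mono one_le_power) auto
    also have "\<dots> = (real m + T + 1) * r ^ k" by (simp add: algebra_simps)
    finally show ?thesis .
  qed
  have total: "real (sample_complexity e Tx Ty \<epsilon>) \<le> c * (r ^ major_iterations e \<epsilon> / (r - 1))" for \<epsilon>
  proof -
    define K where "K = major_iterations e \<epsilon>"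
    have "sample_complexity e Tx Ty \<epsilon> = (\<Sum>k<K. (Ty (Suc k) - 1) + (Tx (Suc k) - 1))"
      unfolding sample_complexity_def K_def[symmetric]
      by (rule sum.reindex_bij_witness[of _ Suc "\<lambda>k. k - 1"]) auto
    then have "real (sample_complexity e Tx Ty \<epsilon>) \<le> (\<Sum>k<K. real (Ty (Suc k)) + real (Tx (Suc k)))"
      unfolding of_nat_sum by (auto intro!: sum_mono)
    also have "\<dots> \<le> (\<Sum>k<K. c * r ^ k)"
    proof (rule sum_mono)
      show "real (Ty (Suc k)) + real (Tx (Suc k)) \<le> c * r ^ k" for k
        using len[of ky k] len[of kx k]
        unfolding Ty Tx c_def distrib_right[of "real kx + T + 1"] by linarith
    qed
    also have "\<dots> = c * ((r ^ K - 1) / (r - 1))"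
      using r by (simp add: sum_distrib_left[symmetric] geometric_sum)
    also have "\<dots> \<le> c * (r ^ K / (r - 1))"
      using r c by (intro mult_left_mono divide_right_mono) auto
    finally show ?thesis by (simp add: K_def)
  qed
  define C where "C = c * (D * r) / (r - 1)"
  have "C > 0" using c D r by (simp add: C_def)
  moreover have "real (sample_complexity e Tx Ty \<epsilon>) \<le> C * (1 / \<epsilon>)" if \<epsilon>: "\<epsilon> > 0" for \<epsilon>
  proof (cases "major_iterations e \<epsilon>")
    case 0
    then show ?thesis using \<open>C > 0\<close> \<epsilon> by (simp add: sample_complexity_def)
  next
    case (Suc m)
    then have "\<not> (\<forall>k\<ge>m. e k \<le> \<epsilon>)"
      using not_less_Least[of m "\<lambda>K. \<forall>k\<ge>K. e k \<le> \<epsilon>"] by (simp add: major_iterations_def)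
    then obtain k where k: "k \<ge> m" "\<epsilon> < e k" by (auto simp: not_le)
    have "\<epsilon> < D * \<eta> ^ k" using k(2) D(2)[of k] by linarith
    also have "\<dots> \<le> D * \<eta> ^ m" using k(1) \<eta> D(1) by (intro mult_left_mono power_decreasing) auto
    finally have "r ^ m \<le> D / \<epsilon>" using \<eta> \<epsilon> by (simp add: r_def power_divide field_simps)
    then have "c * (r ^ Suc m / (r - 1)) \<le> c * (r * (D / \<epsilon>) / (r - 1))"
      unfolding power_Suc using r c by (intro mult_left_mono divide_right_mono) auto
    then show ?thesis using total[of \<epsilon>] Suc by (simp add: C_def mult_ac)
  qed
  ultimately show ?thesis by blast
qed

theorem theorem5:
  fixes M :: "'w measure"
    and \<Xi> :: "(real^'d) set" and \<xi> :: "'w \<Rightarrow> real^'d"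
    and ft :: "real^'n \<Rightarrow> real^'d \<Rightarrow> real" and f :: "real^'n \<Rightarrow> real"
    and gt :: "real^'m \<Rightarrow> real^'d \<Rightarrow> real" and g :: "real^'m \<Rightarrow> real"
    and A :: "real^'n^'p" and B :: "real^'m^'p" and b :: "real^'p"
    and P :: "real^'n^'n" and Q :: "real^'m^'m"
    and \<rho> \<gamma> \<gamma>x \<gamma>y :: real
    and Tx Ty :: "nat \<Rightarrow> nat"
    and \<xi>x \<xi>y :: "nat \<Rightarrow> nat \<Rightarrow> 'w \<Rightarrow> real^'d"
    and xi :: "nat \<Rightarrow> nat \<Rightarrow> 'w \<Rightarrow> real^'n" and yi :: "nat \<Rightarrow> nat \<Rightarrow> 'w \<Rightarrow> real^'m"
    and x :: "nat \<Rightarrow> 'w \<Rightarrow> real^'n" and y :: "nat \<Rightarrow> 'w \<Rightarrow> real^'m" and l :: "nat \<Rightarrow> 'w \<Rightarrow> real^'p"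
    and u :: "nat \<Rightarrow> 'w \<Rightarrow> (real^'n) \<times> (real^'m) \<times> (real^'p)"
    and us :: "(real^'n) \<times> (real^'m) \<times> (real^'p)"
    and \<mu>f \<sigma>g Lf Lg v1x v2x v1y v2y cx Lx cy Ly R T \<eta> :: real
  assumes prob: "prob_space M"
    and xi_rv: "\<xi> \<in> M \<rightarrow>\<^sub>M restrict_space borel \<Xi>"
    and objectives: "stochastic_objective M \<Xi> \<xi> ft f" "stochastic_objective M \<Xi> \<xi> gt g"
    and scalars: "\<rho> > 0" "\<gamma> > 0" "\<gamma>x > 0" "\<gamma>y > 0"
    and run: "\<And>\<omega>. \<omega> \<in> space M \<Longrightarrow>
      si_admm_path A B b \<rho> \<gamma> \<gamma>x \<gamma>y P Q f g ft gt Tx Ty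
        (\<lambda>k j. \<xi>x k j \<omega>) (\<lambda>k j. \<xi>y k j \<omega>) (\<lambda>k j. xi k j \<omega>) (\<lambda>k j. yi k j \<omega>)
        (\<lambda>k. x k \<omega>) (\<lambda>k. y k \<omega>) (\<lambda>k. l k \<omega>)"
    and u_eq: "u = (\<lambda>k \<omega>. (x k \<omega>, y k \<omega>, l k \<omega>))"
    and iid: "iid_copies M (restrict_space borel \<Xi>) \<xi> (samples \<xi>x \<xi>y) (sample_index Tx Ty)"
    and init_indep: "indep_rv M borel (u 0)
      (Pi\<^sub>M (sample_index Tx Ty) (\<lambda>_. restrict_space borel \<Xi>))
      (\<lambda>\<omega>. \<lambda>i\<in>sample_index Tx Ty. samples \<xi>x \<xi>y i \<omega>)"
    and kkt: "is_KKT A B b f g us"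
    and pd: "pos_def_mat Q" "pos_def_mat (P_hat A \<rho> P)"
    and sc: "strongly_convex \<mu>f f" "strongly_convex \<sigma>g g"
    and smooth: "lipschitz_gradient Lf f" "lipschitz_gradient Lg g"
    and full_row_rank: "rank (hconcat A B) = CARD('p)"
    and moments: "noise_moments M \<xi> ft f v1x v2x" "noise_moments M \<xi> gt g v1y v2y"
    and gamma_cond: "P \<noteq> 0 \<longrightarrow> pos_def_mat ((2 - \<gamma>) *\<^sub>R P - ((\<gamma> - 1) * \<rho>) *\<^sub>R (transpose A ** A))"
      "P = 0 \<longrightarrow> \<gamma> = 1"
    and cy: "\<And>x0 l0 z. strongly_convex cy (\<lambda>v. aug_lag A B b \<rho> f g x0 v l0 + 1/2 * qform Q (v - z))"
    and Ly: "\<And>x0 l0 z. lipschitz_gradient Ly (\<lambda>v. aug_lag A B b \<rho> f g x0 v l0 + 1/2 * qform Q (v - z))"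
    and cx: "\<And>y0 l0 z. strongly_convex cx (\<lambda>v. aug_lag A B b \<rho> f g v y0 l0 + 1/2 * qform P (v - z))"
    and Lx: "\<And>y0 l0 z. lipschitz_gradient Lx (\<lambda>v. aug_lag A B b \<rho> f g v y0 l0 + 1/2 * qform P (v - z))"
    and steps: "2 * cx * \<gamma>x > 1" "2 * cy * \<gamma>y > 1"
    and init_moment: "integrable M (\<lambda>\<omega>. G_sqnorm A \<rho> \<gamma> P Q (u 0 \<omega> - us))"
    and params: "R > 0" "T > 0" "0 < \<eta>" "\<eta> < 1"
    and Ty: "\<And>k. Ty (Suc k) = max (inner_threshold cy Ly v1y R \<gamma>y) (nat \<lceil>T / \<eta> ^ k\<rceil>)"
    and Tx: "\<And>k. Tx (Suc k) = max (inner_threshold cx Lx v1x R \<gamma>x) (nat \<lceil>T / \<eta> ^ k\<rceil>)"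
  shows
    "(\<exists>D q. D > 0 \<and> 0 < q \<and> q < 1 \<and>
       (\<forall>k. integrable M (\<lambda>\<omega>. G_sqnorm A \<rho> \<gamma> P Q (u k \<omega> - us)) \<and>
            (\<integral>\<omega>. G_sqnorm A \<rho> \<gamma> P Q (u k \<omega> - us) \<partial>M) \<le> D * q ^ k))
     \<and>
     (\<forall>\<delta>. \<delta> > 0 \<longrightarrow>
       (\<forall>k. AE \<omega> in M. G_sqnorm A \<rho> \<gamma> P Q (exact_update A B b \<rho> \<gamma> P Q f g (u k \<omega>) - us)
                          \<le> 1 / (1 + \<delta>) * G_sqnorm A \<rho> \<gamma> P Q (u k \<omega> - us)) \<longrightarrow>
       \<eta> > 1 / (1 + \<delta>) \<longrightarrow>
       (\<exists>C>0. \<forall>\<epsilon>. 0 < \<epsilon> \<and> \<epsilon> \<le> 1 / exp 1 \<longrightarrow>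
          real (sample_complexity (\<lambda>k. \<integral>\<omega>. G_sqnorm A \<rho> \<gamma> P Q (u k \<omega> - us) \<partial>M) Tx Ty \<epsilon>)
            \<le> C * (1 / \<epsilon>)))"
proof -
  obtain xs ys ls where us: "us = (xs, ys, ls)" by (metis prod_cases3)
  define ky where "ky = inner_threshold cy Ly v1y R \<gamma>y"
  define kx where "kx = inner_threshold cx Lx v1x R \<gamma>x"
  note T0 = params(2) and \<eta> = params(3,4)
  interpret prob_space M by (rule prob)
  interpret si_admm A B b P Q \<rho> \<gamma> f g xs ys ls \<mu>f \<sigma>g Lf Lg cx Lx cy Ly M \<Xi> \<xi> \<xi>x \<xi>y Tx Ty x y l
    ft gt xi yi \<gamma>x \<gamma>y v1x v2x v1y v2y T \<eta> kx ky
  proof unfold_locales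
    show "1 \<le> kx" "1 \<le> ky" by (simp_all add: kx_def ky_def inner_threshold_def)
  qed (use assms in \<open>simp_all add: us u_eq kx_def ky_def\<close>)
  have G_int: "integrable M (\<lambda>\<omega>. G (u k \<omega> - us))" for k
    using G_integrable[of k] by (simp add: us u_eq)
  have decay: "\<exists>D>0. \<forall>k. (\<integral>\<omega>. G (u k \<omega> - us) \<partial>M) \<le> D * q ^ k"
    if "\<delta> > 0" "\<And>k. AE \<omega> in M. G (upd (u k \<omega>) - us) \<le> 1 / (1 + \<delta>) * G (u k \<omega> - us)"
      "1 / (1 + \<delta>) < q" "\<eta> \<le> q" "q < 1" for \<delta> q
    using geometric_decay[of \<delta> q] that unfolding us u_eq by blast
  have part_i: "\<exists>D q. D > 0 \<and> 0 < q \<and> q < 1 \<and>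
      (\<forall>k. integrable M (\<lambda>\<omega>. G (u k \<omega> - us)) \<and> (\<integral>\<omega>. G (u k \<omega> - us) \<partial>M) \<le> D * q ^ k)"
  proof -
    obtain \<delta> where \<delta>: "\<delta> > 0" "\<And>v. G (upd v - us) \<le> 1 / (1 + \<delta>) * G (v - us)"
      using exact_contraction unfolding us by blast
    have "1 / (1 + \<delta>) < 1" using \<delta>(1) by simp
    then obtain q where q: "max \<eta> (1 / (1 + \<delta>)) < q" "q < 1"
      using \<eta> dense[of "max \<eta> (1 / (1 + \<delta>))" 1] by auto
    then obtain D where "D > 0" "\<forall>k. (\<integral>\<omega>. G (u k \<omega> - us) \<partial>M) \<le> D * q ^ k"
      using decay[of \<delta> q] \<delta> by auto
    moreover have "0 < q" using q(1) \<eta> by simp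
    ultimately show ?thesis using q(2) G_int by blast
  qed
  have part_ii: "\<exists>C>0. \<forall>\<epsilon>. 0 < \<epsilon> \<and> \<epsilon> \<le> 1 / exp 1 \<longrightarrow>
      real (sample_complexity (\<lambda>k. \<integral>\<omega>. G (u k \<omega> - us) \<partial>M) Tx Ty \<epsilon>) \<le> C * (1 / \<epsilon>)"
    if \<delta>: "\<delta> > 0" "\<forall>k. AE \<omega> in M. G (upd (u k \<omega>) - us) \<le> 1 / (1 + \<delta>) * G (u k \<omega> - us)"
      "\<eta> > 1 / (1 + \<delta>)" for \<delta>
  proof -
    obtain D where D: "D > 0" "\<And>k. (\<integral>\<omega>. G (u k \<omega> - us) \<partial>M) \<le> D * \<eta> ^ k"
      using decay[of \<delta> \<eta>] \<delta> \<eta> by auto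
    from sample_complexity_bound[OF \<eta> T0 D Ty Tx] obtain C where "C > 0"
      "\<forall>\<epsilon>>0. real (sample_complexity (\<lambda>k. \<integral>\<omega>. G (u k \<omega> - us) \<partial>M) Tx Ty \<epsilon>) \<le> C * (1 / \<epsilon>)"
      by blast
    then show ?thesis by (intro exI[of _ C]) simp
  qed
  show ?thesis
    by (rule conjI[OF part_i], intro allI impI) (rule part_ii, assumption+)
qed

end
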